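(* Let $T>0$, $d\ge 1$, $x\in\mathbb{R}^d$, and let $W$ be a standard $d$-dimensional Brownian motion on a probability space $(\Omega,\mathcal{F},P)$. Let $b:[0,T]\times\mathbb{R}^d\to\mathbb{R}^d$ be a Borel measurable mapping satisfying the following conditions: 1. there exists $M_1\in L^{q_1}([0,T],\mathbb{R})$ such that $|b(t,y)|\le M_1(t)$ for all $t\in[0,T]$, $y\in\mathbb{R}^d$; 2. there exist $M_2\in L^{q_2}([0,T],\mathbb{R})$ and $\beta>0$ such that $|b(t,y)-b(t,z)|\le M_2(t)|y-z|^{\beta}$ for all $t\in[0,T]$, $y,z\in\mathbb{R}^d$; 3. $q_1\ge q_2>2$, $\beta>0$ and $\frac{\beta}{p_1}+\frac{1}{p_2}>1$, where $\frac1{p_1}+\frac1{q_1}=1$ and $\frac1{p_2}+\frac1{q_2}=1$. Then there exists a set $\Omega'$ with $P(\Omega')=1$ such that for each $\omega\in\Omega'$ the equation $$X_t=x+W_t(\omega)+\int_0^t b(s,X_s)\,ds,\qquad t\in[0,T],$$ has exactly one solution.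
   Context: The Brownian motion $W$ starts at $0$ and has continuous paths. For a fixed path $W(\omega)$, a solution of the equation is a continuous function $X:[0,T]\to\mathbb{R}^d$ satisfying the integral equation for every $t\in[0,T]$; thus existence and uniqueness are asserted pathwise, in the class of all continuous functions, and not only among adapted processes. *)

theory Defs
  imports "HOL-Probability.Probability"
begin

text \<open>
  The Lebesgue space of exponent \<open>q\<close> (intended for \<open>1 \<le> q \<le> \<infinity>\<close>). Its elements are genuine functions,
  not classes modulo equality almost everywhere, so that they can occur in bounds that hold at every point.
\<close>

definition Lq_space :: "'a measure \<Rightarrow> ereal \<Rightarrow> ('a \<Rightarrow> real) set" where
  "Lq_space M q = {f \<in> borel_measurable M.
     if q = \<infinity> then esssup M (\<lambda>x. ereal \<bar>f x\<bar>) < \<infinity>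
     else integrable M (\<lambda>x. \<bar>f x\<bar> powr real_of_ereal q)}"

text \<open>
  Standard Brownian motion with time set \<open>{0..T}\<close>; a Brownian motion with time set \<open>{0..}\<close> gives one by
  restriction. The density below is that of the normal law with mean \<open>0\<close> and covariance matrix
  \<open>(t - s) I\<close>; the second argument of \<open>normal_density\<close> is the standard deviation.
\<close>

definition standard_brownian_motion ::
    "'w measure \<Rightarrow> real \<Rightarrow> (real \<Rightarrow> 'w \<Rightarrow> real ^ 'n) \<Rightarrow> bool" where
  "standard_brownian_motion M T W \<longleftrightarrow>
     prob_space M \<and>
     (\<forall>t\<in>{0..T}. W t \<in> borel_measurable M) \<and>
     (\<forall>\<omega>\<in>space M. W 0 \<omega> = 0) \<and>
     (\<forall>\<omega>\<in>space M. continuous_on {0..T} (\<lambda>t. W t \<omega>)) \<and>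
     (\<forall>(n::nat) (t::nat \<Rightarrow> real).
        (\<forall>i\<le>n. t i \<in> {0..T}) \<and> (\<forall>i<n. t i < t (Suc i)) \<longrightarrow>
        prob_space.indep_vars M (\<lambda>_. borel) (\<lambda>i \<omega>. W (t (Suc i)) \<omega> - W (t i) \<omega>) {..<n}) \<and>
     (\<forall>s t. 0 \<le> s \<and> s < t \<and> t \<le> T \<longrightarrow>
        distributed M lborel (\<lambda>\<omega>. W t \<omega> - W s \<omega>)
          (\<lambda>z. ennreal (\<Prod>i\<in>UNIV. normal_density 0 (sqrt (t - s)) (z $ i))))"

text \<open>
  \<open>X\<close> solves the integral equation with initial value \<open>x\<close>, drift \<open>b\<close> and the fixed path \<open>w\<close> as noise.
  Integrability is required explicitly because the Bochner integral of a non-integrable function is \<open>0\<close>.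
  A function on \<open>{0..T}\<close> is represented by its extension with the value \<open>undefined\<close> elsewhere, so that
  equality of solutions is equality on \<open>{0..T}\<close>.
\<close>

definition solves_integral_eq ::
    "real \<Rightarrow> real ^ 'n \<Rightarrow> (real \<Rightarrow> real ^ 'n) \<Rightarrow> (real \<times> (real ^ 'n) \<Rightarrow> real ^ 'n) \<Rightarrow>
      (real \<Rightarrow> real ^ 'n) \<Rightarrow> bool" where
  "solves_integral_eq T x w b X \<longleftrightarrow>
     X \<in> extensional {0..T} \<and>
     continuous_on {0..T} X \<and>
     set_integrable lborel {0..T} (\<lambda>s. b (s, X s)) \<and>
     (\<forall>t\<in>{0..T}. X t = x + w t + set_lebesgue_integral lborel {0..t} (\<lambda>s. b (s, X s)))"

end

theory Submission
  imports Defs "HOL-Complex_Analysis.Great_Picard"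
begin

text \<open>
  Fix a path of \<open>W\<close>. Existence is a theorem of Peano and Caratheodory type: the Euler schemes with frozen
  drift are equicontinuous, and a limit point solves the equation because \<open>b\<close> is continuous in space
  (\<open>solution_exists\<close>).

  Uniqueness comes from comparing an arbitrary solution \<open>Y\<close> with an Euler scheme. On each of \<open>N\<close> cells of
  length \<open>h\<close> the scheme first adds the Brownian increment and then the integral of \<open>b\<close> over the cell,
  mollified by the heat semigroup at time \<open>h\<close>. Started from \<open>Y\<close> at the beginning of cell \<open>i\<close>, it misses
  \<open>Y\<close> at the end of the cell by an error whose sum over \<open>i\<close> is of the order of a positive power of \<open>h\<close>
  (\<open>local_error\<close>, \<open>path_error_AE\<close>). The flow of the scheme carries each error on to later times, and by
  telescoping \<open>Y\<close> differs from the scheme by at most the sum of the transported errors. Following an idea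
  of Shaposhnikov for Davie's uniqueness theorem, this needs nothing but regularity of the flow in its
  initial value: a Hoelder exponent close to 1 and a constant that grows slower than every power of \<open>N\<close>
  (\<open>flow_holder_AE\<close>). Such regularity is a property of the path alone, so it serves every
  solution, adapted or not, and all solutions are limits of the same sequence (\<open>grid_error\<close>,
  \<open>solutions_unique_AE\<close>).

  The Hoelder constants follow by chaining over dyadic lattices (\<open>chaining\<close>, \<open>lattice_holder_prob\<close>) from
  moment bounds for the distance of two Euler schemes with the same noise that are uniform in \<open>N\<close>
  (\<open>euler_flow_moment\<close>). Since the drift is not Lipschitz, its effect has to be averaged by the noise,
  which a discrete Zvonkin transformation achieves. Put \<open>u N = 0\<close> and let \<open>u i\<close> be the image under the
  heat semigroup of \<open>\<rho> * u (i + 1) + F i\<close>, where \<open>F i\<close> is the increment of \<open>y + u (i + 1) y\<close> caused by the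
  drift of step \<open>i\<close>. For \<open>\<rho> = 1\<close> the transformed state \<open>y + u i y\<close> is a martingale along the scheme; a
  damping \<open>\<rho> < 1\<close> costs a drift of order \<open>h\<close> and makes \<open>u i\<close> Lipschitz with constant \<open>1 / 2\<close>
  (\<open>u_bounds\<close>, \<open>damping_exists\<close>), because the singularity of the heat kernel gradient, of order
  \<open>t powr (- 1 / 2)\<close>, is integrable against a function in \<open>L\<^sup>q\<close> with \<open>q > 2\<close>. By Duhamel's formula \<open>u_sum\<close>
  the second differences of \<open>u i\<close> are bounded by numbers that are square summable with weight \<open>h\<close>
  (\<open>u_second_lipschitz\<close>, \<open>sum_convolution_square_le\<close>). So one step multiplies the even moments of the
  transformed distance by at most \<open>1 + C * \<kappa> i\<close> with a bounded sum of the \<open>\<kappa> i\<close> (\<open>gap_moment\<close>).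
\<close>

section \<open>Gaussian measures on Euclidean space\<close>

definition gauss :: "real \<Rightarrow> real ^ 'n::finite \<Rightarrow> real" where
  "gauss t z = (\<Prod>i\<in>UNIV. normal_density 0 (sqrt t) (z $ i))"

lemma gauss_eq:
  fixes z :: "real ^ 'n::finite"
  assumes "t > 0"
  shows "gauss t z = (1 / sqrt (2 * pi * t)) ^ CARD('n) * exp (- (norm z)\<^sup>2 / (2 * t))"
proof -
  have "(norm z)\<^sup>2 = (\<Sum>i\<in>UNIV. (z $ i)\<^sup>2)"
    unfolding power2_norm_eq_inner inner_vec_def by (simp add: power2_eq_square)
  then have "- (norm z)\<^sup>2 / (2 * t) = (\<Sum>i\<in>UNIV. - (z $ i)\<^sup>2 / (2 * t))"
    by (simp add: sum_divide_distrib sum_negf)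
  then show ?thesis
    using assms by (simp add: gauss_def normal_density_def prod_dividef exp_sum power_divide)
qed

lemma gauss_pos: "t > 0 \<Longrightarrow> 0 < gauss t z"
  by (simp add: gauss_eq)

lemma gauss_nonneg [simp]: "0 \<le> gauss t z"
  by (simp add: gauss_def prod_nonneg)

lemma measurable_gauss [measurable]: "gauss t \<in> borel_measurable borel"
  unfolding gauss_def[abs_def] by measurable

lemma Basis_vec_real: "(Basis :: (real ^ 'n::finite) set) = range (\<lambda>i. axis i 1)"
  by (auto simp: Basis_vec_def)

lemma nn_integral_gauss:
  assumes "t > 0"
  shows "(\<integral>\<^sup>+z. ennreal (gauss t z) \<partial>(lborel :: (real ^ 'n::finite) measure)) = 1"
proof -
  have inj: "inj (\<lambda>i::'n. axis i (1::real))"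
    by (auto simp: inj_on_def axis_eq_axis)
  have "ennreal (gauss t z) = (\<Prod>b\<in>Basis. ennreal (normal_density 0 (sqrt t) (z \<bullet> b)))" for z :: "real ^ 'n"
    unfolding gauss_def Basis_vec_real
    by (subst prod.reindex[OF inj]) (simp add: prod_ennreal inner_axis)
  then have "(\<integral>\<^sup>+z. ennreal (gauss t z) \<partial>(lborel :: (real ^ 'n) measure))
      = (\<Prod>b\<in>(Basis::(real^'n) set). \<integral>\<^sup>+x. ennreal (normal_density 0 (sqrt t) x) \<partial>lborel)"
    by (simp add: nn_integral_lborel_prod[where f="\<lambda>_ x. ennreal (normal_density 0 (sqrt t) x)"])
  also have "(\<integral>\<^sup>+x. ennreal (normal_density 0 (sqrt t) x) \<partial>lborel) = 1"
    using assms by (subst nn_integral_eq_integral) (auto simp: integrable_normal_density integral_normal_density)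
  finally show ?thesis by simp
qed

definition gauss_measure :: "real \<Rightarrow> (real ^ 'n::finite) measure" where
  "gauss_measure t = density lborel (\<lambda>z. ennreal (gauss t z))"

lemma sets_gauss_measure [simp, measurable_cong]: "sets (gauss_measure t) = sets borel"
  and space_gauss_measure [simp]: "space (gauss_measure t) = UNIV"
  by (simp_all add: gauss_measure_def)

lemma prob_space_gauss_measure: "t > 0 \<Longrightarrow> prob_space (gauss_measure t)"
  by (intro prob_spaceI) (simp add: gauss_measure_def emeasure_density nn_integral_gauss)

lemma gauss_shift:
  fixes w a :: "real ^ 'n::finite"
  assumes "t > 0"
  shows "gauss t (w - a) = gauss t w * exp ((w \<bullet> a) / t - (norm a)\<^sup>2 / (2 * t))"
proof -
  have "(norm (w - a))\<^sup>2 = (norm w)\<^sup>2 - 2 * (w \<bullet> a) + (norm a)\<^sup>2"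
    by (simp add: power2_norm_eq_inner inner_diff_left inner_diff_right inner_commute)
  then have "- (norm (w - a))\<^sup>2 / (2 * t) = - (norm w)\<^sup>2 / (2 * t) + ((w \<bullet> a) / t - (norm a)\<^sup>2 / (2 * t))"
    unfolding \<open>(norm (w - a))\<^sup>2 = _\<close> using assms by (simp add: field_simps)
  then show ?thesis
    using assms by (simp only: gauss_eq exp_add)
qed

text \<open>
  Completing the square. Integrated over \<open>z\<close>, this is the semigroup property of the Gaussian kernels.
\<close>

lemma gauss_mult:
  fixes z w :: "real ^ 'n::finite"
  assumes s: "s > 0" and t: "t > 0"
  shows "gauss s z * gauss t (w - z) = gauss (s + t) w * gauss (s * t / (s + t)) (z - (s / (s + t)) *\<^sub>R w)"
proof -
  have st: "s + t > 0" "s * t / (s + t) > 0" using s t by auto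
  have n1: "(norm (w - z))\<^sup>2 = w \<bullet> w - 2 * (w \<bullet> z) + z \<bullet> z"
    by (simp add: power2_norm_eq_inner inner_diff_left inner_diff_right inner_commute)
  have n2: "(norm (z - (s / (s + t)) *\<^sub>R w))\<^sup>2
      = z \<bullet> z - 2 * (s / (s + t)) * (w \<bullet> z) + (s / (s + t))\<^sup>2 * (w \<bullet> w)"
    unfolding power2_norm_eq_inner
    by (simp add: inner_diff_left inner_diff_right inner_commute power2_eq_square)
  have key: "- c / (2 * s) + - (a - 2 * b + c) / (2 * t)
      = - a / (2 * (s + t)) + - (c - 2 * (s / (s + t)) * b + (s / (s + t))\<^sup>2 * a) / (2 * (s * t / (s + t)))"
    for a b c :: real
    using s t st by (simp add: divide_simps power2_eq_square) (simp add: algebra_simps)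
  have e: "exp (- (norm z)\<^sup>2 / (2 * s)) * exp (- (norm (w - z))\<^sup>2 / (2 * t)) =
      exp (- (norm w)\<^sup>2 / (2 * (s + t))) * exp (- (norm (z - (s / (s + t)) *\<^sub>R w))\<^sup>2 / (2 * (s * t / (s + t))))"
    unfolding exp_add[symmetric] n1 n2 power2_norm_eq_inner[of z] power2_norm_eq_inner[of w]
    by (subst key) simp
  have c: "1 / sqrt (2 * pi * s) * (1 / sqrt (2 * pi * t))
      = 1 / sqrt (2 * pi * (s + t)) * (1 / sqrt (2 * pi * (s * t / (s + t))))"
    using s t st by (simp add: real_sqrt_mult[symmetric] real_sqrt_divide[symmetric] field_simps)
  have c': "(1 / sqrt (2 * pi * s)) ^ CARD('n) * (1 / sqrt (2 * pi * t)) ^ CARD('n)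
      = (1 / sqrt (2 * pi * (s + t))) ^ CARD('n) * (1 / sqrt (2 * pi * (s * t / (s + t)))) ^ CARD('n)"
    unfolding power_mult_distrib[symmetric] c ..
  show ?thesis
    unfolding gauss_eq[OF s] gauss_eq[OF t] gauss_eq[OF st(1)] gauss_eq[OF st(2)]
    using arg_cong2[OF c' e, of times] by (simp add: mult_ac)
qed

lemma nn_integral_lborel_shift:
  fixes f :: "'a::euclidean_space \<Rightarrow> ennreal"
  assumes [measurable]: "f \<in> borel_measurable borel"
  shows "(\<integral>\<^sup>+w. f (c + w) \<partial>lborel) = (\<integral>\<^sup>+w. f w \<partial>lborel)"
proof -
  have "(\<integral>\<^sup>+w. f w \<partial>lborel) = (\<integral>\<^sup>+w. f w \<partial>distr lborel borel ((+) c))"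
    by (simp add: lborel_distr_plus)
  also have "\<dots> = (\<integral>\<^sup>+w. f (c + w) \<partial>lborel)"
    by (subst nn_integral_distr) auto
  finally show ?thesis ..
qed

lemma nn_integral_gauss_measure:
  assumes [measurable]: "f \<in> borel_measurable borel"
  shows "(\<integral>\<^sup>+z. f z \<partial>gauss_measure t) = (\<integral>\<^sup>+z. ennreal (gauss t z) * f z \<partial>lborel)"
  unfolding gauss_measure_def by (subst nn_integral_density) auto

lemma nn_integral_gauss_add:
  fixes f :: "real ^ 'n::finite \<Rightarrow> ennreal"
  assumes s: "s > 0" and t: "t > 0" and [measurable]: "f \<in> borel_measurable borel"
  shows "(\<integral>\<^sup>+z. \<integral>\<^sup>+w. f (z + w) \<partial>gauss_measure t \<partial>gauss_measure s) = (\<integral>\<^sup>+w. f w \<partial>gauss_measure (s + t))"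
proof -
  interpret T: prob_space "gauss_measure t :: (real ^ 'n) measure" by (rule prob_space_gauss_measure[OF t])
  have st: "s + t > 0" "s * t / (s + t) > 0" using s t by auto
  have "(\<integral>\<^sup>+z. \<integral>\<^sup>+w. f (z + w) \<partial>gauss_measure t \<partial>gauss_measure s)
      = (\<integral>\<^sup>+z. ennreal (gauss s z) * (\<integral>\<^sup>+w. f (z + w) \<partial>gauss_measure t) \<partial>lborel)"
    by (rule nn_integral_gauss_measure) measurable
  also have "\<dots> = (\<integral>\<^sup>+z. ennreal (gauss s z) * (\<integral>\<^sup>+w. ennreal (gauss t (w - z)) * f w \<partial>lborel) \<partial>lborel)"
  proof (intro nn_integral_cong arg_cong2[where f=times] refl)
    fix z :: "real ^ 'n"
    have "(\<integral>\<^sup>+w. f (z + w) \<partial>gauss_measure t) = (\<integral>\<^sup>+w. ennreal (gauss t w) * f (z + w) \<partial>lborel)"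
      by (rule nn_integral_gauss_measure) measurable
    also have "\<dots> = (\<integral>\<^sup>+w. ennreal (gauss t ((z + w) - z)) * f (z + w) \<partial>lborel)" by simp
    also have "\<dots> = (\<integral>\<^sup>+w. ennreal (gauss t (w - z)) * f w \<partial>lborel)"
      by (rule nn_integral_lborel_shift[where f="\<lambda>w. ennreal (gauss t (w - z)) * f w"]) measurable
    finally show "(\<integral>\<^sup>+w. f (z + w) \<partial>gauss_measure t) = (\<integral>\<^sup>+w. ennreal (gauss t (w - z)) * f w \<partial>lborel)" .
  qed
  also have "\<dots> = (\<integral>\<^sup>+z. (\<integral>\<^sup>+w. ennreal (gauss s z) * (ennreal (gauss t (w - z)) * f w) \<partial>lborel) \<partial>lborel)"
    by (intro nn_integral_cong nn_integral_cmult[symmetric]) measurable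
  also have "\<dots> = (\<integral>\<^sup>+w. (\<integral>\<^sup>+z. ennreal (gauss s z) * (ennreal (gauss t (w - z)) * f w) \<partial>lborel) \<partial>lborel)"
    by (intro lborel_pair.Fubini') measurable
  also have "\<dots> = (\<integral>\<^sup>+w. ennreal (gauss (s + t) w) * f w \<partial>lborel)"
  proof (intro nn_integral_cong)
    fix w :: "real ^ 'n"
    have "(\<integral>\<^sup>+z. ennreal (gauss s z) * (ennreal (gauss t (w - z)) * f w) \<partial>lborel)
       = (\<integral>\<^sup>+z. (ennreal (gauss (s + t) w) * f w) * ennreal (gauss (s * t / (s + t)) (z - (s / (s + t)) *\<^sub>R w)) \<partial>lborel)"
      using gauss_mult[OF s t, of _ w]
      by (intro nn_integral_cong) (simp add: mult.assoc[symmetric] ennreal_mult[symmetric], simp add: ennreal_mult mult_ac)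
    also have "\<dots> = (ennreal (gauss (s + t) w) * f w) * (\<integral>\<^sup>+z. ennreal (gauss (s * t / (s + t)) (z - (s / (s + t)) *\<^sub>R w)) \<partial>lborel)"
      by (intro nn_integral_cmult) measurable
    also have "(\<integral>\<^sup>+z. ennreal (gauss (s * t / (s + t)) (z - (s / (s + t)) *\<^sub>R w)) \<partial>lborel) = 1"
      using nn_integral_lborel_shift[of "\<lambda>z. ennreal (gauss (s * t / (s + t)) z)" "- ((s / (s + t)) *\<^sub>R w)"]
        nn_integral_gauss[OF st(2), where 'n='n] by (simp add: add.commute)
    finally show "(\<integral>\<^sup>+z. ennreal (gauss s z) * (ennreal (gauss t (w - z)) * f w) \<partial>lborel) = ennreal (gauss (s + t) w) * f w"
      by simp
  qed
  also have "\<dots> = (\<integral>\<^sup>+w. f w \<partial>gauss_measure (s + t))"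
    by (rule nn_integral_gauss_measure[symmetric]) measurable
  finally show ?thesis .
qed

lemma distr_gauss_measure_add:
  assumes s: "s > 0" and t: "t > 0"
  shows "distr (gauss_measure s \<Otimes>\<^sub>M gauss_measure t) borel (\<lambda>(z, w). z + w)
     = (gauss_measure (s + t) :: (real ^ 'n::finite) measure)" (is "?L = ?R")
proof (rule measure_eqI)
  fix A assume "A \<in> sets ?L"
  then have [measurable]: "A \<in> sets borel" by simp
  interpret T: prob_space "gauss_measure t :: (real ^ 'n) measure" by (rule prob_space_gauss_measure[OF t])
  have "emeasure ?L A = (\<integral>\<^sup>+x. indicator A x \<partial>?L)" by simp
  also have "\<dots> = (\<integral>\<^sup>+p. indicator A (fst p + snd p) \<partial>(gauss_measure s \<Otimes>\<^sub>M gauss_measure t))"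
    by (subst nn_integral_distr) (auto simp: case_prod_beta)
  also have "\<dots> = (\<integral>\<^sup>+z. \<integral>\<^sup>+w. indicator A (z + w) \<partial>gauss_measure t \<partial>gauss_measure s)"
    by (subst T.nn_integral_fst[symmetric]) auto
  also have "\<dots> = (\<integral>\<^sup>+w. indicator A w \<partial>gauss_measure (s + t))"
    by (rule nn_integral_gauss_add[OF s t]) measurable
  finally show "emeasure ?L A = emeasure ?R A" by simp
qed simp

text \<open>
  A bound for the integral of \<open>gauss_weight\<close> below; that it does not depend on the time \<open>t\<close> is what matters.
\<close>

definition gauss_const :: "'n::finite itself \<Rightarrow> real" where
  "gauss_const _ = 2 * exp 5 * sqrt 2 ^ CARD('n)"

lemma gauss_const_ge_2: "2 \<le> gauss_const TYPE('n::finite)"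
proof -
  have "1 * 1 \<le> exp 5 * sqrt 2 ^ CARD('n)"
    by (intro mult_mono one_le_power) auto
  then show ?thesis by (simp add: gauss_const_def)
qed

lemma gauss_const_pos [simp]: "0 < gauss_const TYPE('n::finite)"
  using gauss_const_ge_2[where 'n='n] by linarith

text \<open>
  The factor \<open>exp ((norm z)\<^sup>2 / (4 * t))\<close> turns the Gaussian density of variance \<open>t\<close> into a multiple of
  the one of variance \<open>2 * t\<close>. Hence all moments, rescaled by \<open>sqrt t\<close>, are bounded uniformly in \<open>t\<close>.
\<close>

lemma gauss_measure_dominated:
  fixes g :: "real ^ 'n::finite \<Rightarrow> real"
  assumes t: "t > 0" and [measurable]: "g \<in> borel_measurable borel" and g: "\<And>z. 0 \<le> g z"
    and B: "0 \<le> B" "\<And>z. g z \<le> B * exp ((norm z / sqrt t)\<^sup>2 / 4)"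
  shows "integrable (gauss_measure t) g" "(\<integral>z. g z \<partial>gauss_measure t) \<le> B * sqrt 2 ^ CARD('n)"
proof -
  have le: "gauss t z * g z \<le> B * sqrt 2 ^ CARD('n) * gauss (2 * t) z" for z :: "real ^ 'n"
  proof -
    have e: "exp (- (norm z)\<^sup>2 / (2 * t)) * exp ((norm z / sqrt t)\<^sup>2 / 4) = exp (- (norm z)\<^sup>2 / (2 * (2 * t)))"
      using t unfolding exp_add[symmetric] by (simp add: power_divide field_simps)
    have c: "(1 / sqrt (2 * pi * t)) = sqrt 2 * (1 / sqrt (2 * pi * (2 * t)))"
      using t by (simp add: real_sqrt_mult field_simps)
    have "gauss t z * g z \<le> gauss t z * (B * exp ((norm z / sqrt t)\<^sup>2 / 4))"
      by (intro mult_left_mono B) simp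
    also have "\<dots> = (1 / sqrt (2 * pi * t)) ^ CARD('n) * B * (exp (- (norm z)\<^sup>2 / (2 * t)) * exp ((norm z / sqrt t)\<^sup>2 / 4))"
      using t by (simp add: gauss_eq)
    also have "\<dots> = B * sqrt 2 ^ CARD('n) * gauss (2 * t) z"
      unfolding e c power_mult_distrib using t by (simp add: gauss_eq)
    finally show ?thesis .
  qed
  have int2: "integrable lborel (\<lambda>z::real^'n. gauss (2 * t) z)"
    using t nn_integral_gauss[of "2*t", where 'n='n] by (intro integrableI_nonneg) auto
  have one: "(\<integral>z. gauss (2 * t) z \<partial>(lborel::(real^'n) measure)) = 1"
    using t nn_integral_gauss[of "2*t", where 'n='n] by (subst integral_eq_nn_integral) auto
  have intg: "integrable lborel (\<lambda>z. gauss t z * g z)"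
    by (rule Bochner_Integration.integrable_bound[OF integrable_mult_right[OF int2, of "B * sqrt 2 ^ CARD('n)"]])
       (use le g B in \<open>auto intro!: AE_I2 simp: abs_mult\<close>)
  show "integrable (gauss_measure t) g"
    unfolding gauss_measure_def using intg by (subst integrable_density) auto
  have "(\<integral>z. g z \<partial>gauss_measure t) = (\<integral>z. gauss t z * g z \<partial>lborel)"
    unfolding gauss_measure_def by (subst integral_density) auto
  also have "\<dots> \<le> (\<integral>z. B * sqrt 2 ^ CARD('n) * gauss (2 * t) z \<partial>(lborel::(real^'n) measure))"
    by (intro integral_mono intg integrable_mult_right int2 le)
  also have "\<dots> = B * sqrt 2 ^ CARD('n)"
    using one by simp
  finally show "(\<integral>z. g z \<partial>gauss_measure t) \<le> B * sqrt 2 ^ CARD('n)" .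
qed

lemma exp_quarter_square: "exp (c * s) \<le> exp (c\<^sup>2) * exp (s\<^sup>2 / 4)" for c s :: real
proof -
  have "0 \<le> (c - s / 2)\<^sup>2" by simp
  then have "c * s \<le> c\<^sup>2 + s\<^sup>2 / 4" by (simp add: power2_eq_square algebra_simps)
  then show ?thesis unfolding exp_add[symmetric] by simp
qed

text \<open>
  Combines the growth allowed for the integrand in \<open>heat_diff_local\<close> with the relative change of the
  Gaussian density under a shift by at most \<open>sqrt t\<close>.
\<close>

abbreviation gauss_weight :: "real \<Rightarrow> real ^ 'n::finite \<Rightarrow> real" where
  "gauss_weight t w \<equiv> (1 + norm w / sqrt t)\<^sup>2 * exp (1 + norm w / sqrt t)"

lemma gauss_weight_integral:
  assumes t: "t > 0"
  shows "integrable (gauss_measure t) (gauss_weight t :: real ^ 'n::finite \<Rightarrow> real)"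
    and "(\<integral>w. gauss_weight t (w :: real ^ 'n) \<partial>gauss_measure t) \<le> gauss_const TYPE('n)"
proof -
  have le: "gauss_weight t w \<le> (2 * exp 5) * exp ((norm w / sqrt t)\<^sup>2 / 4)" for w :: "real ^ 'n"
  proof -
    define s where "s = norm w / sqrt t"
    have s: "0 \<le> s" using t by (simp add: s_def)
    have "(1 + s)\<^sup>2 \<le> 2 * exp s"
      using exp_lower_Taylor_quadratic[OF s] by (simp add: power2_eq_square algebra_simps)
    then have "(1 + s)\<^sup>2 * exp (1 + s) \<le> 2 * exp s * exp (1 + s)" by simp
    also have "\<dots> = 2 * exp 1 * exp (2 * s)" by (simp add: exp_add[symmetric])
    also have "\<dots> \<le> 2 * exp 1 * (exp (2\<^sup>2) * exp (s\<^sup>2 / 4))"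
      by (intro mult_left_mono exp_quarter_square) auto
    also have "\<dots> = (2 * exp 5) * exp (s\<^sup>2 / 4)" by (simp add: exp_add[symmetric])
    finally show ?thesis by (simp add: s_def)
  qed
  show "integrable (gauss_measure t) (gauss_weight t :: real ^ 'n \<Rightarrow> real)"
    by (rule gauss_measure_dominated(1)[OF t _ _ _ le]) auto
  show "(\<integral>w. gauss_weight t (w :: real ^ 'n) \<partial>gauss_measure t) \<le> gauss_const TYPE('n)"
    using gauss_measure_dominated(2)[OF t _ _ _ le] by (auto simp: gauss_const_def)
qed

lemma gauss_moment:
  obtains C where "0 \<le> C"
    "\<And>t. t > 0 \<Longrightarrow> integrable (gauss_measure t) (\<lambda>w :: real ^ 'n::finite. (1 + norm w / sqrt t) ^ k)"
    "\<And>t. t > 0 \<Longrightarrow> (\<integral>w. (1 + norm (w :: real ^ 'n) / sqrt t) ^ k \<partial>gauss_measure t) \<le> C"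
proof -
  define B :: real where "B = exp (2 * real k) * exp ((real k)\<^sup>2)"
  have le: "(1 + norm w / sqrt t) ^ k \<le> B * exp ((norm w / sqrt t)\<^sup>2 / 4)" if "t > 0" for w :: "real ^ 'n" and t
  proof -
    define s where "s = norm w / sqrt t"
    have s: "0 \<le> s" using that by (simp add: s_def)
    have "1 + s \<le> exp s" by simp
    then have "(1 + s) ^ k \<le> exp s ^ k" using s by (intro power_mono) auto
    also have "\<dots> = exp (real k * s)" by (simp add: exp_of_nat_mult)
    also have "\<dots> \<le> exp ((real k)\<^sup>2) * exp (s\<^sup>2 / 4)" by (rule exp_quarter_square)
    also have "\<dots> \<le> B * exp (s\<^sup>2 / 4)" by (simp add: B_def)
    finally show ?thesis by (simp add: s_def)
  qed
  have B: "0 \<le> B" by (simp add: B_def)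
  show ?thesis
  proof (rule that[of "B * sqrt 2 ^ CARD('n)"])
    fix t :: real assume t: "t > 0"
    show "integrable (gauss_measure t) (\<lambda>w :: real ^ 'n. (1 + norm w / sqrt t) ^ k)"
      by (rule gauss_measure_dominated(1)[OF t _ _ B le[OF t]]) (use t in auto)
    show "(\<integral>w. (1 + norm (w :: real ^ 'n) / sqrt t) ^ k \<partial>gauss_measure t) \<le> B * sqrt 2 ^ CARD('n)"
      by (rule gauss_measure_dominated(2)[OF t _ _ B le[OF t]]) (use t in auto)
  qed (use B in auto)
qed

lemma integrable_gauss_mono:
  fixes f :: "real ^ 'n::finite \<Rightarrow> 'b::euclidean_space"
  assumes t: "t > 0" and [measurable]: "f \<in> borel_measurable borel"
    and le: "\<And>w. norm (f w) \<le> A * (1 + norm w / sqrt t)"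
  shows "integrable (gauss_measure t) f" "norm (\<integral>w. f w \<partial>gauss_measure t) \<le> A * gauss_const TYPE('n)"
proof -
  have A: "0 \<le> A" using order_trans[OF norm_ge_zero le[of 0]] by simp
  have le2: "norm (f w) \<le> A * gauss_weight t w" for w
  proof -
    define s where "s = norm w / sqrt t"
    have s: "0 \<le> s" using t by (simp add: s_def)
    have "(1 + s) * 1 \<le> (1 + s)\<^sup>2 * exp (1 + s)"
      using s by (intro mult_mono) (auto simp: power2_eq_square)
    then have "A * (1 + s) \<le> A * ((1 + s)\<^sup>2 * exp (1 + s))" using A by (intro mult_left_mono) auto
    then show ?thesis using le[of w] by (simp add: s_def)
  qed
  show i: "integrable (gauss_measure t) f"
    by (rule Bochner_Integration.integrable_bound[OF integrable_mult_right[OF gauss_weight_integral(1)[OF t], of A]])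
       (use le2 A in \<open>auto intro!: AE_I2 order_trans[OF le2] simp: abs_mult\<close>)
  have "norm (\<integral>w. f w \<partial>gauss_measure t) \<le> (\<integral>w. A * gauss_weight t w \<partial>(gauss_measure t :: (real ^ 'n) measure))"
  proof (rule Bochner_Integration.integral_norm_bound_integral)
    show "integrable (gauss_measure t) f" by (rule i)
    show "integrable (gauss_measure t) (\<lambda>w :: real ^ 'n. A * gauss_weight t w)"
      by (intro integrable_mult_right gauss_weight_integral(1)[OF t])
    show "norm (f w) \<le> A * gauss_weight t w" for w by (rule le2)
  qed
  also have "\<dots> \<le> A * gauss_const TYPE('n)"
    using gauss_weight_integral(2)[OF t, where 'n='n] A by (simp add: mult_left_mono)
  finally show "norm (\<integral>w. f w \<partial>gauss_measure t) \<le> A * gauss_const TYPE('n)" .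
qed

section \<open>The heat semigroup\<close>

definition bounded_borel :: "('a::topological_space \<Rightarrow> 'b::real_normed_vector) \<Rightarrow> bool" where
  "bounded_borel f \<longleftrightarrow> f \<in> borel_measurable borel \<and> bounded (range f)"

definition heat :: "real \<Rightarrow> (real ^ 'n::finite \<Rightarrow> 'b::euclidean_space) \<Rightarrow> real ^ 'n \<Rightarrow> 'b" where
  "heat t f y = (\<integral>z. f (y + z) \<partial>gauss_measure t)"

lemma bounded_borelI:
  "f \<in> borel_measurable borel \<Longrightarrow> (\<And>x. norm (f x) \<le> A) \<Longrightarrow> bounded_borel f"
  by (auto simp: bounded_borel_def bounded_iff)

lemma bounded_borelD: "bounded_borel f \<Longrightarrow> f \<in> borel_measurable borel"
  by (simp add: bounded_borel_def)

lemma bounded_borel_bound: "bounded_borel f \<Longrightarrow> \<exists>A. \<forall>x. norm (f x) \<le> A"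
  by (auto simp: bounded_borel_def bounded_iff)

lemma integrable_gauss_bounded:
  fixes f :: "real ^ 'n::finite \<Rightarrow> 'b::euclidean_space"
  assumes t: "t > 0" and f: "bounded_borel f"
  shows "integrable (gauss_measure t) (\<lambda>z. f (y + z))"
proof -
  interpret prob_space "gauss_measure t :: (real ^ 'n) measure" by (rule prob_space_gauss_measure[OF t])
  have [measurable]: "f \<in> borel_measurable borel" using f by (rule bounded_borelD)
  obtain A where "\<And>x. norm (f x) \<le> A" using bounded_borel_bound[OF f] by auto
  then show ?thesis by (intro integrable_const_bound[where B=A]) auto
qed

lemma heat_bound:
  fixes f :: "real ^ 'n::finite \<Rightarrow> 'b::euclidean_space"
  assumes t: "t > 0" and f: "f \<in> borel_measurable borel" and A: "\<And>x. norm (f x) \<le> A"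
  shows "norm (heat t f y) \<le> A"
proof -
  interpret prob_space "gauss_measure t :: (real ^ 'n) measure" by (rule prob_space_gauss_measure[OF t])
  have "norm (heat t f y) \<le> (\<integral>z. A \<partial>(gauss_measure t :: (real ^ 'n) measure))"
    unfolding heat_def
    by (rule Bochner_Integration.integral_norm_bound_integral) (auto intro!: integrable_gauss_bounded[OF t] bounded_borelI[OF f A] A)
  then show ?thesis using prob_space by simp
qed

lemma abs_exp_minus_one: "\<bar>exp x - 1\<bar> \<le> \<bar>x\<bar> * exp \<bar>x\<bar>" for x :: real
proof (cases "0 \<le> x")
  case True
  have "1 - x \<le> exp (- x)" using exp_ge_add_one_self[of "- x"] by simp
  then have "(1 - x) * exp x \<le> exp (- x) * exp x" by (intro mult_right_mono) auto
  then show ?thesis using True by (simp add: exp_minus algebra_simps)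
next
  case False
  then have "\<bar>exp x - 1\<bar> = 1 - exp x" by simp
  also have "\<dots> \<le> - x" using exp_ge_add_one_self[of x] by linarith
  also have "\<dots> \<le> (- x) * exp (- x)" using False by simp
  finally show ?thesis using False by simp
qed

lemma gauss_shift_diff:
  fixes w a :: "real ^ 'n::finite"
  assumes t: "t > 0" and a: "norm a \<le> sqrt t"
  shows "\<bar>gauss t (w - a) - gauss t w\<bar> \<le> gauss t w * ((norm a / sqrt t) * ((1 + norm w / sqrt t) * exp (1 + norm w / sqrt t)))"
proof -
  define s where "s = norm w / sqrt t"
  define r where "r = norm a / sqrt t"
  define x where "x = (w \<bullet> a) / t - (norm a)\<^sup>2 / (2 * t)"
  have s: "0 \<le> s" and r: "0 \<le> r" "r \<le> 1" using t a by (auto simp: s_def r_def)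
  have "\<bar>x\<bar> \<le> \<bar>w \<bullet> a\<bar> / t + (norm a)\<^sup>2 / (2 * t)"
    unfolding x_def using t by (intro order_trans[OF abs_triangle_ineq4]) auto
  also have "\<dots> \<le> norm w * norm a / t + (norm a)\<^sup>2 / (2 * t)"
    using t Cauchy_Schwarz_ineq2[of w a] by (intro add_mono divide_right_mono) auto
  also have "\<dots> = s * r + r\<^sup>2 / 2"
    using t by (simp add: s_def r_def power_divide)
  also have "\<dots> \<le> r * (1 + s)"
  proof -
    have "r\<^sup>2 \<le> r" using r by (simp add: power2_eq_square mult_left_le)
    then show ?thesis using r by (simp add: algebra_simps)
  qed
  finally have x1: "\<bar>x\<bar> \<le> r * (1 + s)" .
  also have "\<dots> \<le> 1 * (1 + s)" using r s by (intro mult_right_mono) auto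
  finally have x2: "\<bar>x\<bar> \<le> 1 + s" by simp
  have "\<bar>exp x - 1\<bar> \<le> \<bar>x\<bar> * exp \<bar>x\<bar>" by (rule abs_exp_minus_one)
  also have "\<dots> \<le> (r * (1 + s)) * exp (1 + s)" using x1 x2 r s by (intro mult_mono) auto
  finally have "\<bar>exp x - 1\<bar> \<le> r * ((1 + s) * exp (1 + s))" by simp
  moreover have "\<bar>gauss t (w - a) - gauss t w\<bar> = gauss t w * \<bar>exp x - 1\<bar>"
  proof -
    have "gauss t (w - a) - gauss t w = gauss t w * (exp x - 1)"
      unfolding gauss_shift[OF t] x_def[symmetric] by (simp add: right_diff_distrib)
    then show ?thesis by (simp add: abs_mult)
  qed
  ultimately have "\<bar>gauss t (w - a) - gauss t w\<bar> \<le> gauss t w * (r * ((1 + s) * exp (1 + s)))"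
    using gauss_pos[OF t, of w] by (simp add: mult_left_mono)
  then show ?thesis by (simp only: s_def r_def)
qed

text \<open>
  The difference is moved from \<open>f\<close> to the kernel. Since only the size of \<open>f\<close> around \<open>z\<close> enters, a constant
  may be subtracted from \<open>f\<close>, which is how Hoelder continuity is exploited later.
\<close>

lemma heat_diff_local:
  fixes f :: "real ^ 'n::finite \<Rightarrow> 'b::euclidean_space"
  assumes t: "t > 0" and [measurable]: "f \<in> borel_measurable borel"
    and A: "\<And>w. norm (f (z + w)) \<le> A * (1 + norm w / sqrt t)" and xz: "norm (x - z) \<le> sqrt t"
  shows "norm (heat t f x - heat t f z) \<le> A * gauss_const TYPE('n) * (norm (x - z) / sqrt t)"
proof -
  define a where "a = x - z"
  have a: "norm a \<le> sqrt t" using xz by (simp add: a_def)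
  define g where "g w = A * (norm a / sqrt t) * gauss_weight t w" for w :: "real ^ 'n"
  have A0: "0 \<le> A" using order_trans[OF norm_ge_zero A[of 0]] by simp
  have W: "integrable lborel (\<lambda>w. gauss t w * gauss_weight t (w :: real ^ 'n))"
    using gauss_weight_integral(1)[OF t, where 'n='n] unfolding gauss_measure_def by (subst (asm) integrable_density) auto
  have hz: "heat t f z = (\<integral>w. gauss t w *\<^sub>R f (z + w) \<partial>lborel)"
    unfolding heat_def gauss_measure_def by (subst integral_density) auto
  have "heat t f x = (\<integral>w. gauss t w *\<^sub>R f (x + w) \<partial>lborel)"
    unfolding heat_def gauss_measure_def by (subst integral_density) auto
  also have "\<dots> = (\<integral>w. gauss t ((a + w) - a) *\<^sub>R f (z + (a + w)) \<partial>lborel)"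
    by (simp add: a_def)
  also have "\<dots> = (\<integral>w. gauss t (w - a) *\<^sub>R f (z + w) \<partial>distr lborel borel ((+) a))"
    by (subst integral_distr) auto
  finally have hx: "heat t f x = (\<integral>w. gauss t (w - a) *\<^sub>R f (z + w) \<partial>lborel)"
    by (simp add: lborel_distr_plus)
  have "(\<lambda>w. f (z + w)) \<in> borel_measurable borel" by measurable
  from integrable_gauss_mono(1)[OF t this A] have "integrable (gauss_measure t) (\<lambda>w. f (z + w))" .
  then have iz: "integrable lborel (\<lambda>w. gauss t w *\<^sub>R f (z + w))"
    unfolding gauss_measure_def by (subst (asm) integrable_density) auto
  have pw: "norm ((gauss t (w - a) - gauss t w) *\<^sub>R f (z + w)) \<le> A * (norm a / sqrt t) * (gauss t w * gauss_weight t w)" for w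
  proof -
    have "norm ((gauss t (w - a) - gauss t w) *\<^sub>R f (z + w)) = \<bar>gauss t (w - a) - gauss t w\<bar> * norm (f (z + w))" by simp
    also have "\<dots> \<le> (gauss t w * ((norm a / sqrt t) * ((1 + norm w / sqrt t) * exp (1 + norm w / sqrt t)))) * (A * (1 + norm w / sqrt t))"
      using t by (intro mult_mono gauss_shift_diff[OF t a] A) auto
    also have "\<dots> = A * (norm a / sqrt t) * (gauss t w * gauss_weight t w)" by (simp add: power2_eq_square mult_ac)
    finally show ?thesis .
  qed
  have id: "integrable lborel (\<lambda>w. (gauss t (w - a) - gauss t w) *\<^sub>R f (z + w))"
    by (rule Bochner_Integration.integrable_bound[OF integrable_mult_right[OF W, of "A * (norm a / sqrt t)"]])
       (use A0 t in \<open>auto intro!: AE_I2 order_trans[OF pw] simp del: norm_scaleR simp: abs_mult\<close>)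
  have ix: "integrable lborel (\<lambda>w. gauss t (w - a) *\<^sub>R f (z + w))"
    using Bochner_Integration.integrable_add[OF iz id] by (simp add: scaleR_diff_left)
  have "heat t f x - heat t f z = (\<integral>w. (gauss t (w - a) - gauss t w) *\<^sub>R f (z + w) \<partial>lborel)"
    unfolding hx hz using ix iz by (simp add: scaleR_diff_left Bochner_Integration.integral_diff)
  also have "norm \<dots> \<le> (\<integral>w. A * (norm a / sqrt t) * (gauss t w * gauss_weight t w) \<partial>(lborel :: (real ^ 'n) measure))"
    by (intro Bochner_Integration.integral_norm_bound_integral id integrable_mult_right W pw)
  also have "\<dots> = A * (norm a / sqrt t) * (\<integral>w. gauss_weight t w \<partial>(gauss_measure t :: (real ^ 'n) measure))"
    unfolding gauss_measure_def by (subst integral_density) auto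
  also have "\<dots> \<le> A * (norm a / sqrt t) * gauss_const TYPE('n)"
    using t A0 by (intro mult_left_mono gauss_weight_integral(2)) auto
  finally show ?thesis by (simp add: a_def mult_ac)
qed

text \<open>
  The gradient bound of order \<open>t powr (- 1 / 2)\<close>. It is trivial for points at a distance above \<open>sqrt t\<close>.
\<close>

lemma heat_lipschitz_bounded:
  fixes f :: "real ^ 'n::finite \<Rightarrow> 'b::euclidean_space"
  assumes t: "t > 0" and f: "f \<in> borel_measurable borel" and A: "\<And>x. norm (f x) \<le> A"
  shows "norm (heat t f x - heat t f z) \<le> gauss_const TYPE('n) * A / sqrt t * norm (x - z)"
proof (cases "norm (x - z) \<le> sqrt t")
  case True
  have A0: "0 \<le> A" using A[of 0] norm_ge_zero[of "f 0"] by linarith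
  have "norm (f (z + w)) \<le> A * (1 + norm w / sqrt t)" for w
    using A[of "z + w"] A0 t by (simp add: algebra_simps add_increasing2)
  from heat_diff_local[OF t f this True] show ?thesis by (simp add: mult_ac)
next
  case False
  have A0: "0 \<le> A" using A[of 0] norm_ge_zero[of "f 0"] by linarith
  have "norm (heat t f x - heat t f z) \<le> norm (heat t f x) + norm (heat t f z)" by (rule norm_triangle_ineq4)
  also have "\<dots> \<le> 2 * A * 1" using heat_bound[OF t f A, of x] heat_bound[OF t f A, of z] by simp
  also have "\<dots> \<le> gauss_const TYPE('n) * A * (norm (x - z) / sqrt t)"
    using False t A0 gauss_const_ge_2[where 'n='n] by (intro mult_mono) auto
  finally show ?thesis by simp
qed

lemma continuous_on_lipschitz_bound:
  fixes f :: "'a::real_normed_vector \<Rightarrow> 'b::real_normed_vector"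
  assumes "\<And>x z. norm (f x - f z) \<le> L * norm (x - z)"
  shows "continuous_on S f"
proof -
  have "(max 0 L)-lipschitz_on S f"
    by (rule lipschitz_onI)
       (auto simp: dist_norm intro!: order_trans[OF assms] mult_right_mono)
  then show ?thesis by (rule lipschitz_on_continuous_on)
qed

lemma bounded_borel_heat:
  fixes f :: "real ^ 'n::finite \<Rightarrow> 'b::euclidean_space"
  assumes t: "t > 0" and f: "bounded_borel f"
  shows "bounded_borel (heat t f)"
proof -
  obtain A where A: "\<And>x. norm (f x) \<le> A" using bounded_borel_bound[OF f] by auto
  have "continuous_on UNIV (heat t f)"
    by (rule continuous_on_lipschitz_bound, rule heat_lipschitz_bounded[OF t bounded_borelD[OF f] A])
  then have "heat t f \<in> borel_measurable borel" by (rule borel_measurable_continuous_onI)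
  then show ?thesis by (rule bounded_borelI) (rule heat_bound[OF t bounded_borelD[OF f] A])
qed

lemma bounded_borel_add [intro]:
  fixes f g :: "'a::topological_space \<Rightarrow> 'b::euclidean_space"
  assumes "bounded_borel f" "bounded_borel g"
  shows "bounded_borel (\<lambda>y. f y + g y)"
  using assms bounded_plus_comp[of f UNIV g] by (auto simp: bounded_borel_def)

lemma bounded_borel_diff [intro]:
  fixes f g :: "'a::topological_space \<Rightarrow> 'b::euclidean_space"
  assumes "bounded_borel f" "bounded_borel g"
  shows "bounded_borel (\<lambda>y. f y - g y)"
  using assms bounded_minus_comp[of f UNIV g] by (auto simp: bounded_borel_def)

lemma bounded_borel_scaleR [intro]:
  fixes f :: "'a::topological_space \<Rightarrow> 'b::euclidean_space"
  assumes "bounded_borel f"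
  shows "bounded_borel (\<lambda>y. c *\<^sub>R f y)"
  using assms bounded_scaleR_comp[of f UNIV c] by (auto simp: bounded_borel_def)

lemma bounded_borel_zero [simp]: "bounded_borel (\<lambda>y. 0)"
  by (auto simp: bounded_borel_def)

lemma bounded_borel_sum [intro]:
  fixes f :: "'i \<Rightarrow> 'a::topological_space \<Rightarrow> 'b::euclidean_space"
  assumes "\<And>i. i \<in> I \<Longrightarrow> bounded_borel (f i)"
  shows "bounded_borel (\<lambda>y. \<Sum>i\<in>I. f i y)"
  using assms by (induction I rule: infinite_finite_induct) auto

lemma bounded_borel_shift:
  fixes f :: "'a::euclidean_space \<Rightarrow> 'b::euclidean_space"
  assumes "bounded_borel f"
  shows "bounded_borel (\<lambda>y. f (y + v))"
proof -
  have [measurable]: "f \<in> borel_measurable borel" using assms by (rule bounded_borelD)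
  have "bounded (range (\<lambda>y. f (y + v)))"
    using assms unfolding bounded_borel_def by (auto elim: bounded_subset)
  then show ?thesis unfolding bounded_borel_def by simp
qed

lemma heat_add:
  fixes f g :: "real ^ 'n::finite \<Rightarrow> 'b::euclidean_space"
  assumes "t > 0" "bounded_borel f" "bounded_borel g"
  shows "heat t (\<lambda>y. f y + g y) y = heat t f y + heat t g y"
  unfolding heat_def using assms by (intro Bochner_Integration.integral_add integrable_gauss_bounded)

lemma heat_diff:
  fixes f g :: "real ^ 'n::finite \<Rightarrow> 'b::euclidean_space"
  assumes "t > 0" "bounded_borel f" "bounded_borel g"
  shows "heat t (\<lambda>y. f y - g y) y = heat t f y - heat t g y"
  unfolding heat_def using assms by (intro Bochner_Integration.integral_diff integrable_gauss_bounded)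

lemma heat_scaleR: "heat t (\<lambda>y. c *\<^sub>R f y) y = c *\<^sub>R heat t f y"
  unfolding heat_def by simp

lemma heat_zero [simp]: "heat t (\<lambda>y. 0) y = 0"
  unfolding heat_def by simp

lemma heat_const:
  assumes "t > 0" shows "heat t (\<lambda>y :: real ^ 'n::finite. c :: 'b::euclidean_space) y = c"
proof -
  interpret prob_space "gauss_measure t :: (real ^ 'n) measure" by (rule prob_space_gauss_measure[OF assms])
  show ?thesis unfolding heat_def using prob_space by simp
qed

lemma heat_sum:
  fixes f :: "'i \<Rightarrow> real ^ 'n::finite \<Rightarrow> 'b::euclidean_space"
  assumes "t > 0" "finite I" "\<And>i. i \<in> I \<Longrightarrow> bounded_borel (f i)"
  shows "heat t (\<lambda>y. \<Sum>i\<in>I. f i y) y = (\<Sum>i\<in>I. heat t (f i) y)"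
  using assms(2,3)
proof (induction I rule: finite_induct)
  case (insert i I)
  then have "bounded_borel (f i)" "bounded_borel (\<lambda>y. \<Sum>i\<in>I. f i y)" by auto
  from heat_add[OF assms(1) this] show ?case using insert by simp
qed simp

lemma heat_shift: "heat t (\<lambda>y. f (y + v)) y = heat t f (y + v)"
  unfolding heat_def by (simp add: add_ac)

lemma heat_heat:
  fixes f :: "real ^ 'n::finite \<Rightarrow> 'b::euclidean_space"
  assumes s: "s > 0" and t: "t > 0" and f: "bounded_borel f"
  shows "heat s (heat t f) y = heat (s + t) f y"
proof -
  interpret S: prob_space "gauss_measure s :: (real ^ 'n) measure" by (rule prob_space_gauss_measure[OF s])
  interpret T: prob_space "gauss_measure t :: (real ^ 'n) measure" by (rule prob_space_gauss_measure[OF t])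
  interpret P: pair_prob_space "gauss_measure s :: (real ^ 'n) measure" "gauss_measure t :: (real ^ 'n) measure" ..
  have [measurable]: "f \<in> borel_measurable borel" using f by (rule bounded_borelD)
  obtain A where A: "\<And>x. norm (f x) \<le> A" using bounded_borel_bound[OF f] by auto
  have int: "integrable (gauss_measure s \<Otimes>\<^sub>M gauss_measure t) (\<lambda>p. f (y + (fst p + snd p)))"
    by (intro P.integrable_const_bound[where B=A]) (auto simp: A)
  have "heat (s + t) f y = (\<integral>v. f (y + v) \<partial>distr (gauss_measure s \<Otimes>\<^sub>M gauss_measure t) borel (\<lambda>(z, w). z + w))"
    unfolding heat_def distr_gauss_measure_add[OF s t] ..
  also have "\<dots> = (\<integral>p. f (y + (fst p + snd p)) \<partial>(gauss_measure s \<Otimes>\<^sub>M gauss_measure t))"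
    by (subst integral_distr) (auto simp: case_prod_beta)
  also have "\<dots> = (\<integral>z. \<integral>w. f (y + (z + w)) \<partial>gauss_measure t \<partial>gauss_measure s)"
    using P.integral_fst'[OF int] by simp
  also have "\<dots> = heat s (heat t f) y"
    unfolding heat_def by (simp add: add.assoc)
  finally show ?thesis ..
qed

lemma powr_le_one_add: "0 \<le> s \<Longrightarrow> 0 < \<beta> \<Longrightarrow> \<beta> \<le> 1 \<Longrightarrow> s powr \<beta> \<le> 1 + s" for s :: real
proof (cases "s \<le> 1")
  case True assume "0 \<le> s" "0 < \<beta>" "\<beta> \<le> 1"
  then show ?thesis using True powr_le1[of \<beta> s] by simp
next
  case False assume "0 \<le> s" "0 < \<beta>" "\<beta> \<le> 1"
  then have "s powr \<beta> \<le> s powr 1" using False by (intro powr_mono) auto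
  then show ?thesis using False by simp
qed

lemma norm_powr_scaled:
  fixes w :: "'a::real_normed_vector"
  assumes t: "t > 0" and \<beta>: "0 < \<beta>" "\<beta> \<le> 1"
  shows "norm w powr \<beta> \<le> t powr (\<beta> / 2) * (1 + norm w / sqrt t)"
proof -
  have "t powr (\<beta> / 2) = sqrt t powr \<beta>"
    using t by (simp add: powr_half_sqrt[symmetric] powr_powr)
  then have "norm w powr \<beta> = t powr (\<beta> / 2) * (norm w / sqrt t) powr \<beta>"
    using t by (simp add: powr_mult[symmetric])
  also have "\<dots> \<le> t powr (\<beta> / 2) * (1 + norm w / sqrt t)"
    using t \<beta> by (intro mult_left_mono powr_le_one_add) auto
  finally show ?thesis .
qed

lemma heat_holder:
  fixes f :: "real ^ 'n::finite \<Rightarrow> 'b::euclidean_space"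
  assumes t: "t > 0" and f: "bounded_borel f"
    and A: "\<And>x z. norm (f x - f z) \<le> A * norm (x - z) powr \<beta>"
  shows "norm (heat t f x - heat t f z) \<le> A * norm (x - z) powr \<beta>"
proof -
  interpret prob_space "gauss_measure t :: (real ^ 'n) measure" by (rule prob_space_gauss_measure[OF t])
  have "heat t f x - heat t f z = (\<integral>w. f (x + w) - f (z + w) \<partial>gauss_measure t)"
    unfolding heat_def by (intro Bochner_Integration.integral_diff[symmetric] integrable_gauss_bounded[OF t f])
  also have "norm \<dots> \<le> (\<integral>w. A * norm (x - z) powr \<beta> \<partial>(gauss_measure t :: (real ^ 'n) measure))"
    by (rule Bochner_Integration.integral_norm_bound_integral)
       (auto intro!: Bochner_Integration.integrable_diff integrable_gauss_bounded[OF t f] order_trans[OF A])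
  finally show ?thesis using prob_space by simp
qed

text \<open>
  Near \<open>z\<close>, at the scale \<open>sqrt t\<close> of the kernel, \<open>f - f z\<close> has size \<open>A * t powr (\<beta> / 2)\<close>.
\<close>

lemma heat_lipschitz_holder:
  fixes f :: "real ^ 'n::finite \<Rightarrow> 'b::euclidean_space"
  assumes t: "t > 0" and f: "bounded_borel f" and A0: "0 \<le> A" and \<beta>: "0 < \<beta>" "\<beta> \<le> 1"
    and A: "\<And>x z. norm (f x - f z) \<le> A * norm (x - z) powr \<beta>"
  shows "norm (heat t f x - heat t f z) \<le> gauss_const TYPE('n) * A * t powr ((\<beta> - 1) / 2) * norm (x - z)"
proof (cases "norm (x - z) \<le> sqrt t")
  case True
  have [measurable]: "f \<in> borel_measurable borel" using f by (rule bounded_borelD)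
  have g: "norm ((\<lambda>y. f y - f z) (z + w)) \<le> A * t powr (\<beta> / 2) * (1 + norm w / sqrt t)" for w
    using A[of "z + w" z] mult_left_mono[OF norm_powr_scaled[OF t \<beta>, of w] A0] by (simp add: mult.assoc)
  have h: "heat t (\<lambda>y. f y - f z) v = heat t f v - f z" for v
    using heat_diff[OF t f, of "\<lambda>_. f z" v] heat_const[OF t, of "f z" v] bounded_borelI[of "\<lambda>_. f z" "norm (f z)"] by simp
  have "norm (heat t (\<lambda>y. f y - f z) x - heat t (\<lambda>y. f y - f z) z)
      \<le> A * t powr (\<beta> / 2) * gauss_const TYPE('n) * (norm (x - z) / sqrt t)"
    by (rule heat_diff_local[OF t _ g True]) measurable
  also have "\<dots> = gauss_const TYPE('n) * A * t powr ((\<beta> - 1) / 2) * norm (x - z)"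
    using t by (simp add: diff_divide_distrib powr_diff powr_half_sqrt)
  finally show ?thesis by (simp add: h)
next
  case False
  define r where "r = norm (x - z)"
  have r: "r > sqrt t" "r > 0"
    using False t real_sqrt_gt_zero[OF t] by (auto simp: r_def not_le simp del: real_sqrt_gt_0_iff)
  have "norm (heat t f x - heat t f z) \<le> A * r powr \<beta>"
    unfolding r_def by (rule heat_holder[OF t f A])
  also have "\<dots> = A * (r * r powr (\<beta> - 1))" using r by (simp add: powr_diff)
  also have "r powr (\<beta> - 1) \<le> sqrt t powr (\<beta> - 1)"
    using r t \<beta> by (intro powr_mono2') auto
  also have "sqrt t powr (\<beta> - 1) = t powr ((\<beta> - 1) / 2)"
    using t by (simp add: powr_half_sqrt[symmetric] powr_powr)
  finally have "norm (heat t f x - heat t f z) \<le> 1 * (A * (r * t powr ((\<beta> - 1) / 2)))"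
    using A0 r by (simp add: mult_left_mono)
  also have "\<dots> \<le> gauss_const TYPE('n) * (A * (r * t powr ((\<beta> - 1) / 2)))"
    using A0 r gauss_const_ge_2[where 'n='n] by (intro mult_right_mono) auto
  finally show ?thesis by (simp add: r_def mult_ac)
qed

lemma heat_close_holder:
  fixes f :: "real ^ 'n::finite \<Rightarrow> 'b::euclidean_space"
  assumes t: "t > 0" and f: "bounded_borel f" and A0: "0 \<le> A" and \<beta>: "0 < \<beta>" "\<beta> \<le> 1"
    and A: "\<And>x z. norm (f x - f z) \<le> A * norm (x - z) powr \<beta>"
  shows "norm (heat t f y - f y) \<le> A * t powr (\<beta> / 2) * gauss_const TYPE('n)"
proof -
  interpret prob_space "gauss_measure t :: (real ^ 'n) measure" by (rule prob_space_gauss_measure[OF t])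
  have [measurable]: "f \<in> borel_measurable borel" using f by (rule bounded_borelD)
  have g: "norm (f (y + w) - f y) \<le> A * t powr (\<beta> / 2) * (1 + norm w / sqrt t)" for w
    using A[of "y + w" y] mult_left_mono[OF norm_powr_scaled[OF t \<beta>, of w] A0] by (simp add: mult.assoc)
  have "heat t f y - f y = (\<integral>w. f (y + w) - f y \<partial>gauss_measure t)"
    unfolding heat_def using integrable_gauss_bounded[OF t f] prob_space by simp
  also have "norm \<dots> \<le> A * t powr (\<beta> / 2) * gauss_const TYPE('n)"
    by (rule integrable_gauss_mono(2)[OF t _ g]) measurable
  finally show ?thesis .
qed

definition second_difference :: "('a::plus \<Rightarrow> 'b::real_normed_vector) \<Rightarrow> 'a \<Rightarrow> 'a \<Rightarrow> 'a \<Rightarrow> 'b" where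
  "second_difference f y v w = f (y + v + w) - f (y + v) - f (y + w) + f y"

text \<open>
  The difference in direction \<open>w\<close> is taken on \<open>f\<close>, the one in direction \<open>v\<close> on the kernel.
\<close>

lemma heat_second_difference_holder:
  fixes f :: "real ^ 'n::finite \<Rightarrow> 'b::euclidean_space"
  assumes t: "t > 0" and f: "bounded_borel f"
    and A: "\<And>x z. norm (f x - f z) \<le> A * norm (x - z) powr \<beta>"
  shows "norm (second_difference (heat t f) y v w)
     \<le> gauss_const TYPE('n) / sqrt t * A * (norm v * norm w powr \<beta>)"
proof -
  define g where "g y = f (y + w) - f y" for y
  have fw: "bounded_borel (\<lambda>y. f (y + w))" by (rule bounded_borel_shift[OF f])
  have g: "bounded_borel g" unfolding g_def using fw f by (rule bounded_borel_diff)
  have gA: "norm (g y) \<le> A * norm w powr \<beta>" for y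
    using A[of "y + w" y] by (simp add: g_def)
  have h: "heat t g y = heat t f (y + w) - heat t f y" for y
    using heat_diff[OF t fw f] by (simp add: g_def[abs_def] heat_shift)
  have "norm (heat t g (y + v) - heat t g y) \<le> gauss_const TYPE('n) * (A * norm w powr \<beta>) / sqrt t * norm (y + v - y)"
    by (rule heat_lipschitz_bounded[OF t bounded_borelD[OF g] gA])
  then show ?thesis by (simp add: second_difference_def h algebra_simps)
qed

text \<open>
  The semigroup property splits the smoothing into two halves, and each half absorbs one difference.
\<close>

lemma heat_second_difference_lipschitz:
  fixes f :: "real ^ 'n::finite \<Rightarrow> 'b::euclidean_space"
  assumes t: "t > 0" and f: "bounded_borel f" and A0: "0 \<le> A" and \<beta>: "0 < \<beta>" "\<beta> \<le> 1"
    and A: "\<And>x z. norm (f x - f z) \<le> A * norm (x - z) powr \<beta>"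
  shows "norm (second_difference (heat t f) y v w)
     \<le> 2 * (gauss_const TYPE('n))\<^sup>2 * t powr (\<beta> / 2 - 1) * A * (norm v * norm w)"
proof -
  define K where "K = gauss_const TYPE('n)"
  define s where "s = t / 2"
  have s: "s > 0" using t by (simp add: s_def)
  define g where "g y = heat s f (y + w) - heat s f y" for y
  have hs: "bounded_borel (heat s f)" by (rule bounded_borel_heat[OF s f])
  have hsw: "bounded_borel (\<lambda>y. heat s f (y + w))" by (rule bounded_borel_shift[OF hs])
  have g: "bounded_borel g" unfolding g_def using hsw hs by (rule bounded_borel_diff)
  have gA: "norm (g y) \<le> K * A * s powr ((\<beta> - 1) / 2) * norm w" for y
    using heat_lipschitz_holder[OF s f A0 \<beta> A, of "y + w" y] by (simp add: g_def K_def)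
  have h: "heat s g y = heat t f (y + w) - heat t f y" for y
    using heat_diff[OF s hsw hs] heat_heat[OF s s f] by (simp add: g_def[abs_def] heat_shift s_def)
  have "norm (heat s g (y + v) - heat s g y) \<le> K * (K * A * s powr ((\<beta> - 1) / 2) * norm w) / sqrt s * norm (y + v - y)"
    unfolding K_def by (rule heat_lipschitz_bounded[OF s bounded_borelD[OF g] gA[unfolded K_def]])
  also have "\<dots> = K\<^sup>2 * A * (s powr ((\<beta> - 1) / 2) / sqrt s) * (norm v * norm w)"
    by (simp add: power2_eq_square mult_ac)
  also have "s powr ((\<beta> - 1) / 2) / sqrt s = s powr (\<beta> / 2 - 1)"
  proof -
    have "s powr (\<beta> / 2 - 1) = s powr ((\<beta> - 1) / 2 - 1 / 2)" by (simp add: diff_divide_distrib)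
    also have "\<dots> = s powr ((\<beta> - 1) / 2) / sqrt s" using s by (simp only: powr_diff powr_half_sqrt less_imp_le)
    finally show ?thesis ..
  qed
  also have "s powr (\<beta> / 2 - 1) = t powr (\<beta> / 2 - 1) * 2 powr (1 - \<beta> / 2)"
    using t by (simp add: s_def powr_divide powr_diff)
  also have "K\<^sup>2 * A * (t powr (\<beta> / 2 - 1) * 2 powr (1 - \<beta> / 2)) * (norm v * norm w)
     \<le> K\<^sup>2 * A * (t powr (\<beta> / 2 - 1) * 2) * (norm v * norm w)"
    using \<beta> A0 powr_mono[of "1 - \<beta> / 2" 1 2] by (intro mult_right_mono mult_left_mono) auto
  finally show ?thesis by (simp add: second_difference_def h algebra_simps K_def)
qed

section \<open>A discrete Zvonkin transformation\<close>

text \<open>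
  \<open>D i\<close> is the drift of step \<open>i\<close> in a scheme of \<open>N\<close> steps of length \<open>h\<close>, and \<open>\<rho>\<close> is the damping factor of
  one step. The last assumption is a smallness condition on the drift: smoothing it by the damped heat
  kernel gives Lipschitz constants whose sum is at most \<open>1 / 3\<close>.
\<close>

locale corrector =
  fixes h \<rho> \<beta> :: real and N :: nat and \<mu> :: "nat \<Rightarrow> real"
    and D :: "nat \<Rightarrow> real ^ 'n::finite \<Rightarrow> real ^ 'n"
  assumes h: "h > 0" and \<rho>: "0 \<le> \<rho>" "\<rho> \<le> 1" and \<beta>: "0 < \<beta>" "\<beta> \<le> 1"
    and \<mu>: "\<And>i. 0 \<le> \<mu> i"
    and D_meas: "\<And>i. D i \<in> borel_measurable borel"
    and D_bound: "\<And>i y. norm (D i y) \<le> \<mu> i"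
    and D_holder: "\<And>i y z. norm (D i y - D i z) \<le> \<mu> i * norm (y - z) powr \<beta>"
    and small: "\<And>i. gauss_const TYPE('n) * (\<Sum>l=i..<N. \<rho> ^ (l - i) * \<mu> l / sqrt (real (l - i + 1) * h)) \<le> 1 / 3"
begin

text \<open>
  The increment of \<open>y + v y\<close> when \<open>y\<close> moves by \<open>D i y\<close>.
\<close>

definition drift_term :: "(real ^ 'n \<Rightarrow> real ^ 'n) \<Rightarrow> nat \<Rightarrow> real ^ 'n \<Rightarrow> real ^ 'n" where
  "drift_term v i y = D i y + v (y + D i y) - v y"

text \<open>
  The transformation with \<open>j\<close> steps to go. For \<open>\<rho> = 1\<close>, the sum of \<open>y\<close> and its value at \<open>y\<close> is the expected
  terminal position of the scheme that has \<open>j\<close> steps to go from \<open>y\<close>. As the noise of a step comes before its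
  drift, the whole right-hand side is smoothed by the heat semigroup.
\<close>

primrec backward :: "nat \<Rightarrow> real ^ 'n \<Rightarrow> real ^ 'n" where
  "backward 0 = (\<lambda>y. 0)"
| "backward (Suc j) = heat h (\<lambda>y. \<rho> *\<^sub>R backward j y + drift_term (backward j) (N - Suc j) y)"

definition u :: "nat \<Rightarrow> real ^ 'n \<Rightarrow> real ^ 'n" where
  "u i = backward (N - i)"

definition F :: "nat \<Rightarrow> real ^ 'n \<Rightarrow> real ^ 'n" where
  "F i = drift_term (u (Suc i)) i"

lemma F_eq: "F i y = D i y + u (Suc i) (y + D i y) - u (Suc i) y"
  by (simp add: F_def drift_term_def)

lemma u_end [simp]: "N \<le> i \<Longrightarrow> u i y = 0"
  by (simp add: u_def)

lemma u_step: "i < N \<Longrightarrow> u i = heat h (\<lambda>y. \<rho> *\<^sub>R u (Suc i) y + F i y)"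
  using Suc_diff_Suc[of i N, symmetric] by (simp add: u_def F_def)

lemma bounded_borel_drift_term:
  assumes v: "bounded_borel v"
  shows "bounded_borel (drift_term v i)"
proof -
  have [measurable]: "v \<in> borel_measurable borel" "D i \<in> borel_measurable borel"
    using v D_meas by (auto dest: bounded_borelD)
  obtain A where A: "\<And>x. norm (v x) \<le> A" using bounded_borel_bound[OF v] by auto
  show ?thesis
  proof (rule bounded_borelI)
    show "drift_term v i \<in> borel_measurable borel"
      unfolding drift_term_def[abs_def] by measurable
    show "norm (drift_term v i x) \<le> \<mu> i + A + A" for x
      unfolding drift_term_def
      by (intro order_trans[OF norm_triangle_ineq4] add_mono order_trans[OF norm_triangle_ineq] D_bound A)
  qed
qed

lemma bounded_borel_backward: "bounded_borel (backward j)"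
proof (induction j)
  case (Suc j)
  show ?case
    unfolding backward.simps
    by (intro bounded_borel_heat[OF h] bounded_borel_add bounded_borel_scaleR bounded_borel_drift_term Suc)
qed simp

lemma bounded_borel_u: "bounded_borel (u i)"
  unfolding u_def by (rule bounded_borel_backward)

lemma bounded_borel_F: "bounded_borel (F i)"
  unfolding F_def by (rule bounded_borel_drift_term[OF bounded_borel_u])

text \<open>
  Duhamel's formula: the source of step \<open>l\<close> has been smoothed for \<open>l - i + 1\<close> steps.
\<close>

lemma u_sum:
  assumes "i \<le> N"
  shows "u i y = (\<Sum>l=i..<N. \<rho> ^ (l - i) *\<^sub>R heat (real (l - i + 1) * h) (F l) y)"
  using assms
proof (induction arbitrary: y rule: inc_induct)
  case base
  then show ?case by simp
next
  case (step n)
  have pos: "real (k + 1) * h > 0" for k using h by simp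
  have bb: "bounded_borel (\<lambda>y. \<rho> ^ (l - Suc n) *\<^sub>R heat (real (l - Suc n + 1) * h) (F l) y)" for l
    by (intro bounded_borel_scaleR bounded_borel_heat[OF pos] bounded_borel_F)
  have eq: "\<rho> * \<rho> ^ (l - Suc n) = \<rho> ^ (l - n)" "h + real (l - Suc n + 1) * h = real (l - n + 1) * h" if "l \<in> {Suc n..<N}" for l
  proof -
    have "l - n = Suc (l - Suc n)" using that by auto
    then show "\<rho> * \<rho> ^ (l - Suc n) = \<rho> ^ (l - n)" "h + real (l - Suc n + 1) * h = real (l - n + 1) * h"
      by (simp_all add: algebra_simps)
  qed
  have "u n y = \<rho> *\<^sub>R heat h (u (Suc n)) y + heat h (F n) y"
    unfolding u_step[OF step.hyps(2)]
    by (subst heat_add) (auto intro: h bounded_borel_u bounded_borel_F bounded_borel_scaleR simp: heat_scaleR)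
  also have "heat h (u (Suc n)) y = heat h (\<lambda>y. \<Sum>l=Suc n..<N. \<rho> ^ (l - Suc n) *\<^sub>R heat (real (l - Suc n + 1) * h) (F l) y) y"
    by (simp add: step.IH[abs_def] fun_eq_iff[symmetric])
  also have "\<dots> = (\<Sum>l=Suc n..<N. \<rho> ^ (l - Suc n) *\<^sub>R heat (h + real (l - Suc n + 1) * h) (F l) y)"
    by (subst heat_sum[OF h _ bb]) (auto simp only: heat_scaleR heat_heat[OF h pos bounded_borel_F] finite_atLeastLessThan)
  also have "\<rho> *\<^sub>R \<dots> = (\<Sum>l=Suc n..<N. \<rho> ^ (l - n) *\<^sub>R heat (real (l - n + 1) * h) (F l) y)"
    unfolding scaleR_sum_right by (intro sum.cong refl) (simp only: scaleR_scaleR eq)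
  finally show ?case
    using step.hyps(2) by (simp add: sum.atLeast_Suc_lessThan)
qed

lemma F_bound_aux:
  assumes lip: "\<And>x z. norm (u (Suc i) x - u (Suc i) z) \<le> 1 / 2 * norm (x - z)"
  shows "norm (F i y) \<le> 3 / 2 * \<mu> i"
proof -
  have "norm (F i y) \<le> norm (D i y) + norm (u (Suc i) (y + D i y) - u (Suc i) y)"
    unfolding F_eq by (metis add_diff_eq norm_triangle_ineq)
  also have "\<dots> \<le> \<mu> i + 1 / 2 * \<mu> i"
    using lip[of "y + D i y" y] D_bound[of i y] by (intro add_mono) auto
  finally show ?thesis by simp
qed

text \<open>
  The increment of \<open>u\<close> is split so that the drift is compared at two points in the second term, and only
  the third term needs regularity of \<open>u\<close> beyond Lipschitz continuity.
\<close>

lemma F_diff_split: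
  "F i y - F i z = (D i y - D i z) + (u (Suc i) (y + D i y) - u (Suc i) (y + D i z))
     + second_difference (u (Suc i)) z (D i z) (y - z)"
  by (simp add: F_eq second_difference_def algebra_simps)

lemma F_holder_aux:
  assumes lip: "\<And>x z. norm (u (Suc i) x - u (Suc i) z) \<le> 1 / 2 * norm (x - z)"
    and sd: "\<And>y v w. norm (second_difference (u (Suc i)) y v w) \<le> norm v * norm w powr \<beta>"
  shows "norm (F i y - F i z) \<le> 5 / 2 * \<mu> i * norm (y - z) powr \<beta>"
proof -
  have "norm (F i y - F i z) \<le> norm (D i y - D i z) + norm (u (Suc i) (y + D i y) - u (Suc i) (y + D i z))
      + norm (second_difference (u (Suc i)) z (D i z) (y - z))"
    unfolding F_diff_split by (intro order_trans[OF norm_triangle_ineq] add_mono norm_triangle_ineq order_refl)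
  also have "\<dots> \<le> \<mu> i * norm (y - z) powr \<beta> + 1 / 2 * (\<mu> i * norm (y - z) powr \<beta>) + \<mu> i * norm (y - z) powr \<beta>"
  proof (intro add_mono D_holder)
    show "norm (u (Suc i) (y + D i y) - u (Suc i) (y + D i z)) \<le> 1 / 2 * (\<mu> i * norm (y - z) powr \<beta>)"
      using lip[of "y + D i y" "y + D i z"] D_holder[of i y z] by simp
    show "norm (second_difference (u (Suc i)) z (D i z) (y - z)) \<le> \<mu> i * norm (y - z) powr \<beta>"
      by (rule order_trans[OF sd]) (intro mult_right_mono D_bound powr_ge_zero)
  qed
  finally show ?thesis by simp
qed

lemma second_difference_u_sum:
  assumes "i \<le> N"
  shows "second_difference (u i) y v w
    = (\<Sum>l=i..<N. \<rho> ^ (l - i) *\<^sub>R second_difference (heat (real (l - i + 1) * h) (F l)) y v w)"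
  unfolding second_difference_def u_sum[OF assms]
  by (simp add: sum.distrib sum_subtractf scaleR_add_right scaleR_diff_right)

lemma rho_nonneg: "0 \<le> \<rho> ^ k"
  using \<rho> by simp

lemma norm_rho: "norm (\<rho> ^ k *\<^sub>R v) = \<rho> ^ k * norm v" for v :: "real ^ 'n"
  using \<rho> by simp

text \<open>
  Backward induction. In Duhamel's formula the source \<open>F l\<close> is controlled by \<open>u (Suc l)\<close>, and the heat
  kernel supplies the factors whose sum is at most \<open>1 / 3\<close>. The two bounds have to be carried along
  together, since the Hoelder constant of \<open>F l\<close> depends on both. The bound on second differences says that
  the gradient of \<open>u i\<close> is \<open>\<beta>\<close>-Hoelder with constant 1.
\<close>

lemma u_bounds:
  "(\<forall>x z. norm (u i x - u i z) \<le> 1 / 2 * norm (x - z)) \<and>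
   (\<forall>y v w. norm (second_difference (u i) y v w) \<le> norm v * norm w powr \<beta>)"
proof (induction "N - i" arbitrary: i rule: less_induct)
  case less
  define K where "K = gauss_const TYPE('n)"
  have K: "K > 0" by (simp add: K_def)
  have pos: "real (k + 1) * h > 0" for k using h by simp
  show ?case
  proof (cases "i < N")
    case False
    then show ?thesis by (simp add: second_difference_def)
  next
    case True
    have IH: "\<And>x z. norm (u (Suc l) x - u (Suc l) z) \<le> 1 / 2 * norm (x - z)"
      "\<And>y v w. norm (second_difference (u (Suc l)) y v w) \<le> norm v * norm w powr \<beta>" if "l \<in> {i..<N}" for l
      using less[of "Suc l"] that by auto
    have sm: "K * (\<Sum>l=i..<N. \<rho> ^ (l - i) * \<mu> l / sqrt (real (l - i + 1) * h)) \<le> 1 / 3"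
      unfolding K_def by (rule small)
    show ?thesis
    proof (intro conjI allI)
      fix x z :: "real ^ 'n"
      have diff: "u i x - u i z = (\<Sum>l=i..<N. \<rho> ^ (l - i) *\<^sub>R (heat (real (l - i + 1) * h) (F l) x - heat (real (l - i + 1) * h) (F l) z))"
        using True by (simp add: u_sum sum_subtractf scaleR_diff_right)
      have "norm (u i x - u i z) \<le> (\<Sum>l=i..<N. \<rho> ^ (l - i) * (K * (3 / 2 * \<mu> l) / sqrt (real (l - i + 1) * h) * norm (x - z)))"
        unfolding diff
      proof (rule order_trans[OF norm_sum sum_mono])
        fix l assume l: "l \<in> {i..<N}"
        show "norm (\<rho> ^ (l - i) *\<^sub>R (heat (real (l - i + 1) * h) (F l) x - heat (real (l - i + 1) * h) (F l) z))
          \<le> \<rho> ^ (l - i) * (K * (3 / 2 * \<mu> l) / sqrt (real (l - i + 1) * h) * norm (x - z))"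
          unfolding norm_rho K_def
          by (rule mult_left_mono[OF heat_lipschitz_bounded[OF pos bounded_borelD[OF bounded_borel_F] F_bound_aux[OF IH(1)[OF l]]] rho_nonneg])
      qed
      also have "\<dots> = 3 / 2 * norm (x - z) * (K * (\<Sum>l=i..<N. \<rho> ^ (l - i) * \<mu> l / sqrt (real (l - i + 1) * h)))"
        unfolding sum_distrib_left by (intro sum.cong refl) simp
      also have "\<dots> \<le> 3 / 2 * norm (x - z) * (1 / 3)"
        by (intro mult_left_mono sm) auto
      finally show "norm (u i x - u i z) \<le> 1 / 2 * norm (x - z)" by simp
    next
      fix y v w :: "real ^ 'n"
      have "norm (second_difference (u i) y v w)
          \<le> (\<Sum>l=i..<N. \<rho> ^ (l - i) * (K / sqrt (real (l - i + 1) * h) * (5 / 2 * \<mu> l) * (norm v * norm w powr \<beta>)))"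
        unfolding second_difference_u_sum[OF less_imp_le[OF True]]
      proof (rule order_trans[OF norm_sum sum_mono])
        fix l assume l: "l \<in> {i..<N}"
        show "norm (\<rho> ^ (l - i) *\<^sub>R second_difference (heat (real (l - i + 1) * h) (F l)) y v w)
          \<le> \<rho> ^ (l - i) * (K / sqrt (real (l - i + 1) * h) * (5 / 2 * \<mu> l) * (norm v * norm w powr \<beta>))"
          unfolding norm_rho K_def
          by (rule mult_left_mono[OF heat_second_difference_holder[OF pos bounded_borel_F F_holder_aux[OF IH[OF l]]] rho_nonneg])
      qed
      also have "\<dots> = 5 / 2 * (norm v * norm w powr \<beta>) * (K * (\<Sum>l=i..<N. \<rho> ^ (l - i) * \<mu> l / sqrt (real (l - i + 1) * h)))"
        unfolding sum_distrib_left by (intro sum.cong refl) (simp add: mult_ac)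
      also have "\<dots> \<le> 5 / 2 * (norm v * norm w powr \<beta>) * (1 / 3)"
        by (intro mult_left_mono sm) auto
      also have "\<dots> \<le> norm v * norm w powr \<beta>" by simp
      finally show "norm (second_difference (u i) y v w) \<le> norm v * norm w powr \<beta>" .
    qed
  qed
qed

lemmas u_lipschitz = u_bounds[THEN conjunct1, rule_format]
lemmas u_second_holder = u_bounds[THEN conjunct2, rule_format]
lemmas F_holder = F_holder_aux[OF u_lipschitz u_second_holder]

text \<open>
  Bounds the second derivative of \<open>u i\<close>. In contrast to \<open>u_bounds\<close> it may be large for single \<open>i\<close>; it is
  controlled in the mean square over \<open>i\<close>.
\<close>

definition hess :: "nat \<Rightarrow> real" where
  "hess i = 5 * (gauss_const TYPE('n))\<^sup>2 * (\<Sum>l=i..<N. (real (l - i + 1) * h) powr (\<beta> / 2 - 1) * \<mu> l)"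

lemma hess_nonneg: "0 \<le> hess i"
  unfolding hess_def using \<mu> by (auto intro!: mult_nonneg_nonneg sum_nonneg)

lemma u_second_lipschitz: "norm (second_difference (u i) y v w) \<le> hess i * (norm v * norm w)"
proof (cases "i < N")
  case False
  then show ?thesis using hess_nonneg by (simp add: second_difference_def)
next
  case True
  have pos: "real (k + 1) * h > 0" for k using h by simp
  define K where "K = gauss_const TYPE('n)"
  have "norm (second_difference (u i) y v w)
      \<le> (\<Sum>l=i..<N. 1 * (2 * K\<^sup>2 * (real (l - i + 1) * h) powr (\<beta> / 2 - 1) * (5 / 2 * \<mu> l) * (norm v * norm w)))"
    unfolding second_difference_u_sum[OF less_imp_le[OF True]]
  proof (rule order_trans[OF norm_sum sum_mono])
    fix l assume l: "l \<in> {i..<N}"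
    show "norm (\<rho> ^ (l - i) *\<^sub>R second_difference (heat (real (l - i + 1) * h) (F l)) y v w)
      \<le> 1 * (2 * K\<^sup>2 * (real (l - i + 1) * h) powr (\<beta> / 2 - 1) * (5 / 2 * \<mu> l) * (norm v * norm w))"
      unfolding norm_scaleR K_def
    proof (rule mult_mono)
      show "\<bar>\<rho> ^ (l - i)\<bar> \<le> 1" using \<rho> by (simp add: power_le_one)
      show "norm (second_difference (heat (real (l - i + 1) * h) (F l)) y v w)
        \<le> 2 * (gauss_const TYPE('n))\<^sup>2 * (real (l - i + 1) * h) powr (\<beta> / 2 - 1) * (5 / 2 * \<mu> l) * (norm v * norm w)"
        by (rule heat_second_difference_lipschitz[OF pos bounded_borel_F _ \<beta> F_holder]) (use \<mu> in auto)
    qed auto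
  qed
  also have "\<dots> = hess i * (norm v * norm w)"
    unfolding hess_def K_def sum_distrib_left sum_distrib_right by (intro sum.cong refl) simp
  finally show ?thesis .
qed

lemma F_lipschitz:
  assumes "norm (D i y - D i z) \<le> \<Lambda> * norm (y - z)"
  shows "norm (F i y - F i z) \<le> (3 / 2 * \<Lambda> + hess (Suc i) * \<mu> i) * norm (y - z)"
proof -
  have "norm (F i y - F i z) \<le> norm (D i y - D i z) + norm (u (Suc i) (y + D i y) - u (Suc i) (y + D i z))
      + norm (second_difference (u (Suc i)) z (D i z) (y - z))"
    unfolding F_diff_split by (intro order_trans[OF norm_triangle_ineq] add_mono norm_triangle_ineq order_refl)
  also have "\<dots> \<le> \<Lambda> * norm (y - z) + 1 / 2 * (\<Lambda> * norm (y - z)) + hess (Suc i) * (\<mu> i * norm (y - z))"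
  proof (intro add_mono assms)
    show "norm (u (Suc i) (y + D i y) - u (Suc i) (y + D i z)) \<le> 1 / 2 * (\<Lambda> * norm (y - z))"
      by (rule order_trans[OF u_lipschitz]) (use assms in simp)
    show "norm (second_difference (u (Suc i)) z (D i z) (y - z)) \<le> hess (Suc i) * (\<mu> i * norm (y - z))"
      by (rule order_trans[OF u_second_lipschitz]) (intro mult_left_mono mult_right_mono D_bound norm_ge_zero hess_nonneg)
  qed
  finally show ?thesis by (simp add: algebra_simps)
qed

end

section \<open>One step of the transformed scheme\<close>

text \<open>
  The remainder is quadratic in \<open>s\<close>, so that a centred perturbation of size \<open>\<epsilon>\<close> changes the mean of a power
  only by the order \<open>\<epsilon>\<^sup>2\<close>.
\<close>

lemma one_add_power_le:
  fixes s :: real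
  assumes "-1 \<le> s"
  shows "(1 + s) ^ n \<le> 1 + real n * s + (real n)\<^sup>2 * s\<^sup>2 * (1 + \<bar>s\<bar>) ^ n"
proof (induction n)
  case (Suc n)
  define p where "p = (1 + \<bar>s\<bar>) ^ Suc n"
  have p: "1 \<le> p" unfolding p_def by (rule one_le_power) simp
  have "(1 + s) ^ Suc n \<le> (1 + s) * (1 + real n * s + (real n)\<^sup>2 * s\<^sup>2 * (1 + \<bar>s\<bar>) ^ n)"
    using assms Suc by (simp add: mult_left_mono)
  also have "\<dots> = 1 + (real n + 1) * s + real n * s\<^sup>2 + (real n)\<^sup>2 * s\<^sup>2 * ((1 + s) * (1 + \<bar>s\<bar>) ^ n)"
    by (simp add: algebra_simps power2_eq_square)
  also have "\<dots> \<le> 1 + (real n + 1) * s + real n * s\<^sup>2 * p + (real n)\<^sup>2 * s\<^sup>2 * p"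
  proof (intro add_mono order_refl mult_left_mono)
    show "real n * s\<^sup>2 \<le> real n * s\<^sup>2 * p" using mult_left_mono[OF p, of "real n * s\<^sup>2"] by simp
    show "(1 + s) * (1 + \<bar>s\<bar>) ^ n \<le> p" unfolding p_def power_Suc by (intro mult_right_mono) auto
  qed auto
  also have "\<dots> \<le> 1 + real (Suc n) * s + (real (Suc n))\<^sup>2 * s\<^sup>2 * p"
  proof -
    have "(real n + (real n)\<^sup>2) * (s\<^sup>2 * p) \<le> (real (Suc n))\<^sup>2 * (s\<^sup>2 * p)"
      using p by (intro mult_right_mono) (auto simp: power2_eq_square algebra_simps)
    then show ?thesis by (simp add: algebra_simps)
  qed
  finally show ?case by (simp add: p_def)
qed simp

text \<open>
  The constant of \<open>moment_perturbation\<close>. It depends neither on \<open>h\<close> nor on \<open>\<kappa>\<close> nor on the perturbed vector.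
\<close>

definition step_const :: "nat \<Rightarrow> real \<Rightarrow> real \<Rightarrow> real \<Rightarrow> real" where
  "step_const n B L M = 2 * real n * B
     + (4 * real n * L\<^sup>2 + (real n)\<^sup>2 * (4 * L + 4 * L\<^sup>2 * B)\<^sup>2 * (1 + (4 * L + 4 * L\<^sup>2 * B) * B) ^ n) * M"

lemma moment_perturbation_pointwise:
  fixes G v :: "'a::real_inner"
  assumes n: "1 \<le> n" and \<kappa>: "0 \<le> \<kappa>" "\<kappa> \<le> B" and B: "1 \<le> B" and L: "0 \<le> L" and \<xi>: "1 \<le> \<xi>"
    and R: "norm v \<le> 2 * norm G * sqrt \<kappa> * L * \<xi>"
  shows "norm (G + v) ^ (2 * n) \<le> norm G ^ (2 * n) * (1 + 2 * real n * ((G \<bullet> v) / (norm G)\<^sup>2)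
    + \<kappa> * (4 * real n * L\<^sup>2 + (real n)\<^sup>2 * (4 * L + 4 * L\<^sup>2 * B)\<^sup>2 * (1 + (4 * L + 4 * L\<^sup>2 * B) * B) ^ n) * \<xi> ^ (2 * n + 4))"
proof (cases "G = 0")
  case True
  then show ?thesis using R n by (simp add: power_0_left)
next
  case False
  define A where "A = 4 * L + 4 * L\<^sup>2 * B"
  define g where "g = norm G"
  have g: "g > 0" using False by (simp add: g_def)
  have A: "0 \<le> A" using L B by (simp add: A_def)
  define s where "s = 2 * ((G \<bullet> v) / g\<^sup>2) + (norm v / g)\<^sup>2"
  have sk: "sqrt \<kappa> \<le> B"
  proof -
    have "sqrt \<kappa> \<le> sqrt B" using \<kappa> by simp
    also have "\<dots> \<le> B" using B by (simp add: real_le_lsqrt power2_eq_square)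
    finally show ?thesis .
  qed
  have v: "norm v / g \<le> 2 * sqrt \<kappa> * L * \<xi>" using R g by (simp add: g_def divide_le_eq mult_ac)
  have v0: "0 \<le> norm v / g" using g by simp
  have "(norm (G + v))\<^sup>2 = g\<^sup>2 + 2 * (G \<bullet> v) + (norm v)\<^sup>2"
    unfolding g_def power2_norm_eq_inner by (simp add: inner_add_left inner_add_right inner_commute)
  then have eq: "(norm (G + v))\<^sup>2 = g\<^sup>2 * (1 + s)"
    using g by (simp add: s_def power_divide field_simps)
  have s1: "-1 \<le> s"
  proof -
    have "0 \<le> g\<^sup>2 * (1 + s)" unfolding eq[symmetric] by simp
    then show ?thesis using g by (simp add: zero_le_mult_iff)
  qed
  have v2: "(norm v / g)\<^sup>2 \<le> 4 * \<kappa> * L\<^sup>2 * \<xi>\<^sup>2"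
  proof -
    have "(norm v / g)\<^sup>2 \<le> (2 * sqrt \<kappa> * L * \<xi>)\<^sup>2" by (rule power_mono[OF v v0])
    also have "\<dots> = 4 * \<kappa> * L\<^sup>2 * \<xi>\<^sup>2" using \<kappa> by (simp add: power_mult_distrib)
    finally show ?thesis .
  qed
  have xi2: "\<xi> \<le> \<xi>\<^sup>2" using \<xi> by (simp add: power2_eq_square)
  have s2: "\<bar>s\<bar> \<le> sqrt \<kappa> * A * \<xi>\<^sup>2"
  proof -
    have "\<bar>G \<bullet> v\<bar> / g\<^sup>2 \<le> norm v / g"
      using Cauchy_Schwarz_ineq2[of G v] g by (simp add: g_def field_simps power2_eq_square)
    then have "\<bar>s\<bar> \<le> 2 * (norm v / g) + (norm v / g)\<^sup>2"
      unfolding s_def by (intro order_trans[OF abs_triangle_ineq]) (auto simp: abs_mult)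
    also have "\<dots> \<le> 2 * (2 * sqrt \<kappa> * L * \<xi>) + 4 * \<kappa> * L\<^sup>2 * \<xi>\<^sup>2"
      by (intro add_mono mult_left_mono v v2) auto
    also have "\<dots> \<le> 2 * (2 * sqrt \<kappa> * L * \<xi>\<^sup>2) + 4 * (sqrt \<kappa> * B) * L\<^sup>2 * \<xi>\<^sup>2"
    proof (intro add_mono mult_left_mono mult_right_mono xi2)
      show "\<kappa> \<le> sqrt \<kappa> * B" using mult_left_mono[OF sk, of "sqrt \<kappa>"] \<kappa> by simp
    qed (use L \<kappa> in auto)
    also have "\<dots> = sqrt \<kappa> * A * \<xi>\<^sup>2" by (simp add: A_def algebra_simps)
    finally show ?thesis .
  qed
  have s3: "1 + \<bar>s\<bar> \<le> (1 + A * B) * \<xi>\<^sup>2"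
  proof -
    have "\<bar>s\<bar> \<le> B * A * \<xi>\<^sup>2" using s2 mult_right_mono[OF sk A] by (meson mult_right_mono order_trans zero_le_power2)
    moreover have "1 \<le> \<xi>\<^sup>2" using \<xi> by (rule one_le_power)
    ultimately show ?thesis by (simp add: algebra_simps)
  qed
  have s4: "s\<^sup>2 \<le> \<kappa> * A\<^sup>2 * \<xi> ^ 4"
  proof -
    have "\<bar>s\<bar>\<^sup>2 \<le> (sqrt \<kappa> * A * \<xi>\<^sup>2)\<^sup>2" by (intro power_mono s2) auto
    then show ?thesis using \<kappa> by (simp add: power_mult_distrib)
  qed
  have "(1 + s) ^ n \<le> 1 + real n * s + (real n)\<^sup>2 * s\<^sup>2 * (1 + \<bar>s\<bar>) ^ n"
    by (rule one_add_power_le[OF s1])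
  also have "\<dots> \<le> 1 + real n * (2 * ((G \<bullet> v) / g\<^sup>2) + 4 * \<kappa> * L\<^sup>2 * \<xi> ^ (2 * n + 4))
      + (real n)\<^sup>2 * (\<kappa> * A\<^sup>2 * \<xi> ^ 4) * ((1 + A * B) * \<xi>\<^sup>2) ^ n"
  proof (intro add_mono order_refl)
    have "\<xi>\<^sup>2 \<le> \<xi> ^ (2 * n + 4)" using \<xi> by (intro power_increasing) auto
    then have "4 * \<kappa> * L\<^sup>2 * \<xi>\<^sup>2 \<le> 4 * \<kappa> * L\<^sup>2 * \<xi> ^ (2 * n + 4)" using \<kappa> by (intro mult_left_mono) auto
    then have "s \<le> 2 * ((G \<bullet> v) / g\<^sup>2) + 4 * \<kappa> * L\<^sup>2 * \<xi> ^ (2 * n + 4)"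
      using v2 unfolding s_def by linarith
    then show "real n * s \<le> real n * (2 * ((G \<bullet> v) / g\<^sup>2) + 4 * \<kappa> * L\<^sup>2 * \<xi> ^ (2 * n + 4))"
      by (rule mult_left_mono) simp
    show "(real n)\<^sup>2 * s\<^sup>2 * (1 + \<bar>s\<bar>) ^ n \<le> (real n)\<^sup>2 * (\<kappa> * A\<^sup>2 * \<xi> ^ 4) * ((1 + A * B) * \<xi>\<^sup>2) ^ n"
      by (intro mult_mono mult_left_mono power_mono s3 s4) (use \<kappa> \<xi> in auto)
  qed
  also have "\<dots> = 1 + 2 * real n * ((G \<bullet> v) / g\<^sup>2) + \<kappa> * (4 * real n * L\<^sup>2 + (real n)\<^sup>2 * A\<^sup>2 * (1 + A * B) ^ n) * \<xi> ^ (2 * n + 4)"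
  proof -
    have "((1 + A * B) * \<xi>\<^sup>2) ^ n = (1 + A * B) ^ n * \<xi> ^ (2 * n)"
      by (simp only: power_mult_distrib power_mult)
    then show ?thesis by (simp add: power_add algebra_simps)
  qed
  finally have "(1 + s) ^ n \<le> 1 + 2 * real n * ((G \<bullet> v) / g\<^sup>2)
     + \<kappa> * (4 * real n * L\<^sup>2 + (real n)\<^sup>2 * A\<^sup>2 * (1 + A * B) ^ n) * \<xi> ^ (2 * n + 4)" .
  then have "g ^ (2 * n) * (1 + s) ^ n \<le> g ^ (2 * n) * (1 + 2 * real n * ((G \<bullet> v) / g\<^sup>2)
     + \<kappa> * (4 * real n * L\<^sup>2 + (real n)\<^sup>2 * A\<^sup>2 * (1 + A * B) ^ n) * \<xi> ^ (2 * n + 4))"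
    using g by (intro mult_left_mono) auto
  moreover have "norm (G + v) ^ (2 * n) = g ^ (2 * n) * (1 + s) ^ n"
    unfolding power_mult eq power_mult_distrib ..
  ultimately show ?thesis unfolding A_def g_def by simp
qed

text \<open>
  \<open>R\<close> is of order \<open>sqrt \<kappa>\<close> relative to \<open>G\<close>, but its mean is of order \<open>\<kappa>\<close>. So the linear term of the
  expansion contributes through the mean only, and the quadratic remainder is of order \<open>\<kappa>\<close> as well.
\<close>

lemma moment_perturbation:
  fixes G :: "real ^ 'n::finite" and R :: "real ^ 'n \<Rightarrow> real ^ 'n"
  assumes h: "h > 0" and [measurable]: "R \<in> borel_measurable borel"
    and n: "1 \<le> n" and \<kappa>: "0 \<le> \<kappa>" "\<kappa> \<le> B" and B: "1 \<le> B" and L: "0 \<le> L"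
    and R: "\<And>w. norm (R w) \<le> 2 * norm G * sqrt \<kappa> * L * (1 + norm w / sqrt h)"
    and mean: "norm (\<integral>w. R w \<partial>gauss_measure h) \<le> B * \<kappa> * norm G"
    and M: "integrable (gauss_measure h) (\<lambda>w :: real ^ 'n. (1 + norm w / sqrt h) ^ (2 * n + 4))"
      "(\<integral>w. (1 + norm (w :: real ^ 'n) / sqrt h) ^ (2 * n + 4) \<partial>gauss_measure h) \<le> M"
  shows "(\<integral>\<^sup>+w. ennreal (norm (G + R w) ^ (2 * n)) \<partial>gauss_measure h)
    \<le> ennreal ((1 + step_const n B L M * \<kappa>) * norm G ^ (2 * n))"
proof -
  interpret prob_space "gauss_measure h :: (real ^ 'n) measure" by (rule prob_space_gauss_measure[OF h])
  define C1 where "C1 = 4 * real n * L\<^sup>2 + (real n)\<^sup>2 * (4 * L + 4 * L\<^sup>2 * B)\<^sup>2 * (1 + (4 * L + 4 * L\<^sup>2 * B) * B) ^ n"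
  have C1: "0 \<le> C1" using L B by (simp add: C1_def)
  define \<xi> where "\<xi> w = 1 + norm w / sqrt h" for w :: "real ^ 'n"
  have \<xi>: "1 \<le> \<xi> w" for w using h by (simp add: \<xi>_def)
  have intR: "integrable (gauss_measure h) R"
    by (rule integrable_gauss_mono(1)[OF h _ R]) measurable
  define rhs where "rhs w = norm G ^ (2 * n) * (1 + 2 * real n * ((G \<bullet> R w) / (norm G)\<^sup>2) + \<kappa> * C1 * \<xi> w ^ (2 * n + 4))" for w
  have pw: "norm (G + R w) ^ (2 * n) \<le> rhs w" for w
    unfolding rhs_def C1_def
    by (rule moment_perturbation_pointwise[OF n \<kappa> B L \<xi>]) (use R in \<open>simp add: \<xi>_def\<close>)
  have irhs: "integrable (gauss_measure h) rhs"
    unfolding rhs_def[abs_def] \<xi>_def using intR M(1) by auto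
  have "(\<integral>\<^sup>+w. ennreal (norm (G + R w) ^ (2 * n)) \<partial>gauss_measure h) \<le> (\<integral>\<^sup>+w. ennreal (rhs w) \<partial>gauss_measure h)"
    by (intro nn_integral_mono ennreal_leI pw)
  also have "\<dots> = ennreal (\<integral>w. rhs w \<partial>gauss_measure h)"
    by (intro nn_integral_eq_integral irhs AE_I2 order_trans[OF _ pw]) auto
  also have "(\<integral>w. rhs w \<partial>gauss_measure h) = norm G ^ (2 * n) * (1 + 2 * real n * ((G \<bullet> (\<integral>w. R w \<partial>gauss_measure h)) / (norm G)\<^sup>2)
     + \<kappa> * C1 * (\<integral>w. \<xi> w ^ (2 * n + 4) \<partial>gauss_measure h))"
    unfolding rhs_def using intR M(1) prob_space by (simp add: \<xi>_def)
  also have "\<dots> \<le> norm G ^ (2 * n) * (1 + 2 * real n * (B * \<kappa>) + \<kappa> * C1 * M)"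
  proof (intro mult_left_mono add_mono order_refl)
    have "(G \<bullet> (\<integral>w. R w \<partial>gauss_measure h)) / (norm G)\<^sup>2 \<le> norm G * (B * \<kappa> * norm G) / (norm G)\<^sup>2"
      by (intro divide_right_mono order_trans[OF norm_cauchy_schwarz] mult_left_mono mean) auto
    also have "\<dots> \<le> B * \<kappa>" using B \<kappa> by (cases "G = 0") (auto simp: power2_eq_square)
    finally show "(G \<bullet> (\<integral>w. R w \<partial>gauss_measure h)) / (norm G)\<^sup>2 \<le> B * \<kappa>" .
    show "(\<integral>w. \<xi> w ^ (2 * n + 4) \<partial>gauss_measure h) \<le> M" using M(2) by (simp add: \<xi>_def)
  qed (use C1 \<kappa> in auto)
  also have "\<dots> = (1 + step_const n B L M * \<kappa>) * norm G ^ (2 * n)"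
    unfolding step_const_def C1_def[symmetric] by (simp add: algebra_simps)
  finally show ?thesis by (simp add: ennreal_leI)
qed

context corrector
begin

definition \<psi> :: "nat \<Rightarrow> real ^ 'n \<Rightarrow> real ^ 'n" where
  "\<psi> i y = y + D i y"

text \<open>
  The difference of two states in the transformed coordinates \<open>y + u i y\<close>.
\<close>

definition gap :: "nat \<Rightarrow> real ^ 'n \<Rightarrow> real ^ 'n \<Rightarrow> real ^ 'n" where
  "gap i x z = (x - z) + (u i x - u i z)"

lemma gap_lower: "norm (x - z) \<le> 2 * norm (gap i x z)"
proof -
  have "norm (x - z) \<le> norm (gap i x z) + norm (u i x - u i z)"
    unfolding gap_def by (metis add_diff_cancel_right' norm_triangle_ineq4)
  then show ?thesis using u_lipschitz[of i x z] by linarith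
qed

lemma gap_upper: "norm (gap i x z) \<le> 3 / 2 * norm (x - z)"
  unfolding gap_def using norm_triangle_ineq[of "x - z" "u i x - u i z"] u_lipschitz[of i x z] by linarith

lemma gap_step: "gap (Suc i) (\<psi> i (x + w)) (\<psi> i (z + w))
    = (x - z) + (u (Suc i) (x + w) - u (Suc i) (z + w)) + (F i (x + w) - F i (z + w))"
  by (simp add: gap_def \<psi>_def F_eq)

text \<open>
  The rough drift has disappeared from the transformed gap: it changes in a step by the increments of
  \<open>u (Suc i)\<close> and \<open>F i\<close> only, minus their means, and by a contribution of the damping. The part of \<open>u\<close>
  fluctuates by \<open>hess (Suc i) * norm w\<close>, the part of \<open>F\<close> by the Lipschitz constant of \<open>F i\<close>; both are of
  order \<open>sqrt \<kappa>\<close>. Only the damping has a mean, of order \<open>\<kappa>\<close>.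
\<close>

lemma gap_moment:
  assumes i: "i < N" and n: "1 \<le> n" and \<kappa>: "0 \<le> \<kappa>" "\<kappa> \<le> B" and B: "1 \<le> B"
    and lip: "\<And>y z. norm (D i y - D i z) \<le> \<Lambda> * norm (y - z)"
    and k1: "hess (Suc i) * sqrt h \<le> sqrt \<kappa>"
    and k2: "3 / 2 * \<Lambda> + hess (Suc i) * \<mu> i \<le> B * sqrt \<kappa>"
    and k3: "1 - \<rho> \<le> B * \<kappa>"
    and L: "L = 1 + gauss_const TYPE('n) + B\<^sup>2 / 2 + 2 * B"
    and M: "integrable (gauss_measure h) (\<lambda>w :: real ^ 'n. (1 + norm w / sqrt h) ^ (2 * n + 4))"
      "(\<integral>w. (1 + norm (w :: real ^ 'n) / sqrt h) ^ (2 * n + 4) \<partial>gauss_measure h) \<le> M"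
  shows "(\<integral>\<^sup>+w. ennreal (norm (gap (Suc i) (\<psi> i (x + w)) (\<psi> i (z + w))) ^ (2 * n)) \<partial>gauss_measure h)
    \<le> ennreal ((1 + step_const n B L M * \<kappa>) * norm (gap i x z) ^ (2 * n))"
proof -
  interpret prob_space "gauss_measure h :: (real ^ 'n) measure" by (rule prob_space_gauss_measure[OF h])
  define K where "K = gauss_const TYPE('n)"
  define r where "r = norm (x - z)"
  have r: "0 \<le> r" by (simp add: r_def)
  define q where "q w = u (Suc i) (x + w) - u (Suc i) (z + w)" for w
  define p where "p w = F i (x + w) - F i (z + w)" for w
  define R where "R w = gap (Suc i) (\<psi> i (x + w)) (\<psi> i (z + w)) - gap i x z" for w
  define Eq where "Eq = heat h (u (Suc i)) x - heat h (u (Suc i)) z"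
  define Ep where "Ep = heat h (F i) x - heat h (F i) z"
  have [measurable]: "u (Suc i) \<in> borel_measurable borel" "F i \<in> borel_measurable borel"
    using bounded_borel_u bounded_borel_F by (auto dest: bounded_borelD)
  have Eq: "Eq = (\<integral>w. q w \<partial>gauss_measure h)" and iq: "integrable (gauss_measure h) q"
    unfolding Eq_def q_def heat_def
    by (auto intro!: Bochner_Integration.integral_diff[symmetric] integrable_gauss_bounded[OF h bounded_borel_u])
  have Ep: "Ep = (\<integral>w. p w \<partial>gauss_measure h)" and ip: "integrable (gauss_measure h) p"
    unfolding Ep_def p_def heat_def
    by (auto intro!: Bochner_Integration.integral_diff[symmetric] integrable_gauss_bounded[OF h bounded_borel_F])
  have "u i y = \<rho> *\<^sub>R heat h (u (Suc i)) y + heat h (F i) y" for y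
    unfolding u_step[OF i] heat_add[OF h bounded_borel_scaleR[OF bounded_borel_u] bounded_borel_F] heat_scaleR ..
  then have ui: "u i x - u i z = \<rho> *\<^sub>R Eq + Ep"
    unfolding Eq_def Ep_def by (simp add: algebra_simps)
  have R_eq: "R w = (q w - \<rho> *\<^sub>R Eq) + (p w - Ep)" for w
    unfolding R_def gap_step using ui by (simp add: gap_def q_def p_def algebra_simps)
  have q_bound: "norm (q w) \<le> r / 2" for w
    using u_lipschitz[of "Suc i" "x + w" "z + w"] by (simp add: q_def r_def)
  have q_diff: "norm (q w - q 0) \<le> (hess (Suc i) * sqrt h * r) * (norm w / sqrt h)" for w
  proof -
    have "q w - q 0 = second_difference (u (Suc i)) z (x - z) w"
      by (simp add: q_def second_difference_def)
    also have "norm \<dots> \<le> hess (Suc i) * (norm (x - z) * norm w)" by (rule u_second_lipschitz)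
    finally show ?thesis using h by (simp add: r_def mult_ac)
  qed
  have q_diff': "norm (q w - q 0) \<le> (sqrt \<kappa> * r) * (norm w / sqrt h)" for w
    by (rule order_trans[OF q_diff]) (intro mult_right_mono k1 r, use h in auto)
  have Eq_bound: "norm Eq \<le> r / 2"
  proof -
    have "norm Eq \<le> (\<integral>w. r / 2 \<partial>(gauss_measure h :: (real ^ 'n) measure))"
      unfolding Eq by (rule Bochner_Integration.integral_norm_bound_integral[OF iq _ q_bound]) simp
    then show ?thesis using prob_space by simp
  qed
  have Eq_diff: "norm (Eq - q 0) \<le> sqrt \<kappa> * r * K"
  proof -
    have "Eq - q 0 = (\<integral>w. q w - q 0 \<partial>gauss_measure h)"
      unfolding Eq using iq prob_space by simp
    also have "norm \<dots> \<le> sqrt \<kappa> * r * K"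
      unfolding K_def
    proof (rule integrable_gauss_mono(2)[OF h])
      show "(\<lambda>w. q w - q 0) \<in> borel_measurable borel" unfolding q_def by measurable
      show "norm (q w - q 0) \<le> sqrt \<kappa> * r * (1 + norm w / sqrt h)" for w
        by (rule order_trans[OF q_diff']) (use \<kappa> r in \<open>auto simp: algebra_simps\<close>)
    qed
    finally show ?thesis .
  qed
  have p_bound: "norm (p w) \<le> B * sqrt \<kappa> * r" for w
  proof -
    have "norm (p w) \<le> (3 / 2 * \<Lambda> + hess (Suc i) * \<mu> i) * norm (x + w - (z + w))"
      unfolding p_def by (rule F_lipschitz[OF lip])
    also have "\<dots> \<le> B * sqrt \<kappa> * norm (x + w - (z + w))"
      by (intro mult_right_mono k2) auto
    finally show ?thesis by (simp add: r_def)
  qed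
  have Ep_bound: "norm Ep \<le> B * sqrt \<kappa> * r"
  proof -
    have "norm Ep \<le> (\<integral>w. B * sqrt \<kappa> * r \<partial>(gauss_measure h :: (real ^ 'n) measure))"
      unfolding Ep by (rule Bochner_Integration.integral_norm_bound_integral[OF ip _ p_bound]) simp
    then show ?thesis using prob_space by simp
  qed
  have k4: "\<kappa> \<le> B * sqrt \<kappa>"
  proof -
    have "sqrt \<kappa> \<le> sqrt B" using \<kappa> by simp
    also have "\<dots> \<le> B" using B by (simp add: real_le_lsqrt power2_eq_square)
    finally show ?thesis using mult_right_mono[of "sqrt \<kappa>" B "sqrt \<kappa>"] \<kappa> by simp
  qed
  have L0: "0 \<le> L" unfolding L using B less_imp_le[OF gauss_const_pos[where 'n='n]] by (intro add_nonneg_nonneg) auto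
  have R_bound: "norm (R w) \<le> 2 * norm (gap i x z) * sqrt \<kappa> * L * (1 + norm w / sqrt h)" for w
  proof -
    define \<xi> where "\<xi> = 1 + norm w / sqrt h"
    have \<xi>: "1 \<le> \<xi>" using h by (simp add: \<xi>_def)
    have Rw: "R w = (q w - q 0) - (Eq - q 0) + (1 - \<rho>) *\<^sub>R Eq + p w - Ep"
      unfolding R_eq by (simp add: algebra_simps)
    have "norm (R w) \<le> norm (q w - q 0) + norm (Eq - q 0) + norm ((1 - \<rho>) *\<^sub>R Eq) + norm (p w) + norm Ep"
      unfolding Rw using norm_triangle_ineq4[of "(q w - q 0) - (Eq - q 0) + (1 - \<rho>) *\<^sub>R Eq + p w" Ep]
        norm_triangle_ineq[of "(q w - q 0) - (Eq - q 0) + (1 - \<rho>) *\<^sub>R Eq" "p w"]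
        norm_triangle_ineq[of "(q w - q 0) - (Eq - q 0)" "(1 - \<rho>) *\<^sub>R Eq"]
        norm_triangle_ineq4[of "q w - q 0" "Eq - q 0"] by linarith
    also have "\<dots> \<le> (sqrt \<kappa> * r) * \<xi> + sqrt \<kappa> * r * K + (B * (B * sqrt \<kappa>)) * (r / 2) + B * sqrt \<kappa> * r + B * sqrt \<kappa> * r"
    proof (intro add_mono Eq_diff p_bound Ep_bound)
      show "norm (q w - q 0) \<le> sqrt \<kappa> * r * \<xi>"
        by (rule order_trans[OF q_diff']) (use \<kappa> r in \<open>auto simp: algebra_simps \<xi>_def\<close>)
      show "norm ((1 - \<rho>) *\<^sub>R Eq) \<le> B * (B * sqrt \<kappa>) * (r / 2)"
        unfolding norm_scaleR
      proof (rule mult_mono[OF _ Eq_bound])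
        have "1 - \<rho> \<le> B * (B * sqrt \<kappa>)"
          by (rule order_trans[OF k3]) (use B in \<open>intro mult_left_mono k4, auto\<close>)
        then show "\<bar>1 - \<rho>\<bar> \<le> B * (B * sqrt \<kappa>)" using \<rho> by simp
      qed (use B \<kappa> in auto)
    qed
    also have "\<dots> = r * sqrt \<kappa> * (\<xi> + (K + B\<^sup>2 / 2 + 2 * B) * 1)"
      by (simp add: algebra_simps power2_eq_square)
    also have "\<dots> \<le> r * sqrt \<kappa> * (\<xi> + (K + B\<^sup>2 / 2 + 2 * B) * \<xi>)"
      using r \<kappa> \<xi> B less_imp_le[OF gauss_const_pos[where 'n='n]] unfolding K_def
      by (intro mult_left_mono add_mono) (auto intro!: add_nonneg_nonneg)
    also have "\<dots> = r * (sqrt \<kappa> * L * \<xi>)" by (simp add: L K_def algebra_simps)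
    also have "\<dots> \<le> (2 * norm (gap i x z)) * (sqrt \<kappa> * L * \<xi>)"
      using gap_lower[of x z i] L0 \<kappa> \<xi> by (intro mult_right_mono) (auto simp: r_def)
    finally show ?thesis by (simp add: \<xi>_def mult_ac)
  qed
  have R_meas: "R \<in> borel_measurable borel"
    unfolding R_eq[abs_def] q_def p_def by measurable
  have "(\<integral>w. R w \<partial>gauss_measure h) = (1 - \<rho>) *\<^sub>R Eq"
    unfolding R_eq using iq ip prob_space by (simp add: Eq[symmetric] Ep[symmetric] algebra_simps)
  also have "norm \<dots> \<le> (B * \<kappa>) * (r / 2)"
    unfolding norm_scaleR using k3 \<rho> B \<kappa> by (intro mult_mono Eq_bound) auto
  also have "\<dots> \<le> (B * \<kappa>) * norm (gap i x z)"
    using gap_lower[of x z i] B \<kappa> by (intro mult_left_mono) (auto simp: r_def)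
  finally have mean: "norm (\<integral>w. R w \<partial>gauss_measure h) \<le> B * \<kappa> * norm (gap i x z)" .
  have "(\<integral>\<^sup>+w. ennreal (norm (gap i x z + R w) ^ (2 * n)) \<partial>gauss_measure h)
    \<le> ennreal ((1 + step_const n B L M * \<kappa>) * norm (gap i x z) ^ (2 * n))"
    by (rule moment_perturbation[OF h R_meas n \<kappa> B L0 R_bound mean M])
  then show ?thesis by (simp add: R_def)
qed

end

section \<open>Singular kernel sums\<close>

text \<open>
  A Riemann sum of \<open>t powr (- s)\<close>; the induction step is the concavity of \<open>t powr (1 - s)\<close>.
\<close>

lemma sum_powr_le:
  assumes s: "0 \<le> s" "s < 1" and h: "h > 0"
  shows "(\<Sum>k<N. h * (real (Suc k) * h) powr (- s)) \<le> (real N * h) powr (1 - s) / (1 - s)"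
proof (induction N)
  case (Suc N)
  define a where "a = 1 - s"
  have a: "0 < a" "a \<le> 1" using s by (auto simp: a_def)
  have conc: "(real N) powr a \<le> real (Suc N) powr a - a * real (Suc N) powr (- s)"
  proof (cases "N = 0")
    case True
    then show ?thesis using a by simp
  next
    case False
    have "(real N / real (Suc N)) powr a * 1 powr (1 - a) \<le> a * (real N / real (Suc N)) + (1 - a) * 1"
      using a False by (intro Youngs_inequality_0) auto
    then have "(real N / real (Suc N)) powr a \<le> 1 - a / real (Suc N)"
      by (simp add: field_simps)
    then have "real (Suc N) powr a * (real N / real (Suc N)) powr a \<le> real (Suc N) powr a * (1 - a / real (Suc N))"
      by (intro mult_left_mono) auto
    moreover have "real (Suc N) powr a * (real N / real (Suc N)) powr a = real N powr a"
      by (simp add: powr_mult[symmetric])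
    moreover have "real (Suc N) powr a * (1 - a / real (Suc N)) = real (Suc N) powr a - a * (real (Suc N) powr a / real (Suc N))"
      by (simp add: right_diff_distrib del: of_nat_Suc)
    moreover have "real (Suc N) powr a / real (Suc N) = real (Suc N) powr (- s)"
      using powr_diff[of "real (Suc N)" a 1] by (simp add: a_def)
    ultimately show ?thesis by (simp only:)
  qed
  have e: "h * (real (Suc N) * h) powr (- s) = h powr a * real (Suc N) powr (- s)"
    using h by (simp add: a_def powr_mult powr_diff powr_minus field_simps del: of_nat_Suc)
  have "(\<Sum>k<Suc N. h * (real (Suc k) * h) powr (- s)) \<le> (real N * h) powr a / a + h powr a * real (Suc N) powr (- s)"
    using Suc.IH unfolding a_def[symmetric] by (simp add: e del: of_nat_Suc)
  also have "\<dots> = h powr a / a * (real N powr a + a * real (Suc N) powr (- s))"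
    using a h by (simp add: powr_mult field_simps)
  also have "\<dots> \<le> h powr a / a * real (Suc N) powr a"
    using conc a by (intro mult_left_mono) auto
  also have "\<dots> = (real (Suc N) * h) powr a / a"
    using h by (simp add: powr_mult)
  finally show ?case by (simp add: a_def)
qed simp

lemma exp_minus_le_powr:
  fixes x e :: real
  assumes "0 < x" "0 < e" "e \<le> 1"
  shows "exp (- x) \<le> x powr (- e)"
proof -
  have "x powr e \<le> 1 + x"
  proof (cases "x \<le> 1")
    case True
    then show ?thesis using powr_le1[of e x] assms by linarith
  next
    case False
    then have "x powr e \<le> x powr 1" using assms by (intro powr_mono) auto
    then show ?thesis using assms by simp
  qed
  also have "\<dots> \<le> exp x" by simp
  finally show ?thesis using assms by (simp add: exp_minus powr_minus le_imp_inverse_le)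
qed

lemma sum_shift_le:
  fixes f :: "nat \<Rightarrow> real"
  assumes "\<And>k. 0 \<le> f k"
  shows "(\<Sum>l=i..<N. f (l - i)) \<le> (\<Sum>k<N. f k)"
proof (cases "i \<le> N")
  case True
  have "(\<Sum>l=i..<N. f (l - i)) = (\<Sum>k<N-i. f k)"
    using True by (intro sum.reindex_bij_witness[of _ "\<lambda>k. k + i" "\<lambda>l. l - i"]) auto
  also have "\<dots> \<le> (\<Sum>k<N. f k)" by (intro sum_mono2) (auto simp: assms)
  finally show ?thesis .
next
  case False
  then show ?thesis by (auto simp: assms intro: sum_nonneg)
qed

text \<open>
  By Young's inequality with exponents \<open>p\<close> and \<open>q\<close> it suffices to bound the \<open>p\<close>-th powers of the kernel.
  As \<open>p < 2\<close>, these leave room to trade a part of the exponential damping for a small power of \<open>lam\<close>.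
\<close>

lemma small_kernel_sum:
  fixes T q Q K :: real
  assumes T: "T > 0" and q: "q > 2" and Q: "Q \<ge> 0" and K: "K > 0"
  shows "\<exists>lam>0. \<forall>(N::nat) h (\<mu>::nat \<Rightarrow> real) (mq::nat \<Rightarrow> real) i. h > 0 \<longrightarrow> real N * h = T \<longrightarrow> lam * h \<le> 1 \<longrightarrow>
    (\<forall>l a \<epsilon>. a > 0 \<longrightarrow> \<epsilon> > 0 \<longrightarrow> a * \<mu> l \<le> h * (a / \<epsilon>) powr (q / (q - 1)) + \<epsilon> powr q * mq l) \<longrightarrow>
    (\<forall>l. 0 \<le> mq l) \<longrightarrow> (\<Sum>l<N. mq l) \<le> Q \<longrightarrow>
    K * (\<Sum>l=i..<N. exp (- lam * h) ^ (l - i) * \<mu> l / sqrt (real (l - i + 1) * h)) \<le> 1 / 3"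
proof -
  define p where "p = q / (q - 1)"
  have p: "1 < p" "p < 2" using q by (auto simp: p_def field_simps)
  \<comment> \<open>This gives \<open>s = p / 4 + 1 / 2\<close>, which is below 1 since \<open>p < 2\<close>.\<close>
  define e where "e = 1 / (2 * p) - 1 / 4"
  have e: "0 < e" "e \<le> 1" using p by (auto simp: e_def field_simps)
  define s where "s = p * (1 / 2 + e)"
  have s: "0 \<le> s" "s < 1" using p by (auto simp: s_def e_def field_simps)
  obtain \<epsilon> where \<epsilon>: "\<epsilon> > 0" "K * (\<epsilon> powr q * Q) \<le> 1 / 6"
  proof
    define \<epsilon> where "\<epsilon> = (1 / (6 * K * (Q + 1))) powr (1 / q)"
    show "\<epsilon> > 0" using K Q by (simp add: \<epsilon>_def)
    have "\<epsilon> powr q = 1 / (6 * K * (Q + 1))" using K Q q by (simp add: \<epsilon>_def powr_powr)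
    then have "K * (\<epsilon> powr q * Q) = K * (1 / (6 * K * (Q + 1)) * Q)" by simp
    also have "\<dots> = (Q / (Q + 1)) / 6" using K by simp
    finally have "K * (\<epsilon> powr q * Q) = (Q / (Q + 1)) / 6" .
    also have "\<dots> \<le> 1 / 6" using Q by (simp add: field_simps)
    finally show "K * (\<epsilon> powr q * Q) \<le> 1 / 6" .
  qed
  define A where "A = K * ((exp 1 / \<epsilon>) powr p * (T powr (1 - s) / (1 - s)))"
  have A: "A > 0" using K \<epsilon> T s by (auto simp: A_def)
  define lam where "lam = (6 * A) powr (1 / (p * e))"
  have lam: "lam > 0" using A by (simp add: lam_def)
  have lam_powr: "A * lam powr (- (p * e)) = 1 / 6"
    using A p e by (simp add: lam_def powr_powr powr_minus field_simps)
  show ?thesis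
  proof (intro exI[of _ lam] conjI allI impI lam)
    fix N :: nat and h :: real and \<mu> mq :: "nat \<Rightarrow> real" and i :: nat
    assume h: "h > 0" and N: "real N * h = T" and lh: "lam * h \<le> 1"
      and young: "\<forall>l a \<epsilon>. a > 0 \<longrightarrow> \<epsilon> > 0 \<longrightarrow> a * \<mu> l \<le> h * (a / \<epsilon>) powr (q / (q - 1)) + \<epsilon> powr q * mq l"
      and mq: "\<forall>l. 0 \<le> mq l" "(\<Sum>l<N. mq l) \<le> Q"
    define a where "a k = exp (- lam * h) ^ k / sqrt (real (Suc k) * h)" for k
    have a: "a k > 0" for k using h by (simp add: a_def)
    have ak: "(a k / \<epsilon>) powr p \<le> (exp 1 / \<epsilon>) powr p * lam powr (- (p * e)) * (real (Suc k) * h) powr (- s)" for k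
    proof -
      define x where "x = real (Suc k) * h"
      have x: "x > 0" using h by (simp add: x_def)
      have "exp (- lam * h) ^ k = exp (lam * h) * exp (- (lam * x))"
        by (simp add: x_def exp_of_nat_mult[symmetric] exp_add[symmetric] algebra_simps)
      also have "\<dots> \<le> exp 1 * (lam * x) powr (- e)"
        using lh lam x e by (intro mult_mono exp_minus_le_powr) auto
      finally have "a k \<le> exp 1 * (lam * x) powr (- e) / sqrt x"
        unfolding a_def x_def[symmetric] using x by (intro divide_right_mono) auto
      also have "\<dots> = exp 1 * lam powr (- e) * x powr (- e - 1 / 2)"
        using lam x by (simp add: powr_mult powr_diff powr_half_sqrt)
      finally have "a k / \<epsilon> \<le> (exp 1 / \<epsilon>) * lam powr (- e) * x powr (- e - 1 / 2)"
        using \<epsilon> by (simp add: field_simps)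
      then have "(a k / \<epsilon>) powr p \<le> ((exp 1 / \<epsilon>) * lam powr (- e) * x powr (- e - 1 / 2)) powr p"
        using a[of k] \<epsilon> p by (intro powr_mono2) auto
      also have "\<dots> = (exp 1 / \<epsilon>) powr p * lam powr (- (p * e)) * x powr (- s)"
      proof -
        have gen: "(g * lam powr (- e) * x powr (- e - 1 / 2)) powr p = g powr p * lam powr (- (p * e)) * x powr (- s)"
          if "0 < g" for g :: real
          using that by (simp add: powr_mult powr_powr s_def algebra_simps)
        have "0 < exp 1 / \<epsilon>" using \<epsilon> by simp
        from gen[OF this] show ?thesis .
      qed
      finally show ?thesis by (simp add: x_def)
    qed
    have "(\<Sum>l=i..<N. exp (- lam * h) ^ (l - i) * \<mu> l / sqrt (real (l - i + 1) * h)) = (\<Sum>l=i..<N. a (l - i) * \<mu> l)"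
      by (intro sum.cong refl) (simp add: a_def)
    also have "\<dots> \<le> (\<Sum>l=i..<N. h * (a (l - i) / \<epsilon>) powr p + \<epsilon> powr q * mq l)"
      using young a \<epsilon> unfolding p_def by (intro sum_mono) auto
    also have "\<dots> = (\<Sum>l=i..<N. h * (a (l - i) / \<epsilon>) powr p) + (\<Sum>l=i..<N. \<epsilon> powr q * mq l)"
      by (simp add: sum.distrib)
    also have "\<dots> \<le> (\<Sum>k<N. h * (a k / \<epsilon>) powr p) + (\<Sum>l<N. \<epsilon> powr q * mq l)"
      using h mq by (intro add_mono sum_shift_le sum_mono2) auto
    also have "(\<Sum>k<N. h * (a k / \<epsilon>) powr p) \<le> (\<Sum>k<N. (exp 1 / \<epsilon>) powr p * lam powr (- (p * e)) * (h * (real (Suc k) * h) powr (- s)))"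
    proof (rule sum_mono)
      fix k show "h * (a k / \<epsilon>) powr p \<le> (exp 1 / \<epsilon>) powr p * lam powr (- (p * e)) * (h * (real (Suc k) * h) powr (- s))"
        using mult_left_mono[OF ak[of k], of h] h by (simp add: mult_ac)
    qed
    also have "\<dots> = (exp 1 / \<epsilon>) powr p * lam powr (- (p * e)) * (\<Sum>k<N. h * (real (Suc k) * h) powr (- s))"
      by (simp only: sum_distrib_left)
    also have "\<dots> \<le> (exp 1 / \<epsilon>) powr p * lam powr (- (p * e)) * (T powr (1 - s) / (1 - s))"
      using sum_powr_le[OF s h, of N] unfolding N by (intro mult_left_mono) auto
    also have "(\<Sum>l<N. \<epsilon> powr q * mq l) \<le> \<epsilon> powr q * Q"
      using mq(2) unfolding sum_distrib_left[symmetric] by (intro mult_left_mono) auto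
    finally have "(\<Sum>l=i..<N. exp (- lam * h) ^ (l - i) * \<mu> l / sqrt (real (l - i + 1) * h))
       \<le> (exp 1 / \<epsilon>) powr p * lam powr (- (p * e)) * (T powr (1 - s) / (1 - s)) + \<epsilon> powr q * Q" by simp
    then have "K * (\<Sum>l=i..<N. exp (- lam * h) ^ (l - i) * \<mu> l / sqrt (real (l - i + 1) * h))
      \<le> K * ((exp 1 / \<epsilon>) powr p * lam powr (- (p * e)) * (T powr (1 - s) / (1 - s)) + \<epsilon> powr q * Q)"
      using K by (intro mult_left_mono) auto
    also have "\<dots> = A * lam powr (- (p * e)) + K * (\<epsilon> powr q * Q)"
      by (simp add: A_def algebra_simps)
    also have "\<dots> \<le> 1 / 3" using lam_powr \<epsilon>(2) by simp
    finally show "K * (\<Sum>l=i..<N. exp (- lam * h) ^ (l - i) * \<mu> l / sqrt (real (l - i + 1) * h)) \<le> 1 / 3" .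
  qed
qed

text \<open>
  Young's convolution inequality for the summable kernel \<open>t powr (\<beta> / 2 - 1)\<close> and a square summable sequence.
  The shift to \<open>c (Suc i)\<close> is the form in which the sum occurs in the moment bound.
\<close>

lemma sum_convolution_square_le:
  fixes h \<beta> :: real and \<mu> :: "nat \<Rightarrow> real" and N :: nat
  assumes h: "h > 0" and \<beta>: "0 < \<beta>" "\<beta> \<le> 1"
  defines "c i \<equiv> (\<Sum>l=i..<N. (real (l - i + 1) * h) powr (\<beta> / 2 - 1) * \<mu> l)"
  defines "S \<equiv> (real N * h) powr (\<beta> / 2) / (\<beta> / 2)"
  shows "(\<Sum>i<N. h * (c (Suc i))\<^sup>2) \<le> S\<^sup>2 * (\<Sum>l<N. (\<mu> l)\<^sup>2 / h)"
proof -
  define k where "k j = (real (Suc j) * h) powr (\<beta> / 2 - 1)" for j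
  have k: "0 < k j" for j using h by (simp add: k_def)
  have S0: "0 \<le> S" using \<beta> by (simp add: S_def)
  have S: "(\<Sum>j<N. h * k j) \<le> S"
    using sum_powr_le[of "1 - \<beta> / 2" h N] h \<beta> by (simp add: k_def S_def)
  have c2: "(c i)\<^sup>2 \<le> S * (\<Sum>l=i..<N. k (l - i) * ((\<mu> l)\<^sup>2 / h))" for i
  proof -
    have "c i = (\<Sum>l=i..<N. sqrt (h * k (l - i)) * (sqrt (k (l - i) / h) * \<mu> l))"
      unfolding c_def
    proof (intro sum.cong refl)
      fix l
      have "sqrt (h * k (l - i)) * sqrt (k (l - i) / h) = sqrt ((k (l - i))\<^sup>2)"
        using h by (simp add: real_sqrt_mult[symmetric] power2_eq_square)
      then show "(real (l - i + 1) * h) powr (\<beta> / 2 - 1) * \<mu> l = sqrt (h * k (l - i)) * (sqrt (k (l - i) / h) * \<mu> l)"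
        using k[of "l - i"] by (simp add: k_def mult.assoc[symmetric])
    qed
    then have "(c i)\<^sup>2 \<le> (\<Sum>l=i..<N. (sqrt (h * k (l - i)))\<^sup>2) * (\<Sum>l=i..<N. (sqrt (k (l - i) / h) * \<mu> l)\<^sup>2)"
      by (simp only: Cauchy_Schwarz_ineq_sum)
    also have "\<dots> = (\<Sum>l=i..<N. h * k (l - i)) * (\<Sum>l=i..<N. k (l - i) * ((\<mu> l)\<^sup>2 / h))"
      using h less_imp_le[OF k] by (simp add: power_mult_distrib)
    also have "\<dots> \<le> S * (\<Sum>l=i..<N. k (l - i) * ((\<mu> l)\<^sup>2 / h))"
      using h less_imp_le[OF k]
      by (intro mult_right_mono order_trans[OF sum_shift_le[of "\<lambda>j. h * k j"] S] sum_nonneg) auto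
    finally show ?thesis .
  qed
  have cN: "c N = 0" by (simp add: c_def)
  have "(\<Sum>i<N. h * (c (Suc i))\<^sup>2) \<le> (\<Sum>i<Suc N. h * (c i)\<^sup>2)"
    unfolding sum.lessThan_Suc_shift[of "\<lambda>i. h * (c i)\<^sup>2"] using h by simp
  also have "\<dots> = (\<Sum>i<N. h * (c i)\<^sup>2)" by (simp add: cN)
  also have "\<dots> \<le> (\<Sum>i<N. h * (S * (\<Sum>l=i..<N. k (l - i) * ((\<mu> l)\<^sup>2 / h))))"
    using h by (intro sum_mono mult_left_mono c2) auto
  also have "\<dots> = S * (\<Sum>i<N. \<Sum>l=i..<N. h * k (l - i) * ((\<mu> l)\<^sup>2 / h))"
    unfolding sum_distrib_left by (intro sum.cong refl) (simp only: mult_ac)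
  also have "(\<Sum>i<N. \<Sum>l=i..<N. h * k (l - i) * ((\<mu> l)\<^sup>2 / h)) = (\<Sum>l<N. \<Sum>i\<le>l. h * k (l - i) * ((\<mu> l)\<^sup>2 / h))"
    unfolding sum.Sigma[OF finite_lessThan ballI[OF finite_atLeastLessThan]] sum.Sigma[OF finite_lessThan ballI[OF finite_atMost]]
    by (intro sum.reindex_bij_witness[of _ "\<lambda>(a, b). (b, a)" "\<lambda>(a, b). (b, a)"]) auto
  also have "\<dots> \<le> (\<Sum>l<N. S * ((\<mu> l)\<^sup>2 / h))"
  proof (rule sum_mono)
    fix l assume l: "l \<in> {..<N}"
    have "(\<Sum>i\<le>l. h * k (l - i)) = (\<Sum>j\<le>l. h * k j)"
      by (intro sum.reindex_bij_witness[of _ "\<lambda>j. l - j" "\<lambda>j. l - j"]) auto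
    also have "\<dots> \<le> (\<Sum>j<N. h * k j)" using l h less_imp_le[OF k] by (intro sum_mono2) auto
    finally have "(\<Sum>i\<le>l. h * k (l - i)) \<le> S" using S by simp
    then show "(\<Sum>i\<le>l. h * k (l - i) * ((\<mu> l)\<^sup>2 / h)) \<le> S * ((\<mu> l)\<^sup>2 / h)"
      unfolding sum_distrib_right[symmetric] using h by (intro mult_right_mono) auto
  qed
  finally have "(\<Sum>i<N. h * (c (Suc i))\<^sup>2) \<le> S * (\<Sum>l<N. S * ((\<mu> l)\<^sup>2 / h))"
    using S0 by (simp add: mult_left_mono)
  then show ?thesis by (simp add: sum_distrib_left power2_eq_square mult_ac)
qed

section \<open>Discrete flows driven by Brownian increments\<close>

text \<open>
  \<open>j\<close> steps, starting with step \<open>k\<close>. In each step the noise is added before \<open>\<psi>\<close> is applied.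
\<close>

primrec flow :: "(nat \<Rightarrow> 'a \<Rightarrow> 'a::plus) \<Rightarrow> (nat \<Rightarrow> 'a) \<Rightarrow> nat \<Rightarrow> nat \<Rightarrow> 'a \<Rightarrow> 'a" where
  "flow \<psi> w k 0 y = y"
| "flow \<psi> w k (Suc j) y = \<psi> (k + j) (flow \<psi> w k j y + w (k + j))"

lemma flow_Suc_left: "flow \<psi> w k (Suc j) y = flow \<psi> w (Suc k) j (\<psi> k (y + w k))"
  by (induction j) auto

lemma flow_cong: "(\<And>i. i \<in> {k..<k + j} \<Longrightarrow> w i = w' i) \<Longrightarrow> flow \<psi> w k j y = flow \<psi> w' k j y"
  by (induction j) auto

lemma measurable_flow_random:
  fixes \<psi> :: "nat \<Rightarrow> 'a::euclidean_space \<Rightarrow> 'a"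
  assumes [measurable]: "\<And>i. \<psi> i \<in> borel_measurable borel"
    and "\<And>i. i \<in> {k..<k + j} \<Longrightarrow> \<Delta> i \<in> borel_measurable M"
  shows "(\<lambda>\<omega>. flow \<psi> (\<lambda>i. \<Delta> i \<omega>) k j y) \<in> borel_measurable M"
  using assms(2)
proof (induction j)
  case (Suc j)
  have [measurable]: "(\<lambda>\<omega>. flow \<psi> (\<lambda>i. \<Delta> i \<omega>) k j y) \<in> borel_measurable M"
    by (rule Suc.IH) (use Suc.prems in auto)
  have [measurable]: "\<Delta> (k + j) \<in> borel_measurable M" by (rule Suc.prems) simp
  show ?case by simp
qed simp

lemma measurable_flow:
  fixes \<psi> :: "nat \<Rightarrow> 'a::euclidean_space \<Rightarrow> 'a"
  assumes "\<And>i. \<psi> i \<in> borel_measurable borel" and "{k..<k + j} \<subseteq> A"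
  shows "(\<lambda>w. flow \<psi> w k j y) \<in> borel_measurable (Pi\<^sub>M A (\<lambda>_. borel))"
  by (rule measurable_flow_random[where \<Delta> = "\<lambda>i w. w i", OF assms(1)])
     (use assms(2) in \<open>auto intro: measurable_component_singleton\<close>)

lemma continuous_flow:
  fixes \<psi> :: "nat \<Rightarrow> 'a::real_normed_vector \<Rightarrow> 'a"
  assumes "\<And>i. continuous_on UNIV (\<psi> i)"
  shows "continuous_on UNIV (flow \<psi> w k j)"
proof (induction j)
  case (Suc j)
  have "continuous_on UNIV (\<lambda>y. \<psi> (k + j) (flow \<psi> w k j y + w (k + j)))"
    by (rule continuous_on_compose2[OF assms, of "UNIV"]) (auto intro!: continuous_intros Suc)
  then show ?case by (simp add: fun_eq_iff[symmetric] cong: continuous_on_cong)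
qed (simp add: continuous_on_id')

lemma (in prob_space) nn_integral_indep_var:
  assumes ind: "indep_var S X N Y" and [measurable]: "f \<in> borel_measurable (S \<Otimes>\<^sub>M N)"
  shows "(\<integral>\<^sup>+\<omega>. f (X \<omega>, Y \<omega>) \<partial>M) = (\<integral>\<^sup>+\<omega>. \<integral>\<^sup>+\<omega>'. f (X \<omega>, Y \<omega>') \<partial>M \<partial>M)"
proof -
  have [measurable]: "X \<in> measurable M S" "Y \<in> measurable M N"
    using ind unfolding indep_var_distribution_eq by auto
  have eq: "distr M S X \<Otimes>\<^sub>M distr M N Y = distr M (S \<Otimes>\<^sub>M N) (\<lambda>x. (X x, Y x))"
    using ind unfolding indep_var_distribution_eq by auto
  interpret Y: prob_space "distr M N Y" by (rule prob_space_distr) simp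
  have "(\<integral>\<^sup>+\<omega>. f (X \<omega>, Y \<omega>) \<partial>M) = (\<integral>\<^sup>+p. f p \<partial>distr M (S \<Otimes>\<^sub>M N) (\<lambda>x. (X x, Y x)))"
    by (subst nn_integral_distr) auto
  also have "\<dots> = (\<integral>\<^sup>+x. \<integral>\<^sup>+y. f (x, y) \<partial>distr M N Y \<partial>distr M S X)"
    unfolding eq[symmetric] by (rule Y.nn_integral_fst[symmetric]) measurable
  also have "\<dots> = (\<integral>\<^sup>+\<omega>. \<integral>\<^sup>+y. f (X \<omega>, y) \<partial>distr M N Y \<partial>M)"
    by (subst nn_integral_distr) auto
  also have "\<dots> = (\<integral>\<^sup>+\<omega>. \<integral>\<^sup>+\<omega>'. f (X \<omega>, Y \<omega>') \<partial>M \<partial>M)"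
    by (intro nn_integral_cong nn_integral_distr) (auto intro: measurable_Pair2)
  finally show ?thesis .
qed

text \<open>
  The one-step estimates multiply, because the state before a step depends only on the earlier increments
  and is therefore independent of the increment of that step.
\<close>

lemma (in prob_space) flow_moment:
  fixes \<psi> :: "nat \<Rightarrow> real ^ 'n::finite \<Rightarrow> real ^ 'n" and \<Delta> :: "nat \<Rightarrow> 'a \<Rightarrow> real ^ 'n"
    and V :: "nat \<Rightarrow> real ^ 'n \<Rightarrow> real ^ 'n \<Rightarrow> real" and a :: "nat \<Rightarrow> real"
  assumes ind: "indep_vars (\<lambda>_. borel) \<Delta> {..<N}"
    and law: "\<And>i. i < N \<Longrightarrow> distr M borel (\<Delta> i) = gauss_measure h"
    and \<psi>[measurable]: "\<And>i. \<psi> i \<in> borel_measurable borel"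
    and V_meas[measurable]: "\<And>i. (\<lambda>p. V i (fst p) (snd p)) \<in> borel_measurable (borel \<Otimes>\<^sub>M borel)"
    and V: "\<And>i x z. 0 \<le> V i x z" and a: "\<And>i. 0 \<le> a i"
    and step: "\<And>i x z. i < N \<Longrightarrow> (\<integral>\<^sup>+w. ennreal (V (Suc i) (\<psi> i (x + w)) (\<psi> i (z + w))) \<partial>gauss_measure h) \<le> ennreal (a i * V i x z)"
  shows "k + j \<le> N \<Longrightarrow> (\<integral>\<^sup>+\<omega>. ennreal (V (k + j) (flow \<psi> (\<lambda>i. \<Delta> i \<omega>) k j x) (flow \<psi> (\<lambda>i. \<Delta> i \<omega>) k j z)) \<partial>M)
      \<le> ennreal ((\<Prod>i=k..<k + j. a i) * V k x z)"
proof (induction j)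
  case 0
  then show ?case by (simp add: emeasure_space_1)
next
  case (Suc j)
  define A where "A = {k..<k + j}"
  define Bs where "Bs = {k + j}"
  have kj: "k + j < N" using Suc.prems by simp
  have [measurable]: "random_variable borel (\<Delta> (k + j))"
    using ind kj unfolding indep_vars_def by auto
  have "indep_var (PiM A (\<lambda>_. borel)) (\<lambda>\<omega>. restrict (\<lambda>i. \<Delta> i \<omega>) A) (PiM Bs (\<lambda>_. borel)) (\<lambda>\<omega>. restrict (\<lambda>i. \<Delta> i \<omega>) Bs)"
    using kj by (intro indep_var_restrict[OF ind]) (auto simp: A_def Bs_def)
  note iv = this
  define f where "f p = ennreal (V (Suc (k + j)) (\<psi> (k + j) (flow \<psi> (fst p) k j x + snd p (k + j)))
     (\<psi> (k + j) (flow \<psi> (fst p) k j z + snd p (k + j))))" for p :: "(nat \<Rightarrow> real ^ 'n) \<times> (nat \<Rightarrow> real ^ 'n)"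
  have [measurable]: "(\<lambda>w. flow \<psi> w k j y) \<in> borel_measurable (Pi\<^sub>M A (\<lambda>_. borel))" for y
    by (rule measurable_flow[OF \<psi>]) (simp add: A_def)
  have [measurable]: "(\<lambda>w. w (k + j)) \<in> borel_measurable (Pi\<^sub>M Bs (\<lambda>_. borel))"
    by (rule measurable_component_singleton) (simp add: Bs_def)
  have Vm: "(\<lambda>p. V i (g p) (g' p)) \<in> borel_measurable L" if "g \<in> borel_measurable L" "g' \<in> borel_measurable L"
    for i L and g g' :: "_ \<Rightarrow> real ^ 'n"
    using measurable_compose[OF measurable_Pair[OF that] V_meas[of i]] by simp
  have f: "f \<in> borel_measurable (PiM A (\<lambda>_. borel) \<Otimes>\<^sub>M PiM Bs (\<lambda>_. borel))"
    unfolding f_def[abs_def] by (intro measurable_compose[OF _ measurable_ennreal] Vm) measurable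
  have fl: "flow \<psi> (restrict (\<lambda>i. \<Delta> i \<omega>) A) k j y = flow \<psi> (\<lambda>i. \<Delta> i \<omega>) k j y" for \<omega> y
    by (rule flow_cong) (simp add: A_def)
  have "(\<integral>\<^sup>+\<omega>. ennreal (V (k + Suc j) (flow \<psi> (\<lambda>i. \<Delta> i \<omega>) k (Suc j) x) (flow \<psi> (\<lambda>i. \<Delta> i \<omega>) k (Suc j) z)) \<partial>M)
     = (\<integral>\<^sup>+\<omega>. f (restrict (\<lambda>i. \<Delta> i \<omega>) A, restrict (\<lambda>i. \<Delta> i \<omega>) Bs) \<partial>M)"
    by (simp add: f_def fl Bs_def)
  also have "\<dots> = (\<integral>\<^sup>+\<omega>. \<integral>\<^sup>+\<omega>'. f (restrict (\<lambda>i. \<Delta> i \<omega>) A, restrict (\<lambda>i. \<Delta> i \<omega>') Bs) \<partial>M \<partial>M)"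
    by (rule nn_integral_indep_var[OF iv f])
  also have "\<dots> \<le> (\<integral>\<^sup>+\<omega>. ennreal (a (k + j)) * ennreal (V (k + j) (flow \<psi> (\<lambda>i. \<Delta> i \<omega>) k j x) (flow \<psi> (\<lambda>i. \<Delta> i \<omega>) k j z)) \<partial>M)"
  proof (rule nn_integral_mono)
    fix \<omega>
    let ?x = "flow \<psi> (\<lambda>i. \<Delta> i \<omega>) k j x" and ?z = "flow \<psi> (\<lambda>i. \<Delta> i \<omega>) k j z"
    have m: "(\<lambda>w. ennreal (V (Suc (k + j)) (\<psi> (k + j) (?x + w)) (\<psi> (k + j) (?z + w)))) \<in> borel_measurable borel"
      by (intro measurable_compose[OF _ measurable_ennreal] Vm) measurable
    have "(\<integral>\<^sup>+\<omega>'. f (restrict (\<lambda>i. \<Delta> i \<omega>) A, restrict (\<lambda>i. \<Delta> i \<omega>') Bs) \<partial>M)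
       = (\<integral>\<^sup>+\<omega>'. ennreal (V (Suc (k + j)) (\<psi> (k + j) (?x + \<Delta> (k + j) \<omega>')) (\<psi> (k + j) (?z + \<Delta> (k + j) \<omega>'))) \<partial>M)"
      by (simp add: f_def fl Bs_def)
    also have "\<dots> = (\<integral>\<^sup>+w. ennreal (V (Suc (k + j)) (\<psi> (k + j) (?x + w)) (\<psi> (k + j) (?z + w))) \<partial>distr M borel (\<Delta> (k + j)))"
      by (subst nn_integral_distr) (use m in auto)
    also have "\<dots> \<le> ennreal (a (k + j) * V (k + j) ?x ?z)"
      unfolding law[OF kj] by (rule step[OF kj])
    finally show "(\<integral>\<^sup>+\<omega>'. f (restrict (\<lambda>i. \<Delta> i \<omega>) A, restrict (\<lambda>i. \<Delta> i \<omega>') Bs) \<partial>M)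
       \<le> ennreal (a (k + j)) * ennreal (V (k + j) ?x ?z)"
      by (simp add: ennreal_mult a V)
  qed
  also have "\<dots> = ennreal (a (k + j)) * (\<integral>\<^sup>+\<omega>. ennreal (V (k + j) (flow \<psi> (\<lambda>i. \<Delta> i \<omega>) k j x) (flow \<psi> (\<lambda>i. \<Delta> i \<omega>) k j z)) \<partial>M)"
  proof (rule nn_integral_cmult)
    have rA: "(\<lambda>\<omega>. restrict (\<lambda>i. \<Delta> i \<omega>) A) \<in> measurable M (PiM A (\<lambda>_. borel))"
      using iv unfolding indep_var_distribution_eq by auto
    have fm: "(\<lambda>\<omega>. flow \<psi> (\<lambda>i. \<Delta> i \<omega>) k j y) \<in> borel_measurable M" for y
      using measurable_compose[OF rA, of "\<lambda>w. flow \<psi> w k j y" borel] by (simp add: fl)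
    show "(\<lambda>\<omega>. ennreal (V (k + j) (flow \<psi> (\<lambda>i. \<Delta> i \<omega>) k j x) (flow \<psi> (\<lambda>i. \<Delta> i \<omega>) k j z))) \<in> borel_measurable M"
      by (intro measurable_compose[OF _ measurable_ennreal] Vm fm)
  qed
  also have "\<dots> \<le> ennreal (a (k + j)) * ennreal ((\<Prod>i=k..<k + j. a i) * V k x z)"
    using Suc by (intro mult_left_mono) auto
  also have "\<dots> = ennreal ((\<Prod>i=k..<k + Suc j. a i) * V k x z)"
    using a V by (simp add: ennreal_mult[symmetric] prod_nonneg mult_ac)
  finally show ?case .
qed

lemma brownian_increment_law:
  fixes W :: "real \<Rightarrow> 'w \<Rightarrow> real ^ 'n::finite"
  assumes bm: "standard_brownian_motion P T W" and st: "0 \<le> s" "s < t" "t \<le> T"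
  shows "distr P borel (\<lambda>\<omega>. W t \<omega> - W s \<omega>) = gauss_measure (t - s)"
proof -
  have d: "distributed P lborel (\<lambda>\<omega>. W t \<omega> - W s \<omega>)
      (\<lambda>z. ennreal (\<Prod>j\<in>UNIV. normal_density 0 (sqrt (t - s)) (z $ j)))"
    using bm st unfolding standard_brownian_motion_def by blast
  then show ?thesis
    using distributed_distr_eq_density[OF d] unfolding gauss_measure_def gauss_def
    by (simp cong: distr_cong)
qed

lemma measurable_brownian_increment:
  fixes W :: "real \<Rightarrow> 'w \<Rightarrow> real ^ 'n::finite"
  assumes bm: "standard_brownian_motion P T W" and h: "real N * h = T" "h > 0" and i: "i < N"
  shows "(\<lambda>\<omega>. W (real (Suc i) * h) \<omega> - W (real i * h) \<omega>) \<in> borel_measurable P"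
proof -
  have Wm: "W t \<in> borel_measurable P" if "t \<in> {0..T}" for t
    using bm that unfolding standard_brownian_motion_def by auto
  have "real j * h \<le> real N * h" if "j \<le> N" for j
    using that h(2) by (intro mult_right_mono) auto
  then have grid: "real j * h \<in> {0..T}" if "j \<le> N" for j
    using that h by auto
  show ?thesis
    by (intro borel_measurable_diff Wm grid) (use i in auto)
qed

lemma brownian_increments:
  fixes W :: "real \<Rightarrow> 'w \<Rightarrow> real ^ 'n::finite"
  assumes bm: "standard_brownian_motion P T W" and T: "T > 0" and N: "N > 0" and h: "real N * h = T"
  shows "prob_space.indep_vars P (\<lambda>_. borel) (\<lambda>i \<omega>. W (real (Suc i) * h) \<omega> - W (real i * h) \<omega>) {..<N}"
    and "i < N \<Longrightarrow> distr P borel (\<lambda>\<omega>. W (real (Suc i) * h) \<omega> - W (real i * h) \<omega>) = gauss_measure h"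
proof -
  have h0: "h > 0" using h T N by (metis of_nat_0_less_iff zero_less_mult_pos)
  have grid: "real i * h \<in> {0..T}" if "i \<le> N" for i
    using that h0 h by (auto simp flip: h intro!: mult_right_mono)
  show "prob_space.indep_vars P (\<lambda>_. borel) (\<lambda>i \<omega>. W (real (Suc i) * h) \<omega> - W (real i * h) \<omega>) {..<N}"
  proof -
    have "(\<forall>i\<le>N. real i * h \<in> {0..T}) \<and> (\<forall>i<N. real i * h < real (Suc i) * h)"
      using grid h0 by auto
    moreover have "\<forall>(n::nat) (t::nat \<Rightarrow> real).
        (\<forall>i\<le>n. t i \<in> {0..T}) \<and> (\<forall>i<n. t i < t (Suc i)) \<longrightarrow>
        prob_space.indep_vars P (\<lambda>_. borel) (\<lambda>i \<omega>. W (t (Suc i)) \<omega> - W (t i) \<omega>) {..<n}"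
      using bm unfolding standard_brownian_motion_def by blast
    ultimately show ?thesis by (elim allE[of _ N] allE[of _ "\<lambda>i. real i * h"]) auto
  qed
  assume i: "i < N"
  have "0 \<le> real i * h" "real i * h < real (Suc i) * h" "real (Suc i) * h \<le> T"
    using grid[of "Suc i"] i h0 by auto
  from brownian_increment_law[OF bm this]
  show "distr P borel (\<lambda>\<omega>. W (real (Suc i) * h) \<omega> - W (real i * h) \<omega>) = gauss_measure h"
    by (simp add: algebra_simps)
qed

section \<open>Rough drifts and their Euler schemes\<close>

text \<open>
  A single function dominates both the size and the Hoelder constants of the drift, without exceptional
  times. Changing the drift on a null set of times brings the general case into this form.
\<close>

locale rough_drift =
  fixes T \<beta> q :: real and b :: "real \<times> (real ^ 'n::finite) \<Rightarrow> real ^ 'n" and M :: "real \<Rightarrow> real"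
  assumes T: "T > 0" and \<beta>: "0 < \<beta>" "\<beta> \<le> 1" and q: "2 < q"
    and b_meas: "b \<in> borel_measurable borel"
    and M_meas [measurable]: "M \<in> borel_measurable borel" and M_nonneg: "\<And>t. 0 \<le> M t"
    and M_supp: "\<And>t. t \<notin> {0..T} \<Longrightarrow> M t = 0"
    and M_int: "integrable lborel (\<lambda>t. M t powr q)"
    and b_bound: "\<And>t y. norm (b (t, y)) \<le> M t"
    and b_holder: "\<And>t y z. norm (b (t, y) - b (t, z)) \<le> M t * norm (y - z) powr \<beta>"
begin

lemma b_meas' [measurable]: "b \<in> borel_measurable (borel \<Otimes>\<^sub>M borel)"
  using b_meas by (simp only: borel_prod)

lemma integrable_dominated_by_Mq:
  assumes [measurable]: "g \<in> borel_measurable borel" and g: "\<And>t. \<bar>g t\<bar> \<le> indicator {0..T} t + M t powr q"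
  shows "integrable lborel g"
proof (rule Bochner_Integration.integrable_bound)
  show "integrable lborel (\<lambda>t. indicator {0..T} t + M t powr q)"
    using M_int by (intro Bochner_Integration.integrable_add integrable_real_indicator) (auto simp: emeasure_lborel_Icc_eq)
qed (use g in \<open>auto intro!: AE_I2 order_trans[OF g]\<close>)

lemma M_powr_le: "0 < r \<Longrightarrow> r \<le> q \<Longrightarrow> M t powr r \<le> indicator {0..T} t + M t powr q"
proof (cases "t \<in> {0..T}")
  case True
  assume r: "0 < r" "r \<le> q"
  show ?thesis
  proof (cases "M t \<le> 1")
    case True
    then have "M t powr r \<le> 1" using r M_nonneg[of t] by (simp add: powr_le1)
    then show ?thesis using \<open>t \<in> _\<close> by (simp add: add_increasing2)
  next
    case False
    then have "M t powr r \<le> M t powr q" using r by (intro powr_mono) auto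
    then show ?thesis using \<open>t \<in> _\<close> by simp
  qed
qed (simp add: M_supp)

lemma M_integrable: "integrable lborel M"
  by (rule integrable_dominated_by_Mq) (use M_powr_le[of 1] M_nonneg q in auto)

lemma M2_integrable: "integrable lborel (\<lambda>t. (M t)\<^sup>2)"
  by (rule integrable_dominated_by_Mq) (use M_powr_le[of 2] M_nonneg q in \<open>auto simp: powr_numeral\<close>)

lemma M_set_integrable: "A \<in> sets borel \<Longrightarrow> set_integrable lborel A M"
  unfolding set_integrable_def by (rule integrable_mult_indicator[OF _ M_integrable]) simp

lemma b_section_meas [measurable]: "Y \<in> borel_measurable borel \<Longrightarrow> (\<lambda>t. b (t, Y t)) \<in> borel_measurable borel"
  by measurable

lemma b_integrable:
  assumes "Y \<in> borel_measurable borel"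
  shows "integrable lborel (\<lambda>t. b (t, Y t))"
  by (rule Bochner_Integration.integrable_bound[OF M_integrable])
     (use assms b_bound M_nonneg in \<open>auto intro!: AE_I2\<close>)

lemma b_set_integrable:
  assumes "Y \<in> borel_measurable borel" "A \<in> sets borel"
  shows "set_integrable lborel A (\<lambda>t. b (t, Y t))"
  unfolding set_integrable_def by (rule integrable_mult_indicator[OF _ b_integrable]) (use assms in simp_all)

definition cell :: "nat \<Rightarrow> nat \<Rightarrow> real set" where
  "cell N i = {real i * (T / real N)<..real (Suc i) * (T / real N)}"

definition mu :: "nat \<Rightarrow> nat \<Rightarrow> real" where
  "mu N i = (LINT t:cell N i|lborel. M t)"

definition cell_drift :: "nat \<Rightarrow> nat \<Rightarrow> real ^ 'n \<Rightarrow> real ^ 'n" where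
  "cell_drift N i y = (LINT t:cell N i|lborel. b (t, y))"

text \<open>
  Mollification at the scale of the mesh makes the step Lipschitz (\<open>smooth_drift_lipschitz\<close>) and moves the
  drift by no more than the order \<open>h powr (\<beta> / 2)\<close> relative to \<open>mu\<close>.
\<close>

definition smooth_drift :: "nat \<Rightarrow> nat \<Rightarrow> real ^ 'n \<Rightarrow> real ^ 'n" where
  "smooth_drift N i = heat (T / real N) (cell_drift N i)"

definition euler_step :: "nat \<Rightarrow> nat \<Rightarrow> real ^ 'n \<Rightarrow> real ^ 'n" where
  "euler_step N i y = y + smooth_drift N i y"

lemma cell_sets [measurable]: "cell N i \<in> sets borel"
  by (simp add: cell_def)

lemma cell_eq: "cell N i = {real i * (T / real N)<..real i * (T / real N) + T / real N}"
proof -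
  have "real (Suc i) * c = real i * c + c" for c :: real by (simp add: algebra_simps)
  then show ?thesis unfolding cell_def by (simp only:)
qed

lemma cell_measure: "measure lborel (cell N i) = T / real N"
  and cell_finite: "emeasure lborel (cell N i) < \<infinity>"
proof -
  have "measure lborel {c<..c + d} = d" "emeasure lborel {c<..c + d} < \<infinity>" if "0 \<le> d" for c d :: real
    using that by simp_all
  moreover have "0 \<le> T / real N" using T by simp
  ultimately show "measure lborel (cell N i) = T / real N" "emeasure lborel (cell N i) < \<infinity>"
    unfolding cell_eq by blast+
qed

lemma mu_nonneg: "0 \<le> mu N i"
  unfolding mu_def set_lebesgue_integral_def by (intro integral_nonneg_AE AE_I2) (simp add: M_nonneg)

lemma sum_cells:
  fixes g :: "real \<Rightarrow> 'b::{banach, second_countable_topology}"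
  assumes N: "N > 0" and g: "integrable lborel g"
  shows "(\<Sum>i<k. LINT t:cell N i|lborel. g t) = (LINT t:{0<..real k * (T / real N)}|lborel. g t)"
proof (induction k)
  case 0
  then show ?case by (simp add: set_lebesgue_integral_def)
next
  case (Suc k)
  have si: "set_integrable lborel A g" if "A \<in> sets borel" for A
    unfolding set_integrable_def by (rule integrable_mult_indicator[OF _ g]) (use that in simp)
  have "{0<..real (Suc k) * (T / real N)} = {0<..real k * (T / real N)} \<union> cell N k"
    unfolding cell_def using T N by (intro ivl_disj_un_two(6)[symmetric]) (auto intro!: divide_right_mono)
  moreover have "{0<..real k * (T / real N)} \<inter> cell N k = {}"
    unfolding cell_def by auto
  ultimately show ?case
    using Suc by (simp add: set_integral_Un[OF _ si si])
qed

lemma sum_cells_le: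
  fixes g :: "real \<Rightarrow> real"
  assumes N: "N > 0" and g: "integrable lborel g" "\<And>t. 0 \<le> g t"
  shows "(\<Sum>i<N. LINT t:cell N i|lborel. g t) \<le> (\<integral>t. g t \<partial>lborel)"
proof -
  have "(\<Sum>i<N. LINT t:cell N i|lborel. g t) = (\<integral>t. indicator {0<..real N * (T / real N)} t *\<^sub>R g t \<partial>lborel)"
    unfolding sum_cells[OF N g(1)] by (simp add: set_lebesgue_integral_def)
  also have "\<dots> \<le> (\<integral>t. g t \<partial>lborel)"
    using g by (intro integral_mono integrable_mult_indicator) (auto simp: indicator_def)
  finally show ?thesis .
qed

text \<open>
  The Cauchy-Schwarz inequality, obtained by integrating the square of \<open>M\<close> minus its mean.
\<close>

lemma M_interval_square:
  assumes st: "s \<le> t"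
  shows "(LINT r:{s<..t}|lborel. M r)\<^sup>2 \<le> (t - s) * (LINT r:{s<..t}|lborel. (M r)\<^sup>2)"
proof (cases "s = t")
  case False
  define h where "h = t - s"
  have h: "h > 0" using st False by (simp add: h_def)
  define m where "m = (LINT r:{s<..t}|lborel. M r)"
  define c where "c = m / h"
  have i1: "set_integrable lborel {s<..t} (\<lambda>r. (M r)\<^sup>2)"
    unfolding set_integrable_def by (rule integrable_mult_indicator[OF _ M2_integrable]) simp
  have i2: "set_integrable lborel {s<..t} (\<lambda>r. 2 * c * M r)"
    using M_set_integrable[of "{s<..t}"] by simp
  have meas: "measure lborel {s<..t} = h" using st by (simp add: h_def)
  have i3: "set_integrable lborel {s<..t} (\<lambda>r. c\<^sup>2)"
    unfolding set_integrable_def using st by (simp add: integrable_indicator_iff)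
  have "0 \<le> (LINT r:{s<..t}|lborel. (M r - c)\<^sup>2)"
    unfolding set_lebesgue_integral_def by (intro integral_nonneg_AE AE_I2) simp
  also have "(LINT r:{s<..t}|lborel. (M r - c)\<^sup>2) = (LINT r:{s<..t}|lborel. (M r)\<^sup>2 - 2 * c * M r + c\<^sup>2)"
    by (simp add: power2_diff algebra_simps)
  also have "\<dots> = (LINT r:{s<..t}|lborel. (M r)\<^sup>2) - 2 * c * m + c\<^sup>2 * h"
    using i1 i2 i3 by (simp add: m_def meas set_lebesgue_integral_def[of _ _ "\<lambda>_. c\<^sup>2"])
  also have "\<dots> = (LINT r:{s<..t}|lborel. (M r)\<^sup>2) - m\<^sup>2 / h"
    using h by (simp add: c_def power2_eq_square)
  finally show ?thesis using h by (simp add: h_def[symmetric] m_def[symmetric] field_simps)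
qed (simp add: set_lebesgue_integral_def)

lemma M_interval_le_sqrt:
  assumes st: "s \<le> t"
  shows "(LINT r:{s<..t}|lborel. M r) \<le> sqrt ((\<integral>t. (M t)\<^sup>2 \<partial>lborel) * (t - s))"
proof (rule real_le_rsqrt)
  have "(LINT r:{s<..t}|lborel. (M r)\<^sup>2) \<le> (\<integral>t. (M t)\<^sup>2 \<partial>lborel)"
    unfolding set_lebesgue_integral_def
    by (intro integral_mono integrable_mult_indicator M2_integrable) (auto simp: indicator_def)
  then have "(t - s) * (LINT r:{s<..t}|lborel. (M r)\<^sup>2) \<le> (t - s) * (\<integral>t. (M t)\<^sup>2 \<partial>lborel)"
    using st by (intro mult_left_mono) auto
  then show "(LINT r:{s<..t}|lborel. M r)\<^sup>2 \<le> (\<integral>t. (M t)\<^sup>2 \<partial>lborel) * (t - s)"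
    using M_interval_square[OF st] by (simp only: mult.commute)
qed

lemma mu_square:
  assumes N: "N > 0"
  shows "(mu N i)\<^sup>2 \<le> (T / real N) * (LINT t:cell N i|lborel. (M t)\<^sup>2)"
  unfolding mu_def cell_eq
  using M_interval_square[of "real i * (T / real N)" "real i * (T / real N) + T / real N"] T by simp

lemma mu_young:
  assumes N: "N > 0" and a: "a > 0" and \<epsilon>: "\<epsilon> > 0"
  shows "a * mu N i \<le> (T / real N) * (a / \<epsilon>) powr (q / (q - 1)) + \<epsilon> powr q * (LINT t:cell N i|lborel. M t powr q)"
proof -
  define p where "p = q / (q - 1)"
  have p: "p > 1" "1 / p + 1 / q = 1" using q by (auto simp: p_def field_simps)
  note fin = cell_finite[of N i]
  have i3: "set_integrable lborel (cell N i) (\<lambda>t. (a / \<epsilon>) powr p)"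
    unfolding set_integrable_def using fin by (simp add: integrable_indicator_iff)
  have i4: "set_integrable lborel (cell N i) (\<lambda>t. \<epsilon> powr q * M t powr q)"
    unfolding set_integrable_def by (rule integrable_mult_indicator[OF _ integrable_mult_right[OF M_int]]) simp
  have pw: "a * M t \<le> (a / \<epsilon>) powr p + \<epsilon> powr q * M t powr q" for t
  proof -
    have "a * M t = (a / \<epsilon>) * (\<epsilon> * M t)" using \<epsilon> by simp
    also have "\<dots> \<le> (a / \<epsilon>) powr p / p + (\<epsilon> * M t) powr q / q"
      using p q a \<epsilon> M_nonneg by (intro Youngs_inequality) auto
    also have "\<dots> \<le> (a / \<epsilon>) powr p + (\<epsilon> * M t) powr q"
    proof (rule add_mono)
      show "(a / \<epsilon>) powr p / p \<le> (a / \<epsilon>) powr p" using p divide_left_mono[of 1 p "(a / \<epsilon>) powr p"] by simp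
      show "(\<epsilon> * M t) powr q / q \<le> (\<epsilon> * M t) powr q" using q divide_left_mono[of 1 q "(\<epsilon> * M t) powr q"] by simp
    qed
    also have "(\<epsilon> * M t) powr q = \<epsilon> powr q * M t powr q" using \<epsilon> M_nonneg by (simp add: powr_mult)
    finally show ?thesis .
  qed
  have "a * mu N i = (LINT t:cell N i|lborel. a * M t)" by (simp add: mu_def)
  also have "\<dots> \<le> (LINT t:cell N i|lborel. (a / \<epsilon>) powr p + \<epsilon> powr q * M t powr q)"
    using M_set_integrable[of "cell N i"] i3 i4 by (intro set_integral_mono pw) auto
  also have "\<dots> = (T / real N) * (a / \<epsilon>) powr p + \<epsilon> powr q * (LINT t:cell N i|lborel. M t powr q)"
    using i3 i4 fin by (simp add: cell_measure set_lebesgue_integral_def[of _ _ "\<lambda>_. (a / \<epsilon>) powr p"])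
  finally show ?thesis by (simp add: p_def)
qed

lemma cell_drift_meas: "cell_drift N i \<in> borel_measurable borel"
  unfolding cell_drift_def[abs_def] set_lebesgue_integral_def
  by (rule lborel.borel_measurable_lebesgue_integral) measurable

lemma norm_set_integral_b_diff_le:
  assumes Y: "Y \<in> borel_measurable borel" "Z \<in> borel_measurable borel" and A: "A \<in> sets borel"
    and g: "set_integrable lborel A g" "\<And>t. t \<in> A \<Longrightarrow> norm (b (t, Y t) - b (t, Z t)) \<le> g t"
  shows "norm ((LINT t:A|lborel. b (t, Y t)) - (LINT t:A|lborel. b (t, Z t))) \<le> (LINT t:A|lborel. g t)"
proof -
  have "(LINT t:A|lborel. b (t, Y t)) - (LINT t:A|lborel. b (t, Z t)) = (LINT t:A|lborel. b (t, Y t) - b (t, Z t))"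
    using b_set_integrable[OF Y(1) A] b_set_integrable[OF Y(2) A] by simp
  also have "norm \<dots> \<le> (\<integral>t. indicator A t *\<^sub>R g t \<partial>lborel)"
    unfolding set_lebesgue_integral_def
  proof (rule Bochner_Integration.integral_norm_bound_integral)
    show "integrable lborel (\<lambda>t. indicator A t *\<^sub>R (b (t, Y t) - b (t, Z t)))"
      using set_integral_diff(1)[OF b_set_integrable[OF Y(1) A] b_set_integrable[OF Y(2) A]] by (simp add: set_integrable_def)
    show "integrable lborel (\<lambda>t. indicator A t *\<^sub>R g t)" using g(1) by (simp add: set_integrable_def)
  qed (use g(2) in \<open>auto simp: indicator_def\<close>)
  finally show ?thesis by (simp add: set_lebesgue_integral_def)
qed

lemma norm_set_integral_b_le:
  assumes Y: "Y \<in> borel_measurable borel" and A: "A \<in> sets borel"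
  shows "norm (LINT t:A|lborel. b (t, Y t)) \<le> (LINT t:A|lborel. M t)"
  unfolding set_lebesgue_integral_def
proof (rule Bochner_Integration.integral_norm_bound_integral)
  show "integrable lborel (\<lambda>t. indicator A t *\<^sub>R b (t, Y t))"
    using b_set_integrable[OF Y A] by (simp add: set_integrable_def)
  show "integrable lborel (\<lambda>t. indicator A t *\<^sub>R M t)" using M_set_integrable[OF A] by (simp add: set_integrable_def)
qed (use b_bound in \<open>auto simp: indicator_def\<close>)

lemma cell_drift_bound: "norm (cell_drift N i y) \<le> mu N i"
  unfolding cell_drift_def mu_def by (rule norm_set_integral_b_le) auto

lemma cell_drift_holder: "norm (cell_drift N i y - cell_drift N i z) \<le> mu N i * norm (y - z) powr \<beta>"
proof -
  have "norm (cell_drift N i y - cell_drift N i z) \<le> (LINT t:cell N i|lborel. M t * norm (y - z) powr \<beta>)"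
    unfolding cell_drift_def
    by (rule norm_set_integral_b_diff_le) (use M_set_integrable[of "cell N i"] b_holder in auto)
  then show ?thesis by (simp add: mu_def)
qed

lemma bounded_borel_cell_drift: "bounded_borel (cell_drift N i)"
  by (rule bounded_borelI[OF cell_drift_meas cell_drift_bound])

lemma smooth_drift_meas: "N > 0 \<Longrightarrow> smooth_drift N i \<in> borel_measurable borel"
  unfolding smooth_drift_def using T by (intro bounded_borelD bounded_borel_heat bounded_borel_cell_drift) simp

lemma smooth_drift_bound: "N > 0 \<Longrightarrow> norm (smooth_drift N i y) \<le> mu N i"
  unfolding smooth_drift_def using T by (intro heat_bound cell_drift_meas cell_drift_bound) simp

lemma smooth_drift_holder: "N > 0 \<Longrightarrow> norm (smooth_drift N i y - smooth_drift N i z) \<le> mu N i * norm (y - z) powr \<beta>"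
  unfolding smooth_drift_def using T by (intro heat_holder bounded_borel_cell_drift cell_drift_holder) simp

lemma smooth_drift_lipschitz:
  "N > 0 \<Longrightarrow> norm (smooth_drift N i y - smooth_drift N i z)
    \<le> gauss_const TYPE('n) * mu N i * (T / real N) powr ((\<beta> - 1) / 2) * norm (y - z)"
  unfolding smooth_drift_def using T
  by (intro heat_lipschitz_holder bounded_borel_cell_drift cell_drift_holder \<beta> mu_nonneg) simp

lemma continuous_euler_step: "N > 0 \<Longrightarrow> continuous_on UNIV (euler_step N i)"
  unfolding euler_step_def[abs_def]
  by (intro continuous_on_add continuous_on_id continuous_on_lipschitz_bound[OF smooth_drift_lipschitz])

end

section \<open>Moment bounds uniform in the mesh\<close>

lemma prod_one_add_le_exp:
  fixes x :: "nat \<Rightarrow> real"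
  assumes "\<And>i. 0 \<le> x i"
  shows "(\<Prod>i\<in>A. 1 + x i) \<le> exp (\<Sum>i\<in>A. x i)"
proof (cases "finite A")
  case True
  then show ?thesis
    unfolding exp_sum[OF True] by (intro prod_mono) (auto simp: assms add_nonneg_nonneg)
qed simp

lemma rescale_power: "(2::real) ^ m * (e * (3 / 2 * r) ^ m) = 3 ^ m * e * r ^ m"
proof -
  have "(2::real) ^ m * (3 / 2 * r) ^ m = (2 * (3 / 2 * r)) ^ m" by (rule power_mult_distrib[symmetric])
  also have "2 * (3 / 2 * r) = 3 * r" by simp
  also have "(3 * r) ^ m = 3 ^ m * r ^ m" by (rule power_mult_distrib)
  finally have eq: "(2::real) ^ m * (3 / 2 * r) ^ m = 3 ^ m * r ^ m" .
  have "(2::real) ^ m * (e * (3 / 2 * r) ^ m) = e * (2 ^ m * (3 / 2 * r) ^ m)" by (rule mult.left_commute)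
  also have "\<dots> = 3 ^ m * e * r ^ m" unfolding eq by (simp only: mult_ac)
  finally show ?thesis .
qed

context rough_drift
begin

lemma sum_mu_square:
  assumes N: "N > 0"
  shows "(\<Sum>i<N. (mu N i)\<^sup>2 / (T / real N)) \<le> (\<integral>t. (M t)\<^sup>2 \<partial>lborel)"
proof -
  have h: "T / real N > 0" using T N by simp
  have "(\<Sum>i<N. (mu N i)\<^sup>2 / (T / real N)) \<le> (\<Sum>i<N. LINT t:cell N i|lborel. (M t)\<^sup>2)"
    by (rule sum_mono) (use mu_square[OF N] h in \<open>simp only: pos_divide_le_eq mult.commute\<close>)
  also have "\<dots> \<le> (\<integral>t. (M t)\<^sup>2 \<partial>lborel)"
    by (rule sum_cells_le[OF N M2_integrable]) simp
  finally show ?thesis .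
qed

lemma damping_exists:
  obtains lam where "lam > 0"
    "\<And>N i. N > 0 \<Longrightarrow> lam * (T / real N) \<le> 1 \<Longrightarrow>
      gauss_const TYPE('n) * (\<Sum>l=i..<N. exp (- lam * (T / real N)) ^ (l - i) * mu N l / sqrt (real (l - i + 1) * (T / real N))) \<le> 1 / 3"
proof -
  have Q: "0 \<le> (\<integral>t. M t powr q \<partial>lborel)" by (intro integral_nonneg_AE AE_I2) simp
  obtain lam where lam: "lam > 0" and lam': "\<forall>(N::nat) h (\<mu>::nat \<Rightarrow> real) (mq::nat \<Rightarrow> real) i. h > 0 \<longrightarrow> real N * h = T \<longrightarrow> lam * h \<le> 1 \<longrightarrow>
    (\<forall>l a \<epsilon>. a > 0 \<longrightarrow> \<epsilon> > 0 \<longrightarrow> a * \<mu> l \<le> h * (a / \<epsilon>) powr (q / (q - 1)) + \<epsilon> powr q * mq l) \<longrightarrow>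
    (\<forall>l. 0 \<le> mq l) \<longrightarrow> (\<Sum>l<N. mq l) \<le> (\<integral>t. M t powr q \<partial>lborel) \<longrightarrow>
    gauss_const TYPE('n) * (\<Sum>l=i..<N. exp (- lam * h) ^ (l - i) * \<mu> l / sqrt (real (l - i + 1) * h)) \<le> 1 / 3"
    using small_kernel_sum[OF T q Q gauss_const_pos[where 'n='n]] by blast
  show ?thesis
  proof (rule that[OF lam])
    fix N i :: nat assume N: "N > 0" and l: "lam * (T / real N) \<le> 1"
    have "T / real N > 0" "real N * (T / real N) = T" using T N by auto
    moreover have "\<forall>l. 0 \<le> (LINT t:cell N l|lborel. M t powr q)"
      unfolding set_lebesgue_integral_def by (intro allI integral_nonneg_AE AE_I2) simp
    moreover have "(\<Sum>l<N. LINT t:cell N l|lborel. M t powr q) \<le> (\<integral>t. M t powr q \<partial>lborel)"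
      by (rule sum_cells_le[OF N M_int]) simp
    ultimately show "gauss_const TYPE('n) * (\<Sum>l=i..<N. exp (- lam * (T / real N)) ^ (l - i) * mu N l / sqrt (real (l - i + 1) * (T / real N))) \<le> 1 / 3"
      using mu_young[OF N] l
      by (intro lam'[rule_format, where mq = "\<lambda>l. LINT t:cell N l|lborel. M t powr q"]) auto
  qed
qed

text \<open>
  The sum of the numbers \<open>\<kappa> i\<close> of \<open>gap_moment\<close> is bounded independently of the number of steps, and so is
  the product of the factors \<open>1 + C * \<kappa> i\<close>. The transformed gap is comparable with the distance itself.
\<close>

lemma euler_flow_moment:
  fixes P :: "'w measure" and W :: "real \<Rightarrow> 'w \<Rightarrow> real ^ 'n"
  assumes bm: "standard_brownian_motion P T W" and n: "1 \<le> n"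
  obtains C N0 where "0 \<le> C"
    "\<And>N k j x z. N0 \<le> N \<Longrightarrow> k + j \<le> N \<Longrightarrow>
      (\<integral>\<^sup>+\<omega>. ennreal (norm (flow (euler_step N) (\<lambda>i. W (real (Suc i) * (T / real N)) \<omega> - W (real i * (T / real N)) \<omega>) k j x
         - flow (euler_step N) (\<lambda>i. W (real (Suc i) * (T / real N)) \<omega> - W (real i * (T / real N)) \<omega>) k j z) ^ (2 * n)) \<partial>P)
      \<le> ennreal (C * norm (x - z) ^ (2 * n))"
proof -
  interpret P: prob_space P using bm by (simp add: standard_brownian_motion_def)
  define K where "K = gauss_const TYPE('n)"
  have K: "0 < K" by (simp add: K_def)
  obtain lam where lam: "lam > 0" and small: "\<And>N i. N > 0 \<Longrightarrow> lam * (T / real N) \<le> 1 \<Longrightarrow>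
      K * (\<Sum>l=i..<N. exp (- lam * (T / real N)) ^ (l - i) * mu N l / sqrt (real (l - i + 1) * (T / real N))) \<le> 1 / 3"
    using damping_exists unfolding K_def by blast
  define m2 where "m2 = (\<integral>t. (M t)\<^sup>2 \<partial>lborel)"
  have m2: "0 \<le> m2" unfolding m2_def by (intro integral_nonneg_AE AE_I2) simp
  define S where "S = T powr (\<beta> / 2) / (\<beta> / 2)"
  define tot where "tot = T + 25 * K ^ 4 * S\<^sup>2 * m2 + m2"
  have tot: "0 \<le> tot" using T m2 by (simp add: tot_def)
  define B where "B = 1 + tot + lam + 3 / 2 * K * T powr (\<beta> / 2) + sqrt tot"
  have B1: "1 \<le> B" "tot \<le> B" "lam \<le> B" "3 / 2 * K * T powr (\<beta> / 2) + sqrt tot \<le> B"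
    using tot lam K by (auto simp: B_def)
  define L where "L = 1 + K + B\<^sup>2 / 2 + 2 * B"
  obtain Mo where Mo: "0 \<le> Mo"
    "\<And>t. t > 0 \<Longrightarrow> integrable (gauss_measure t) (\<lambda>w :: real ^ 'n. (1 + norm w / sqrt t) ^ (2 * n + 4))"
    "\<And>t. t > 0 \<Longrightarrow> (\<integral>w. (1 + norm (w :: real ^ 'n) / sqrt t) ^ (2 * n + 4) \<partial>gauss_measure t) \<le> Mo"
    using gauss_moment by metis
  define sc where "sc = step_const n B L Mo"
  have L0: "0 \<le> L" using K B1 by (simp add: L_def add_nonneg_nonneg)
  have sc: "0 \<le> sc"
    unfolding sc_def step_const_def using B1 L0 Mo(1)
    by (intro add_nonneg_nonneg mult_nonneg_nonneg zero_le_power) auto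
  define C where "C = 3 ^ (2 * n) * exp (sc * tot)"
  obtain N0 :: nat where N0: "1 \<le> N0" "lam * T \<le> real N0"
    by (meson le_cases order_trans real_arch_simple of_nat_mono)
  show ?thesis
  proof (rule that[of C N0])
    show "0 \<le> C" by (simp add: C_def)
    fix N k j :: nat and x z :: "real ^ 'n"
    assume N: "N0 \<le> N" and kj: "k + j \<le> N"
    define h where "h = T / real N"
    have Np: "N > 0" using N N0 by simp
    have h: "h > 0" "real N * h = T" using T Np by (auto simp: h_def)
    have lh: "lam * h \<le> 1"
    proof -
      have "lam * T \<le> real N" using N N0 by linarith
      then show ?thesis using Np by (simp add: h_def divide_le_eq)
    qed
    define \<rho> where "\<rho> = exp (- lam * h)"
    interpret c: corrector h \<rho> \<beta> N "mu N" "smooth_drift N"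
    proof
      show "0 \<le> \<rho>" "\<rho> \<le> 1" using lam h by (auto simp: \<rho>_def)
      show "gauss_const TYPE('n) * (\<Sum>l = i..<N. \<rho> ^ (l - i) * mu N l / sqrt (real (l - i + 1) * h)) \<le> 1 / 3" for i
        using small[OF Np, of i] lh unfolding K_def h_def \<rho>_def by simp
    qed (use h(1) \<beta> Np in \<open>auto intro: mu_nonneg smooth_drift_meas smooth_drift_bound smooth_drift_holder\<close>)
    \<comment> \<open>The three parts pay for the damping, for the fluctuation of \<open>u\<close> and for the size of the drift.\<close>
    define \<kappa> where "\<kappa> i = h * (1 + (c.hess (Suc i))\<^sup>2) + (mu N i)\<^sup>2 / h" for i
    have \<kappa>0: "0 \<le> \<kappa> i" for i using h by (simp add: \<kappa>_def)
    have \<kappa>sum: "(\<Sum>i<N. \<kappa> i) \<le> tot"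
    proof -
      define cc where "cc i = (\<Sum>l=i..<N. (real (l - i + 1) * h) powr (\<beta> / 2 - 1) * mu N l)" for i
      have hess: "c.hess i = 5 * K\<^sup>2 * cc i" for i by (simp add: c.hess_def cc_def K_def)
      have ms: "(\<Sum>l<N. (mu N l)\<^sup>2 / h) \<le> m2" using sum_mu_square[OF Np] by (simp add: m2_def h_def)
      have "(\<Sum>i<N. h * (cc (Suc i))\<^sup>2) \<le> S\<^sup>2 * (\<Sum>l<N. (mu N l)\<^sup>2 / h)"
        using sum_convolution_square_le[OF h(1) \<beta>, where N = N and \<mu> = "mu N"]
        unfolding cc_def[symmetric] h(2) S_def[symmetric] .
      also have "\<dots> \<le> S\<^sup>2 * m2" by (intro mult_left_mono ms) auto
      finally have cs: "(\<Sum>i<N. h * (cc (Suc i))\<^sup>2) \<le> S\<^sup>2 * m2" .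
      have "(\<Sum>i<N. \<kappa> i) = (\<Sum>i<N. h) + 25 * K ^ 4 * (\<Sum>i<N. h * (cc (Suc i))\<^sup>2) + (\<Sum>l<N. (mu N l)\<^sup>2 / h)"
      proof -
        have "(5 * K\<^sup>2 * y)\<^sup>2 = 25 * K ^ 4 * y\<^sup>2" for y by (simp add: power_mult_distrib)
        then have "\<kappa> i = h + 25 * K ^ 4 * (h * (cc (Suc i))\<^sup>2) + (mu N i)\<^sup>2 / h" for i
          unfolding \<kappa>_def hess by (simp only: distrib_left mult_1_right mult_ac)
        then show ?thesis by (simp only: sum.distrib sum_distrib_left)
      qed
      also have "\<dots> \<le> T + 25 * K ^ 4 * (S\<^sup>2 * m2) + m2"
        using cs ms h(2) K by (intro add_mono mult_left_mono) auto
      finally show ?thesis by (simp add: tot_def)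
    qed
    have \<kappa>tot: "\<kappa> i \<le> tot" if "i < N" for i
    proof -
      have "\<kappa> i \<le> (\<Sum>i<N. \<kappa> i)" using that by (intro member_le_sum \<kappa>0) auto
      then show ?thesis using \<kappa>sum by simp
    qed
    have step: "(\<integral>\<^sup>+w. ennreal (norm (c.gap (Suc i) (euler_step N i (x + w)) (euler_step N i (z + w))) ^ (2 * n)) \<partial>gauss_measure h)
        \<le> ennreal ((1 + sc * \<kappa> i) * norm (c.gap i x z) ^ (2 * n))" if i: "i < N" for i x z
    proof -
      define \<Lambda> where "\<Lambda> = K * mu N i * h powr ((\<beta> - 1) / 2)"
      have lip: "norm (smooth_drift N i y - smooth_drift N i z) \<le> \<Lambda> * norm (y - z)" for y z
        using smooth_drift_lipschitz[OF Np] by (simp add: \<Lambda>_def K_def h_def)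
      have k1: "c.hess (Suc i) * sqrt h \<le> sqrt (\<kappa> i)"
      proof (rule real_le_rsqrt)
        show "(c.hess (Suc i) * sqrt h)\<^sup>2 \<le> \<kappa> i" using h by (simp add: \<kappa>_def power_mult_distrib algebra_simps)
      qed
      have m1: "mu N i / sqrt h \<le> sqrt (\<kappa> i)"
      proof (rule real_le_rsqrt)
        show "(mu N i / sqrt h)\<^sup>2 \<le> \<kappa> i" using h by (simp add: \<kappa>_def power_divide)
      qed
      have k2: "3 / 2 * \<Lambda> + c.hess (Suc i) * mu N i \<le> B * sqrt (\<kappa> i)"
      proof -
        have "h powr ((\<beta> - 1) / 2) = h powr (\<beta> / 2) / sqrt h"
          using h by (simp add: diff_divide_distrib powr_diff powr_half_sqrt)
        then have "\<Lambda> = K * (h powr (\<beta> / 2) * (mu N i / sqrt h))" by (simp add: \<Lambda>_def)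
        also have "\<dots> \<le> K * (T powr (\<beta> / 2) * sqrt (\<kappa> i))"
        proof (intro mult_left_mono mult_mono m1)
          have "h \<le> T" using T Np by (simp add: h_def divide_le_eq)
          then show "h powr (\<beta> / 2) \<le> T powr (\<beta> / 2)" using h \<beta> by (intro powr_mono2) auto
        qed (use K h \<kappa>0 mu_nonneg in auto)
        finally have a: "\<Lambda> \<le> K * T powr (\<beta> / 2) * sqrt (\<kappa> i)" by simp
        have "c.hess (Suc i) * mu N i = (c.hess (Suc i) * sqrt h) * (mu N i / sqrt h)" using h by simp
        also have "\<dots> \<le> sqrt (\<kappa> i) * sqrt (\<kappa> i)"
          using h mu_nonneg c.hess_nonneg \<kappa>0 by (intro mult_mono k1 m1) auto
        also have "\<dots> \<le> sqrt tot * sqrt (\<kappa> i)" using \<kappa>tot[OF i] \<kappa>0 by (intro mult_right_mono) auto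
        finally have "3 / 2 * \<Lambda> + c.hess (Suc i) * mu N i \<le> (3 / 2 * K * T powr (\<beta> / 2) + sqrt tot) * sqrt (\<kappa> i)"
          using a by (simp add: algebra_simps)
        also have "\<dots> \<le> B * sqrt (\<kappa> i)" using \<kappa>0 by (intro mult_right_mono B1) auto
        finally show ?thesis .
      qed
      have k3: "1 - \<rho> \<le> B * \<kappa> i"
      proof -
        have "1 - \<rho> \<le> lam * h" using exp_ge_add_one_self[of "- lam * h"] unfolding \<rho>_def by linarith
        also have "\<dots> \<le> B * \<kappa> i"
          using B1 lam h by (intro mult_mono) (auto simp: \<kappa>_def algebra_simps)
        finally show ?thesis .
      qed
      have es: "c.\<psi> = euler_step N" by (simp add: fun_eq_iff c.\<psi>_def euler_step_def)
      show ?thesis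
        unfolding sc_def es[symmetric]
        by (rule c.gap_moment[OF i n \<kappa>0 _ B1(1) lip k1 k2 k3 L_def[unfolded K_def] Mo(2,3)[OF h(1)]])
           (use \<kappa>tot[OF i] B1 in auto)
    qed
    let ?w = "\<lambda>\<omega> i. W (real (Suc i) * h) \<omega> - W (real i * h) \<omega>"
    let ?X = "\<lambda>\<omega>. flow (euler_step N) (?w \<omega>) k j x" and ?Z = "\<lambda>\<omega>. flow (euler_step N) (?w \<omega>) k j z"
    have um: "c.u i \<in> borel_measurable borel" for i by (rule bounded_borelD[OF c.bounded_borel_u])
    have Vm: "(\<lambda>p. norm (c.gap i (fst p) (snd p)) ^ (2 * n)) \<in> borel_measurable (borel \<Otimes>\<^sub>M borel)" for i
      using um[of i] unfolding c.gap_def by measurable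
    have em: "euler_step N i \<in> borel_measurable borel" for i
      by (rule borel_measurable_continuous_onI[OF continuous_euler_step[OF Np]])
    have fm: "(\<integral>\<^sup>+\<omega>. ennreal (norm (c.gap (k + j) (?X \<omega>) (?Z \<omega>)) ^ (2 * n)) \<partial>P)
       \<le> ennreal ((\<Prod>i=k..<k + j. 1 + sc * \<kappa> i) * norm (c.gap k x z) ^ (2 * n))"
    proof (rule P.flow_moment[where \<Delta> = "\<lambda>i \<omega>. W (real (Suc i) * h) \<omega> - W (real i * h) \<omega>" and N = N and h = h
          and V = "\<lambda>i x z. norm (c.gap i x z) ^ (2 * n)" and a = "\<lambda>i. 1 + sc * \<kappa> i"])
      show "0 \<le> 1 + sc * \<kappa> i" for i using sc \<kappa>0 by (simp add: add_nonneg_nonneg)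
    qed (fact brownian_increments[OF bm T Np h(2)] em Vm step kj | simp)+
    have pr: "(\<Prod>i=k..<k + j. 1 + sc * \<kappa> i) \<le> exp (sc * tot)"
    proof -
      have "(\<Prod>i=k..<k + j. 1 + sc * \<kappa> i) \<le> exp (\<Sum>i=k..<k + j. sc * \<kappa> i)"
        using sc \<kappa>0 by (intro prod_one_add_le_exp) auto
      also have "(\<Sum>i=k..<k + j. sc * \<kappa> i) \<le> (\<Sum>i<N. sc * \<kappa> i)"
        using kj sc \<kappa>0 by (intro sum_mono2) auto
      also have "\<dots> \<le> sc * tot" unfolding sum_distrib_left[symmetric] by (intro mult_left_mono \<kappa>sum sc)
      finally show ?thesis by simp
    qed
    have "(\<integral>\<^sup>+\<omega>. ennreal (norm (?X \<omega> - ?Z \<omega>) ^ (2 * n)) \<partial>P)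
      \<le> (\<integral>\<^sup>+\<omega>. ennreal (2 ^ (2 * n)) * ennreal (norm (c.gap (k + j) (?X \<omega>) (?Z \<omega>)) ^ (2 * n)) \<partial>P)"
    proof (intro nn_integral_mono)
      fix \<omega>
      have "norm (?X \<omega> - ?Z \<omega>) ^ (2 * n) \<le> (2 * norm (c.gap (k + j) (?X \<omega>) (?Z \<omega>))) ^ (2 * n)"
        by (intro power_mono c.gap_lower) auto
      then show "ennreal (norm (?X \<omega> - ?Z \<omega>) ^ (2 * n)) \<le> ennreal (2 ^ (2 * n)) * ennreal (norm (c.gap (k + j) (?X \<omega>) (?Z \<omega>)) ^ (2 * n))"
        by (simp add: ennreal_mult[symmetric] power_mult_distrib ennreal_leI)
    qed
    also have "\<dots> \<le> ennreal (2 ^ (2 * n)) * (\<integral>\<^sup>+\<omega>. ennreal (norm (c.gap (k + j) (?X \<omega>) (?Z \<omega>)) ^ (2 * n)) \<partial>P)"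
    proof (intro eq_refl nn_integral_cmult measurable_compose[OF _ measurable_ennreal])
      have "(\<lambda>\<omega>. flow (euler_step N) (?w \<omega>) k j y) \<in> borel_measurable P" for y
        using kj by (intro measurable_flow_random em measurable_brownian_increment[OF bm h(2,1)]) auto
      from measurable_compose[OF measurable_Pair[OF this this] Vm]
      show "(\<lambda>\<omega>. norm (c.gap (k + j) (?X \<omega>) (?Z \<omega>)) ^ (2 * n)) \<in> borel_measurable P" by simp
    qed
    also have "\<dots> \<le> ennreal (2 ^ (2 * n)) * ennreal (exp (sc * tot) * (3 / 2 * norm (x - z)) ^ (2 * n))"
      by (intro mult_left_mono order_trans[OF fm] ennreal_leI mult_mono pr power_mono c.gap_upper) auto
    also have "\<dots> = ennreal (C * norm (x - z) ^ (2 * n))"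
      unfolding C_def ennreal_mult'[OF zero_le_power[OF zero_le_numeral], symmetric] rescale_power ..
    finally show "(\<integral>\<^sup>+\<omega>. ennreal (norm (flow (euler_step N) (\<lambda>i. W (real (Suc i) * (T / real N)) \<omega> - W (real i * (T / real N)) \<omega>) k j x
         - flow (euler_step N) (\<lambda>i. W (real (Suc i) * (T / real N)) \<omega> - W (real i * (T / real N)) \<omega>) k j z) ^ (2 * n)) \<partial>P)
      \<le> ennreal (C * norm (x - z) ^ (2 * n))"
      unfolding h_def .
  qed
qed

end

section \<open>Chaining on dyadic lattices\<close>

definition dyadic_lattice :: "nat \<Rightarrow> nat \<Rightarrow> (real ^ 'n::finite) set" where
  "dyadic_lattice R j = (\<lambda>k. \<chi> i. real_of_int (k i) / 2 ^ j) ` {k. \<forall>i. k i \<in> {- int (R * 2 ^ j)..int (R * 2 ^ j)}}"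

text \<open>
  Only countably many points enter, which allows a union bound. The factor \<open>4 * CARD('n)\<close> admits the pairs
  that occur in chaining: roundings of one point at successive levels, and roundings of two close points.
\<close>

definition lattice_holder :: "(real ^ 'n::finite \<Rightarrow> 'b::real_normed_vector) \<Rightarrow> nat \<Rightarrow> real \<Rightarrow> real \<Rightarrow> bool" where
  "lattice_holder \<Phi> R K \<theta> \<longleftrightarrow> (\<forall>j. \<forall>u\<in>dyadic_lattice R j. \<forall>v\<in>dyadic_lattice R j.
     norm (u - v) \<le> 4 * real CARD('n) * (1 / 2) ^ j \<longrightarrow> norm (\<Phi> u - \<Phi> v) \<le> K * \<theta> ^ j)"

lemma finite_dyadic_lattice: "finite (dyadic_lattice R j :: (real ^ 'n::finite) set)"
  and card_dyadic_lattice: "card (dyadic_lattice R j :: (real ^ 'n::finite) set) \<le> (2 * R * 2 ^ j + 1) ^ CARD('n)"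
proof -
  have eq: "{k :: 'n \<Rightarrow> int. \<forall>i. k i \<in> {- int (R * 2 ^ j)..int (R * 2 ^ j)}} = PiE UNIV (\<lambda>_. {- int (R * 2 ^ j)..int (R * 2 ^ j)})"
    by (auto simp: PiE_def)
  have fin: "finite {k :: 'n \<Rightarrow> int. \<forall>i. k i \<in> {- int (R * 2 ^ j)..int (R * 2 ^ j)}}"
    unfolding eq by (intro finite_PiE) auto
  then show "finite (dyadic_lattice R j :: (real ^ 'n) set)" by (simp add: dyadic_lattice_def)
  have "card (dyadic_lattice R j :: (real ^ 'n) set) \<le> card {k :: 'n \<Rightarrow> int. \<forall>i. k i \<in> {- int (R * 2 ^ j)..int (R * 2 ^ j)}}"
    unfolding dyadic_lattice_def by (rule card_image_le[OF fin])
  also have "\<dots> = (2 * R * 2 ^ j + 1) ^ CARD('n)"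
    unfolding eq by (simp add: card_PiE nat_eq_iff) (simp add: nat_add_distrib nat_mult_distrib nat_power_eq mult.assoc)
  finally show "card (dyadic_lattice R j :: (real ^ 'n) set) \<le> (2 * R * 2 ^ j + 1) ^ CARD('n)" .
qed

lemma dyadic_lattice_mono: "dyadic_lattice R j \<subseteq> (dyadic_lattice R (Suc j) :: (real ^ 'n::finite) set)"
proof
  fix u :: "real ^ 'n" assume "u \<in> dyadic_lattice R j"
  then obtain k where k: "\<forall>i. k i \<in> {- int (R * 2 ^ j)..int (R * 2 ^ j)}" "u = (\<chi> i. real_of_int (k i) / 2 ^ j)"
    by (auto simp: dyadic_lattice_def)
  have "u = (\<chi> i. real_of_int (2 * k i) / 2 ^ Suc j)" by (simp add: k(2))
  moreover have "2 * k i \<in> {- int (R * 2 ^ Suc j)..int (R * 2 ^ Suc j)}" for i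
  proof -
    have "int (R * 2 ^ Suc j) = 2 * int (R * 2 ^ j)" by simp
    then show ?thesis using k(1)[rule_format, of i] unfolding atLeastAtMost_iff by linarith
  qed
  ultimately show "u \<in> dyadic_lattice R (Suc j)"
    unfolding dyadic_lattice_def by (intro image_eqI[of _ _ "\<lambda>i. 2 * k i"] CollectI allI)
qed

definition dyadic_floor :: "nat \<Rightarrow> real ^ 'n::finite \<Rightarrow> real ^ 'n" where
  "dyadic_floor j y = (\<chi> i. real_of_int \<lfloor>2 ^ j * y $ i\<rfloor> / 2 ^ j)"

lemma dyadic_floor_in_lattice:
  fixes y :: "real ^ 'n::finite"
  assumes "norm y \<le> real R - 1"
  shows "dyadic_floor j y \<in> dyadic_lattice R j"
proof -
  have "\<lfloor>2 ^ j * y $ i\<rfloor> \<in> {- int (R * 2 ^ j)..int (R * 2 ^ j)}" for i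
  proof -
    have a: "\<bar>y $ i\<bar> \<le> real R - 1" using component_le_norm_cart[of y i] assms by simp
    have "2 ^ j * y $ i \<le> 2 ^ j * real R" using a by (intro mult_left_mono) auto
    then have "\<lfloor>2 ^ j * y $ i\<rfloor> \<le> \<lfloor>real_of_int (int (R * 2 ^ j))\<rfloor>" by (intro floor_mono) (simp add: mult.commute)
    moreover have "2 ^ j * (- real R) \<le> 2 ^ j * y $ i" using a by (intro mult_left_mono) auto
    then have "\<lfloor>real_of_int (- int (R * 2 ^ j))\<rfloor> \<le> \<lfloor>2 ^ j * y $ i\<rfloor>" by (intro floor_mono) (simp add: mult.commute)
    ultimately show ?thesis by (simp only: floor_of_int atLeastAtMost_iff)
  qed
  then show ?thesis unfolding dyadic_lattice_def dyadic_floor_def by (intro image_eqI[of _ _ "\<lambda>i. \<lfloor>2 ^ j * y $ i\<rfloor>"]) auto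
qed

lemma dyadic_floor_close:
  fixes y :: "real ^ 'n::finite"
  shows "norm (dyadic_floor j y - y) \<le> real CARD('n) * (1 / 2) ^ j"
proof -
  have "\<bar>(dyadic_floor j y - y) $ i\<bar> \<le> (1 / 2) ^ j" for i
  proof -
    have "\<bar>real_of_int \<lfloor>2 ^ j * y $ i\<rfloor> - 2 ^ j * y $ i\<bar> \<le> 1" by linarith
    then have "\<bar>(real_of_int \<lfloor>2 ^ j * y $ i\<rfloor> - 2 ^ j * y $ i) / 2 ^ j\<bar> \<le> 1 / 2 ^ j"
      by (simp add: abs_divide divide_right_mono)
    then show ?thesis by (simp add: dyadic_floor_def diff_divide_distrib power_one_over)
  qed
  then have "(\<Sum>i\<in>UNIV. \<bar>(dyadic_floor j y - y) $ i\<bar>) \<le> (\<Sum>i\<in>(UNIV::'n set). (1 / 2) ^ j)" by (intro sum_mono)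
  with norm_le_l1_cart[of "dyadic_floor j y - y"] show ?thesis by simp
qed

lemma norm_add_diff_le: "norm (a + b - c) \<le> norm a + norm b + norm c" for a b c :: "'a::real_normed_vector"
  using norm_triangle_ineq4[of "a + b" c] norm_triangle_ineq[of a b] by linarith

text \<open>
  Both points are approximated by their roundings to the dyadic lattices, beginning with the level whose
  mesh is comparable with the distance of the points. Along the levels the increments of \<open>\<Phi>\<close> decrease like a
  geometric series with ratio at most \<open>3 / 4\<close>.
\<close>

lemma chaining:
  fixes \<Phi> :: "real ^ 'n::finite \<Rightarrow> 'b::real_normed_vector"
  assumes cont: "continuous_on UNIV \<Phi>" and lh: "lattice_holder \<Phi> R K ((1 / 2) powr \<alpha>)"
    and \<alpha>: "1 / 2 \<le> \<alpha>" "\<alpha> \<le> 1" and K: "0 \<le> K"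
    and y: "norm y \<le> real R - 1" and z: "norm z \<le> real R - 1" and yz: "norm (y - z) \<le> 1"
  shows "norm (\<Phi> y - \<Phi> z) \<le> 14 * K * norm (y - z) powr \<alpha>"
proof (cases "y = z")
  case False
  define d where "d = real CARD('n)"
  have d: "1 \<le> d" unfolding d_def by (simp add: Suc_leI)
  define \<theta> where "\<theta> = (1 / 2 :: real) powr \<alpha>"
  have \<theta>0: "0 < \<theta>" by (simp add: \<theta>_def)
  have \<theta>1: "\<theta> \<le> 3 / 4"
  proof -
    have "\<theta> \<le> (1 / 2) powr (1 / 2)" unfolding \<theta>_def using \<alpha> by (intro powr_mono') auto
    also have "\<dots> = sqrt (1 / 2)" by (simp add: powr_half_sqrt)
    also have "\<dots> \<le> 3 / 4" by (rule real_le_lsqrt) (auto simp: power2_eq_square)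
    finally show ?thesis .
  qed
  have \<theta>pow: "\<theta> ^ j = ((1 / 2) ^ j) powr \<alpha>" for j
    unfolding \<theta>_def by (simp add: powr_power powr_realpow[symmetric] powr_powr mult.commute)
  have L: "norm (\<Phi> u - \<Phi> v) \<le> K * \<theta> ^ j"
    if "u \<in> dyadic_lattice R j" "v \<in> dyadic_lattice R j" "norm (u - v) \<le> 4 * d * (1 / 2) ^ j" for u v j
    using lh that unfolding lattice_holder_def \<theta>_def d_def by blast
  have tail: "norm (\<Phi> x - \<Phi> (dyadic_floor j0 x)) \<le> 3 * K * \<theta> ^ j0" if x: "norm x \<le> real R - 1" for x j0
  proof -
    have step: "norm (\<Phi> (dyadic_floor (Suc j) x) - \<Phi> (dyadic_floor j x)) \<le> K * \<theta> ^ Suc j" for j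
    proof (rule L)
      show "dyadic_floor (Suc j) x \<in> dyadic_lattice R (Suc j)" by (rule dyadic_floor_in_lattice[OF x])
      show "dyadic_floor j x \<in> dyadic_lattice R (Suc j)"
        using dyadic_floor_in_lattice[OF x] dyadic_lattice_mono by blast
      have "norm (dyadic_floor (Suc j) x - dyadic_floor j x) \<le> norm (dyadic_floor (Suc j) x - x) + norm (dyadic_floor j x - x)"
        by (metis dist_norm dist_triangle2)
      also have "\<dots> \<le> d * (1 / 2) ^ Suc j + d * (1 / 2) ^ j" unfolding d_def by (intro add_mono dyadic_floor_close)
      also have "\<dots> \<le> 4 * d * (1 / 2) ^ Suc j" using d by simp
      finally show "norm (dyadic_floor (Suc j) x - dyadic_floor j x) \<le> 4 * d * (1 / 2) ^ Suc j" .
    qed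
    have fin: "norm (\<Phi> (dyadic_floor (j0 + m) x) - \<Phi> (dyadic_floor j0 x)) \<le> 3 * K * \<theta> ^ j0 * (1 - \<theta> ^ m)" for m
    proof (induction m)
      case (Suc m)
      have "norm (\<Phi> (dyadic_floor (j0 + Suc m) x) - \<Phi> (dyadic_floor j0 x))
          \<le> norm (\<Phi> (dyadic_floor (Suc (j0 + m)) x) - \<Phi> (dyadic_floor (j0 + m) x)) + norm (\<Phi> (dyadic_floor (j0 + m) x) - \<Phi> (dyadic_floor j0 x))"
        using norm_triangle_ineq[of "\<Phi> (dyadic_floor (Suc (j0 + m)) x) - \<Phi> (dyadic_floor (j0 + m) x)"
            "\<Phi> (dyadic_floor (j0 + m) x) - \<Phi> (dyadic_floor j0 x)"] by simp
      also have "\<dots> \<le> K * \<theta> ^ Suc (j0 + m) + 3 * K * \<theta> ^ j0 * (1 - \<theta> ^ m)" by (intro add_mono step Suc)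
      also have "\<dots> = 3 * K * \<theta> ^ j0 - K * \<theta> ^ j0 * \<theta> ^ m * (3 - \<theta>)"
        by (simp add: power_add algebra_simps)
      also have "\<dots> \<le> 3 * K * \<theta> ^ j0 - K * \<theta> ^ j0 * \<theta> ^ m * (3 * \<theta>)"
        using K \<theta>0 \<theta>1 by (intro diff_left_mono mult_left_mono) auto
      also have "\<dots> = 3 * K * \<theta> ^ j0 * (1 - \<theta> ^ Suc m)" by (simp add: algebra_simps)
      finally show ?case .
    qed simp
    have "(\<lambda>m. dyadic_floor (j0 + m) x) \<longlonglongrightarrow> x"
    proof (rule LIM_zero_cancel, rule Lim_null_comparison)
      show "\<forall>\<^sub>F m in sequentially. norm (dyadic_floor (j0 + m) x - x) \<le> d * (1 / 2) ^ (j0 + m)"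
        unfolding d_def by (intro always_eventually allI dyadic_floor_close)
      have "(\<lambda>m. d * (1 / 2) ^ j0 * (1 / 2) ^ m) \<longlonglongrightarrow> d * (1 / 2) ^ j0 * 0"
        by (intro tendsto_intros LIMSEQ_power_zero) auto
      then show "(\<lambda>m. d * (1 / 2) ^ (j0 + m)) \<longlonglongrightarrow> 0" by (simp add: power_add mult.assoc)
    qed
    then have "(\<lambda>m. norm (\<Phi> (dyadic_floor (j0 + m) x) - \<Phi> (dyadic_floor j0 x))) \<longlonglongrightarrow> norm (\<Phi> x - \<Phi> (dyadic_floor j0 x))"
      using cont by (intro tendsto_norm tendsto_diff tendsto_const)
        (rule continuous_on_tendsto_compose[of UNIV \<Phi>], auto)
    moreover have "norm (\<Phi> (dyadic_floor (j0 + m) x) - \<Phi> (dyadic_floor j0 x)) \<le> 3 * K * \<theta> ^ j0" for m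
    proof (rule order_trans[OF fin])
      have "3 * K * \<theta> ^ j0 * (1 - \<theta> ^ m) \<le> 3 * K * \<theta> ^ j0 * 1" using K \<theta>0 by (intro mult_left_mono) auto
      then show "3 * K * \<theta> ^ j0 * (1 - \<theta> ^ m) \<le> 3 * K * \<theta> ^ j0" by simp
    qed
    ultimately show ?thesis by (intro LIMSEQ_le_const2) auto
  qed
  define r where "r = norm (y - z)"
  have r: "0 < r" "r \<le> 1" using False yz by (auto simp: r_def)
  obtain j where j: "(1 / 2) ^ Suc j < r" "r \<le> (1 / 2) ^ j"
  proof -
    obtain j1 where "(1 / 2 :: real) ^ j1 < r" using real_arch_pow_inv[of r "1 / 2"] r by auto
    moreover have "(1 / 2 :: real) ^ Suc j1 \<le> (1 / 2) ^ j1" by simp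
    ultimately have ex: "(1 / 2 :: real) ^ Suc j1 < r" by linarith
    define j where "j = (LEAST j. (1 / 2 :: real) ^ Suc j < r)"
    have 1: "(1 / 2) ^ Suc j < r" unfolding j_def by (rule LeastI[of "\<lambda>j. (1 / 2 :: real) ^ Suc j < r", OF ex])
    have 2: "r \<le> (1 / 2) ^ j"
    proof (cases j)
      case 0
      then show ?thesis using r by simp
    next
      case (Suc i)
      then have "\<not> (1 / 2 :: real) ^ Suc i < r" using not_less_Least[of i "\<lambda>j. (1 / 2 :: real) ^ Suc j < r"] by (simp add: j_def)
      then show ?thesis using Suc by simp
    qed
    show ?thesis by (rule that[OF 1 2])
  qed
  have mid: "norm (\<Phi> (dyadic_floor j y) - \<Phi> (dyadic_floor j z)) \<le> K * \<theta> ^ j"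
  proof (rule L)
    show "dyadic_floor j y \<in> dyadic_lattice R j" "dyadic_floor j z \<in> dyadic_lattice R j"
      by (rule dyadic_floor_in_lattice[OF y], rule dyadic_floor_in_lattice[OF z])
    have "norm (dyadic_floor j y - dyadic_floor j z) \<le> norm (dyadic_floor j y - y) + r + norm (dyadic_floor j z - z)"
      using norm_add_diff_le[of "dyadic_floor j y - y" "y - z" "dyadic_floor j z - z"] by (simp add: r_def)
    also have "\<dots> \<le> d * (1 / 2) ^ j + 1 * (1 / 2) ^ j + d * (1 / 2) ^ j"
      using j(2) unfolding d_def by (intro add_mono dyadic_floor_close) auto
    also have "\<dots> \<le> d * (1 / 2) ^ j + d * (1 / 2) ^ j + d * (1 / 2) ^ j"
      using d by (intro add_mono mult_right_mono) auto
    also have "\<dots> \<le> 4 * d * (1 / 2) ^ j" using d by simp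
    finally show "norm (dyadic_floor j y - dyadic_floor j z) \<le> 4 * d * (1 / 2) ^ j" .
  qed
  have \<theta>r: "\<theta> ^ j \<le> 2 * r powr \<alpha>"
  proof -
    have "\<theta> ^ j \<le> (2 * r) powr \<alpha>" unfolding \<theta>pow using j \<alpha> by (intro powr_mono2) auto
    also have "\<dots> = 2 powr \<alpha> * r powr \<alpha>" using r by (simp add: powr_mult)
    also have "\<dots> \<le> 2 powr 1 * r powr \<alpha>" using \<alpha> by (intro mult_right_mono powr_mono) auto
    finally show ?thesis by simp
  qed
  have "norm (\<Phi> y - \<Phi> z) \<le> norm (\<Phi> y - \<Phi> (dyadic_floor j y)) + norm (\<Phi> (dyadic_floor j y) - \<Phi> (dyadic_floor j z)) + norm (\<Phi> z - \<Phi> (dyadic_floor j z))"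
    using norm_add_diff_le[of "\<Phi> y - \<Phi> (dyadic_floor j y)" "\<Phi> (dyadic_floor j y) - \<Phi> (dyadic_floor j z)" "\<Phi> z - \<Phi> (dyadic_floor j z)"]
    by simp
  also have "\<dots> \<le> 3 * K * \<theta> ^ j + K * \<theta> ^ j + 3 * K * \<theta> ^ j"
    by (intro add_mono tail[OF y] tail[OF z] mid)
  also have "\<dots> = 7 * K * \<theta> ^ j" by simp
  also have "\<dots> \<le> 7 * K * (2 * r powr \<alpha>)" using K by (intro mult_left_mono \<theta>r) auto
  finally show ?thesis by (simp add: r_def mult.assoc)
next
  case True
  then show ?thesis using K by simp
qed

text \<open>
  At level \<open>j\<close> there are of the order of \<open>2 ^ (2 * d * j)\<close> pairs of lattice points in dimension \<open>d\<close>. By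
  Markov's inequality each of them violates the condition with a probability of the order of
  \<open>2 powr (- 2 * n * (1 - \<alpha>) * j)\<close>. The assumption on \<open>n\<close> makes the sum over \<open>j\<close> converge.
\<close>

lemma (in prob_space) lattice_holder_prob:
  fixes \<Phi> :: "'a \<Rightarrow> real ^ 'n::finite \<Rightarrow> real ^ 'n"
  assumes meas[measurable]: "\<And>u. (\<lambda>\<omega>. \<Phi> \<omega> u) \<in> borel_measurable M" and C: "0 \<le> C" and K: "0 < K" and R: "1 \<le> R"
    and moment: "\<And>u v. (\<integral>\<^sup>+\<omega>. ennreal (norm (\<Phi> \<omega> u - \<Phi> \<omega> v) ^ (2 * n)) \<partial>M) \<le> ennreal (C * norm (u - v) ^ (2 * n))"
    and n: "2 * real CARD('n) + 1 \<le> 2 * real n * (1 - \<alpha>)"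
  shows "{\<omega>\<in>space M. \<not> lattice_holder (\<Phi> \<omega>) R K ((1 / 2) powr \<alpha>)} \<in> sets M" (is "?bad \<in> _")
    and "emeasure M {\<omega>\<in>space M. \<not> lattice_holder (\<Phi> \<omega>) R K ((1 / 2) powr \<alpha>)}
      \<le> ennreal (2 * (real (3 * R) ^ (2 * CARD('n)) * (4 * real CARD('n)) ^ (2 * n) * C) / K ^ (2 * n))"
proof -
  define d where "d = CARD('n)"
  define \<theta> where "\<theta> = (1 / 2 :: real) powr \<alpha>"
  have \<theta>: "0 < \<theta>" by (simp add: \<theta>_def)
  let ?near = "\<lambda>j. {p \<in> dyadic_lattice R j \<times> dyadic_lattice R j. norm (fst p - snd p) \<le> 4 * real d * (1 / 2) ^ j} :: ((real ^ 'n) \<times> (real ^ 'n)) set"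
  define E where "E j p = {\<omega>\<in>space M. K * \<theta> ^ j < norm (\<Phi> \<omega> (fst p) - \<Phi> \<omega> (snd p))}" for j and p :: "(real ^ 'n) \<times> (real ^ 'n)"
  have E_sets[measurable]: "E j p \<in> sets M" for j p unfolding E_def by measurable
  have fin: "finite (?near j)" for j
    by (rule finite_subset[OF _ finite_cartesian_product[OF finite_dyadic_lattice finite_dyadic_lattice]]) auto
  have bad: "?bad = (\<Union>j. \<Union>p\<in>?near j. E j p)"
  proof -
    have "\<not> lattice_holder (\<Phi> \<omega>) R K \<theta> \<longleftrightarrow> (\<exists>j. \<exists>p\<in>?near j. K * \<theta> ^ j < norm (\<Phi> \<omega> (fst p) - \<Phi> \<omega> (snd p)))" for \<omega>
      unfolding lattice_holder_def d_def Bex_def mem_Collect_eq mem_Times_iff split_paired_Ex fst_conv snd_conv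
      by (meson not_le)
    then show ?thesis unfolding E_def \<theta>_def[symmetric] by blast
  qed
  show "?bad \<in> sets M" unfolding bad using fin by (intro sets.countable_UN sets.finite_UN) auto
  define c where "c = real (3 * R) ^ (2 * d) * (4 * real d) ^ (2 * n) * C / K ^ (2 * n)"
  have c: "0 \<le> c" using C K by (simp add: c_def)
  have Ep: "emeasure M (E j p) \<le> ennreal (C * (4 * real d * (1 / 2) ^ j) ^ (2 * n) / (K * \<theta> ^ j) ^ (2 * n))" if "p \<in> ?near j" for j p
  proof -
    define L where "L = (K * \<theta> ^ j) ^ (2 * n)"
    have L: "0 < L" using K \<theta> by (simp add: L_def)
    let ?f = "\<lambda>\<omega>. ennreal (norm (\<Phi> \<omega> (fst p) - \<Phi> \<omega> (snd p)) ^ (2 * n))"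
    have "emeasure M (E j p) \<le> emeasure M {\<omega>\<in>space M. 1 \<le> ennreal (1 / L) * ?f \<omega>}"
    proof (intro emeasure_mono)
      show "E j p \<subseteq> {\<omega>\<in>space M. 1 \<le> ennreal (1 / L) * ?f \<omega>}"
      proof
        fix \<omega> assume w: "\<omega> \<in> E j p"
        then have "K * \<theta> ^ j \<le> norm (\<Phi> \<omega> (fst p) - \<Phi> \<omega> (snd p))" by (simp add: E_def)
        then have "L \<le> norm (\<Phi> \<omega> (fst p) - \<Phi> \<omega> (snd p)) ^ (2 * n)"
          unfolding L_def using K \<theta> by (intro power_mono) auto
        then have "1 \<le> 1 / L * norm (\<Phi> \<omega> (fst p) - \<Phi> \<omega> (snd p)) ^ (2 * n)" using L by simp
        then have "ennreal 1 \<le> ennreal (1 / L * norm (\<Phi> \<omega> (fst p) - \<Phi> \<omega> (snd p)) ^ (2 * n))" by (rule ennreal_leI)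
        also have "ennreal (1 / L * norm (\<Phi> \<omega> (fst p) - \<Phi> \<omega> (snd p)) ^ (2 * n)) = ennreal (1 / L) * ?f \<omega>"
          using L by (intro ennreal_mult) auto
        finally show "\<omega> \<in> {\<omega>\<in>space M. 1 \<le> ennreal (1 / L) * ?f \<omega>}"
          using w unfolding E_def ennreal_1 by blast
      qed
    qed measurable
    also have "\<dots> \<le> ennreal (1 / L) * (\<integral>\<^sup>+\<omega>. ?f \<omega> * indicator (space M) \<omega> \<partial>M)"
      using nn_integral_Markov_inequality[of ?f "space M" M "ennreal (1 / L)"] by simp
    also have "(\<integral>\<^sup>+\<omega>. ?f \<omega> * indicator (space M) \<omega> \<partial>M) = (\<integral>\<^sup>+\<omega>. ?f \<omega> \<partial>M)"
      by (intro nn_integral_cong) simp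
    also have "\<dots> \<le> ennreal (C * norm (fst p - snd p) ^ (2 * n))" by (rule moment)
    also have "\<dots> \<le> ennreal (C * (4 * real d * (1 / 2) ^ j) ^ (2 * n))"
      using that C by (intro ennreal_leI mult_left_mono power_mono) auto
    finally show ?thesis using L C unfolding L_def[symmetric]
      by (simp add: ennreal_mult[symmetric] mult_left_mono)
  qed
  have Ej: "emeasure M (\<Union>p\<in>?near j. E j p) \<le> ennreal (c * (1 / 2) ^ j)" for j
  proof -
    have "emeasure M (\<Union>p\<in>?near j. E j p) \<le> (\<Sum>p\<in>?near j. emeasure M (E j p))"
      using fin by (intro emeasure_subadditive_finite) auto
    also have "\<dots> \<le> (\<Sum>p\<in>?near j. ennreal (C * (4 * real d * (1 / 2) ^ j) ^ (2 * n) / (K * \<theta> ^ j) ^ (2 * n)))"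
      by (intro sum_mono Ep)
    also have "\<dots> = ennreal (real (card (?near j)) * (C * (4 * real d * (1 / 2) ^ j) ^ (2 * n) / (K * \<theta> ^ j) ^ (2 * n)))"
      unfolding sum_constant ennreal_of_nat_eq_real_of_nat
      by (rule ennreal_mult[symmetric]) (use C K \<theta> in auto)
    also have "\<dots> \<le> ennreal ((real (3 * R) * 2 ^ j) ^ (2 * d) * (C * (4 * real d * (1 / 2) ^ j) ^ (2 * n) / (K * \<theta> ^ j) ^ (2 * n)))"
    proof (intro ennreal_leI mult_right_mono)
      have "card (?near j) \<le> card ((dyadic_lattice R j :: (real ^ 'n) set) \<times> (dyadic_lattice R j :: (real ^ 'n) set))"
        using finite_dyadic_lattice by (intro card_mono) auto
      also have "\<dots> = card (dyadic_lattice R j :: (real ^ 'n) set) ^ 2" by (simp add: card_cartesian_product power2_eq_square)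
      also have "\<dots> \<le> ((2 * R * 2 ^ j + 1) ^ d) ^ 2" unfolding d_def by (intro power_mono card_dyadic_lattice) auto
      also have "\<dots> = (2 * R * 2 ^ j + 1) ^ (2 * d)" by (simp add: power_mult[symmetric] mult.commute)
      also have "\<dots> \<le> (3 * R * 2 ^ j) ^ (2 * d)"
      proof (rule power_mono)
        have "1 \<le> R * 2 ^ j" using R by (simp add: Suc_le_eq)
        then show "2 * R * 2 ^ j + 1 \<le> 3 * R * 2 ^ j" by linarith
      qed simp
      finally have "real (card (?near j)) \<le> real ((3 * R * 2 ^ j) ^ (2 * d))" by (rule of_nat_mono)
      then show "real (card (?near j)) \<le> (real (3 * R) * 2 ^ j) ^ (2 * d)" by simp
    qed (use C K \<theta> in auto)
    also have "(real (3 * R) * 2 ^ j) ^ (2 * d) * (C * (4 * real d * (1 / 2) ^ j) ^ (2 * n) / (K * \<theta> ^ j) ^ (2 * n))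
        = c * ((2 ^ (2 * d) * (1 / 2) ^ (2 * n) / \<theta> ^ (2 * n)) ^ j)"
      unfolding c_def power_mult_distrib power_divide
      by (simp add: power_mult[symmetric] mult.commute[of j]) (simp add: mult_ac)
    also have "\<dots> \<le> c * (1 / 2) ^ j"
    proof (intro mult_left_mono power_mono c)
      have "2 ^ (2 * d) * (1 / 2) ^ (2 * n) / \<theta> ^ (2 * n) = 2 powr (2 * real d - 2 * real n * (1 - \<alpha>))"
        unfolding \<theta>_def
        by (simp add: powr_realpow[symmetric] powr_powr powr_diff powr_divide powr_mult powr_add powr_minus algebra_simps divide_simps)
      also have "\<dots> \<le> 2 powr (- 1)" using n unfolding d_def by (intro powr_mono) auto
      finally show "2 ^ (2 * d) * (1 / 2) ^ (2 * n) / \<theta> ^ (2 * n) \<le> 1 / 2" by (simp add: powr_minus)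
    qed (use \<theta> in auto)
    finally show ?thesis using c by (simp add: ennreal_leI)
  qed
  have "emeasure M ?bad \<le> (\<Sum>j. emeasure M (\<Union>p\<in>?near j. E j p))"
    unfolding bad using fin by (intro emeasure_subadditive_countably) (auto intro!: sets.finite_UN)
  also have "\<dots> \<le> (\<Sum>j. ennreal (c * (1 / 2) ^ j))" by (intro suminf_le Ej summableI)
  also have "\<dots> = ennreal (c * 2)"
  proof -
    have "(\<lambda>j. c * (1 / 2 :: real) ^ j) sums (c * (1 / (1 - 1 / 2)))" by (intro sums_mult geometric_sums) auto
    then have "(\<lambda>j. c * (1 / 2 :: real) ^ j) sums (c * 2)" by simp
    then show ?thesis using c by (intro suminf_ennreal_eq) auto
  qed
  finally show "emeasure M ?bad \<le> ennreal (2 * (real (3 * R) ^ (2 * CARD('n)) * (4 * real CARD('n)) ^ (2 * n) * C) / K ^ (2 * n))"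
    by (simp add: c_def d_def mult.commute)
qed

section \<open>Local errors of exact solutions\<close>

text \<open>
  The path \<open>y\<close> is replaced by the flow one step at a time, from the last step back to the first.
\<close>

lemma flow_telescope:
  fixes y :: "nat \<Rightarrow> 'a::real_normed_vector"
  shows "norm (y l - flow \<psi> w 0 l (y 0))
    \<le> (\<Sum>k<l. norm (flow \<psi> w (Suc k) (l - Suc k) (y (Suc k)) - flow \<psi> w (Suc k) (l - Suc k) (\<psi> k (y k + w k))))"
proof -
  define a where "a k = flow \<psi> w k (l - k) (y k)" for k
  have step: "a k = flow \<psi> w (Suc k) (l - Suc k) (\<psi> k (y k + w k))" if "k < l" for k
  proof -
    have "l - k = Suc (l - Suc k)" using that by simp
    then show ?thesis unfolding a_def by (simp only: flow_Suc_left)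
  qed
  have "y l - flow \<psi> w 0 l (y 0) = a l - a 0" by (simp add: a_def)
  also have "\<dots> = (\<Sum>k<l. a (Suc k) - a k)" by (rule sum_lessThan_telescope[symmetric])
  also have "norm \<dots> \<le> (\<Sum>k<l. norm (a (Suc k) - a k))" by (rule norm_sum)
  also have "\<dots> = (\<Sum>k<l. norm (flow \<psi> w (Suc k) (l - Suc k) (y (Suc k)) - flow \<psi> w (Suc k) (l - Suc k) (\<psi> k (y k + w k))))"
    by (intro sum.cong refl) (simp add: step, simp add: a_def)
  finally show ?thesis .
qed

text \<open>
  Lets a sum of powers be estimated by the sum itself when \<open>\<alpha>\<close> is close to 1. Terms below \<open>N powr (- 2)\<close> are
  negligible even if there are \<open>N\<close> of them.
\<close>

lemma powr_split_le:
  fixes l \<alpha> :: real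
  assumes l: "0 \<le> l" and \<alpha>: "0 < \<alpha>" "\<alpha> \<le> 1" and N: "0 < N"
  shows "l powr \<alpha> \<le> N powr (2 * (1 - \<alpha>)) * l + N powr (- (2 * \<alpha>))"
proof (cases "N powr (-2) \<le> l")
  case True
  have l0: "0 < l" using True N by (smt (verit) powr_gt_zero)
  have "l powr \<alpha> = l * l powr (\<alpha> - 1)" using l0 by (simp add: powr_diff)
  also have "\<dots> \<le> l * (N powr (-2)) powr (\<alpha> - 1)"
    using l0 \<alpha> True N by (intro mult_left_mono powr_mono2') auto
  also have "\<dots> = N powr (2 * (1 - \<alpha>)) * l" by (simp add: powr_powr algebra_simps)
  finally show ?thesis by (simp add: add_increasing2)
next
  case False
  then have "l powr \<alpha> \<le> (N powr (-2)) powr \<alpha>" using l \<alpha> by (intro powr_mono2) auto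
  also have "\<dots> = N powr (- (2 * \<alpha>))" by (simp add: powr_powr)
  finally show ?thesis using l by (simp add: add_increasing)
qed

lemma powr_add_le:
  fixes a b :: real
  assumes "0 \<le> a" "0 \<le> b" "0 < \<beta>" "\<beta> \<le> 1"
  shows "(a + b) powr \<beta> \<le> a powr \<beta> + b powr \<beta>"
proof (cases "a + b = 0")
  case False
  define s where "s = a + b"
  have s: "0 < s" using assms False by (simp add: s_def)
  have le: "t \<le> t powr \<beta>" if "0 \<le> t" "t \<le> 1" for t :: real
    using that assms powr_mono'[of \<beta> 1 t] by simp
  have "1 = a / s + b / s" using s by (simp add: s_def add_divide_distrib[symmetric])
  also have "\<dots> \<le> (a / s) powr \<beta> + (b / s) powr \<beta>"
    using assms s by (intro add_mono le) (auto simp: s_def)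
  also have "\<dots> = (a powr \<beta> + b powr \<beta>) / s powr \<beta>"
    using assms s by (simp add: powr_divide add_divide_distrib)
  finally show ?thesis using s by (simp add: s_def[symmetric] field_simps)
qed (use assms in auto)

context rough_drift
begin

text \<open>
  Extends functions on \<open>{0..T}\<close> continuously to the line, which keeps measurability statements simple.
\<close>

definition clamp_time :: "real \<Rightarrow> real" where "clamp_time t = max 0 (min T t)"

lemma clamp_time_in: "clamp_time t \<in> {0..T}" using T by (auto simp: clamp_time_def)
lemma clamp_time_eq: "t \<in> {0..T} \<Longrightarrow> clamp_time t = t" by (auto simp: clamp_time_def)
lemma continuous_clamp_time: "continuous_on S clamp_time" unfolding clamp_time_def by (intro continuous_intros)

lemma continuous_clamped: "continuous_on {0..T} f \<Longrightarrow> continuous_on UNIV (\<lambda>t. f (clamp_time t))"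
  by (rule continuous_on_compose2[OF _ continuous_clamp_time]) (auto intro: image_subsetI clamp_time_in simp del: atLeastAtMost_iff)

lemma b_clamped: "b (t, Y (clamp_time t)) = b (t, Y t)"
proof (cases "t \<in> {0..T}")
  case False
  then have "norm (b (t, y)) \<le> 0" for y using b_bound[of t y] M_supp by simp
  then show ?thesis by simp
qed (simp add: clamp_time_eq)

definition solution :: "real ^ 'n \<Rightarrow> (real \<Rightarrow> real ^ 'n) \<Rightarrow> (real \<Rightarrow> real ^ 'n) \<Rightarrow> bool" where
  "solution x w Y \<longleftrightarrow> continuous_on {0..T} Y \<and>
     (\<forall>t\<in>{0..T}. Y t = x + w t + (LINT s:{0..t}|lborel. b (s, Y s)))"

definition grid :: "nat \<Rightarrow> nat \<Rightarrow> real" where "grid N i = real i * (T / real N)"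

text \<open>
  The contribution of the motion of \<open>w\<close> within a cell to the local error. The right end point occurs because
  the scheme evaluates the drift after adding the noise of the cell.
\<close>

definition path_error :: "nat \<Rightarrow> (real \<Rightarrow> real ^ 'n) \<Rightarrow> nat \<Rightarrow> real" where
  "path_error N w i = (LINT t:cell N i|lborel. M t * norm (w (grid N (Suc i)) - w t) powr \<beta>)"

lemma cell_grid: "cell N i = {grid N i<..grid N (Suc i)}"
  by (simp add: cell_def grid_def)

lemma grid_in: "0 < N \<Longrightarrow> i \<le> N \<Longrightarrow> grid N i \<in> {0..T}"
proof -
  assume N: "0 < N" "i \<le> N"
  have "real i * (T / real N) \<le> real N * (T / real N)" using N T by (intro mult_right_mono) auto
  then show ?thesis using N T by (simp add: grid_def)
qed

lemma grid_mono: "i \<le> j \<Longrightarrow> grid N i \<le> grid N j"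
  unfolding grid_def using T by (intro mult_right_mono) auto

lemma set_integral_split:
  assumes Y: "Y \<in> borel_measurable borel" and st: "0 \<le> s" "s \<le> t"
  shows "(LINT r:{0..t}|lborel. b (r, Y r)) = (LINT r:{0..s}|lborel. b (r, Y r)) + (LINT r:{s<..t}|lborel. b (r, Y r))"
proof -
  have un: "{0..t} = {0..s} \<union> {s<..t}" and disj: "{0..s} \<inter> {s<..t} = {}" using st by auto
  show ?thesis unfolding un by (rule set_integral_Un[OF disj b_set_integrable[OF Y] b_set_integrable[OF Y]]) simp_all
qed

lemma solution_increment:
  assumes sol: "solution x w Y" and st: "0 \<le> s" "s \<le> t" "t \<le> T"
  shows "Y t - Y s = w t - w s + (LINT r:{s<..t}|lborel. b (r, Y (clamp_time r)))"
proof -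
  define Yc where "Yc = (\<lambda>t. Y (clamp_time t))"
  have Yc: "Yc \<in> borel_measurable borel"
    using sol unfolding solution_def Yc_def by (intro borel_measurable_continuous_onI continuous_clamped) auto
  have "Y r = x + w r + (LINT s:{0..r}|lborel. b (s, Yc s))" if "r \<in> {0..T}" for r
    using sol that unfolding solution_def Yc_def b_clamped by blast
  from this[of t] this[of s] st have "Y t - Y s = w t - w s + ((LINT r:{0..t}|lborel. b (r, Yc r)) - (LINT r:{0..s}|lborel. b (r, Yc r)))"
    by simp
  then show ?thesis unfolding set_integral_split[OF Yc st(1,2)] by (simp add: Yc_def)
qed

lemma set_integral_M_mono: "A \<in> sets borel \<Longrightarrow> B \<in> sets borel \<Longrightarrow> A \<subseteq> B \<Longrightarrow> (LINT t:A|lborel. M t) \<le> (LINT t:B|lborel. M t)"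
  using M_set_integrable[of A] M_set_integrable[of B] M_nonneg unfolding set_lebesgue_integral_def set_integrable_def
  by (intro integral_mono) (auto simp: indicator_def)

lemma mu_le_sqrt: "mu N i \<le> sqrt ((\<integral>t. (M t)\<^sup>2 \<partial>lborel) * (T / real N))"
  unfolding mu_def cell_eq
  using M_interval_le_sqrt[of "real i * (T / real N)" "real i * (T / real N) + T / real N"] T by simp

definition error_const :: real where
  "error_const = (\<integral>t. (M t)\<^sup>2 \<partial>lborel) powr (\<beta> / 2) + gauss_const TYPE('n)"

text \<open>
  In cell \<open>i\<close> the solution differs from the point at which the scheme evaluates its drift by the remaining
  noise and by at most \<open>mu N i\<close>. The Hoelder condition turns these two distances into errors of the drift,
  and a third error comes from the mollification.
\<close>

lemma local_error:
  assumes sol: "solution x w Y" and w: "continuous_on {0..T} w" and N: "N > 0" and i: "i < N"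
  shows "norm (Y (grid N (Suc i)) - euler_step N i (Y (grid N i) + (w (grid N (Suc i)) - w (grid N i))))
    \<le> path_error N w i + error_const * (T / real N) powr (\<beta> / 2) * mu N i"
proof -
  define h where "h = T / real N"
  have h: "h > 0" using T N by (simp add: h_def)
  define s t where "s = grid N i" and "t = grid N (Suc i)"
  have st: "0 \<le> s" "s \<le> t" "t \<le> T"
    using grid_in[OF N, of i] grid_in[OF N, of "Suc i"] grid_mono[of i "Suc i" N] i by (auto simp: s_def t_def)
  have cell: "cell N i = {s<..t}" by (simp add: cell_grid s_def t_def)
  define Yc where "Yc = (\<lambda>t. Y (clamp_time t))"
  define wc where "wc = (\<lambda>t. w (clamp_time t))"
  have Yc[measurable]: "Yc \<in> borel_measurable borel"
    using sol unfolding solution_def Yc_def by (intro borel_measurable_continuous_onI continuous_clamped) auto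
  have wc: "continuous_on UNIV wc" unfolding wc_def by (rule continuous_clamped[OF w])
  then have [measurable]: "wc \<in> borel_measurable borel" by (rule borel_measurable_continuous_onI)
  define y where "y = Y s + (w t - w s)"
  define J where "J = (LINT r:cell N i|lborel. b (r, Yc r))"
  have "Y t - Y s = w t - w s + J"
    using solution_increment[OF sol st] by (simp add: J_def cell Yc_def)
  then have Yt: "Y t = y + J" by (simp add: y_def algebra_simps)
  have dist: "norm (Yc r - y) \<le> norm (w t - w r) + mu N i" if r: "r \<in> cell N i" for r
  proof -
    have rs: "s \<le> r" "r \<le> t" using r by (auto simp: cell)
    have rT: "r \<in> {0..T}" using rs st by auto
    have "Y r - Y s = w r - w s + (LINT u:{s<..r}|lborel. b (u, Yc u))"
      using solution_increment[OF sol st(1) rs(1)] rT by (simp add: Yc_def)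
    then have "Yc r - y = (w r - w t) + (LINT u:{s<..r}|lborel. b (u, Yc u))"
      using rT by (simp add: Yc_def y_def clamp_time_eq algebra_simps)
    then have "norm (Yc r - y) \<le> norm (w r - w t) + norm (LINT u:{s<..r}|lborel. b (u, Yc u))"
      by (simp only: norm_triangle_ineq)
    also have "norm (LINT u:{s<..r}|lborel. b (u, Yc u)) \<le> (LINT u:{s<..r}|lborel. M u)"
      by (rule norm_set_integral_b_le[OF Yc]) simp
    also have "\<dots> \<le> mu N i"
      unfolding mu_def cell by (rule set_integral_M_mono) (use rs in auto)
    finally show ?thesis by (simp add: norm_minus_commute)
  qed
  have intM: "set_integrable lborel (cell N i) (\<lambda>r. M r * mu N i powr \<beta>)"
    using M_set_integrable[of "cell N i"] by simp
  have bnd: "\<exists>B. \<forall>r. norm (wc t - wc r) powr \<beta> \<le> B"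
  proof -
    have "compact (w ` {0..T})" by (intro compact_continuous_image w) simp
    then obtain B where B: "\<And>r. r \<in> {0..T} \<Longrightarrow> norm (w r) \<le> B"
      by (metis bounded_iff compact_imp_bounded image_eqI)
    have "norm (wc t - wc r) powr \<beta> \<le> (B + B) powr \<beta>" for r
      unfolding wc_def using \<beta> clamp_time_in
      by (intro powr_mono2 order_trans[OF norm_triangle_ineq4] add_mono B) auto
    then show ?thesis by blast
  qed
  then obtain Bd where Bd: "\<And>r. norm (wc t - wc r) powr \<beta> \<le> Bd" by blast
  have intw': "integrable lborel (\<lambda>r. M r * norm (wc t - wc r) powr \<beta>)"
    by (rule Bochner_Integration.integrable_bound[OF integrable_mult_right[OF M_integrable, of Bd]])
       (auto intro!: AE_I2 mult_mono' Bd M_nonneg order_trans[OF _ abs_ge_self] simp: M_nonneg abs_mult mult.commute[of Bd])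
  have intw: "set_integrable lborel (cell N i) (\<lambda>r. M r * norm (wc t - wc r) powr \<beta>)"
    unfolding set_integrable_def by (rule integrable_mult_indicator[OF _ intw']) simp
  have wceq: "wc r = w r" if "r \<in> cell N i" for r
    using that st by (auto simp: wc_def cell clamp_time_eq)
  have wct: "wc t = w t" using st by (simp add: wc_def clamp_time_eq)
  have "norm (J - cell_drift N i y) \<le> (LINT r:cell N i|lborel. M r * norm (wc t - wc r) powr \<beta> + M r * mu N i powr \<beta>)"
    unfolding J_def cell_drift_def
  proof (rule norm_set_integral_b_diff_le)
    show "set_integrable lborel (cell N i) (\<lambda>r. M r * norm (wc t - wc r) powr \<beta> + M r * mu N i powr \<beta>)"
      using intw intM by simp
    fix r assume r: "r \<in> cell N i"
    have "norm (b (r, Yc r) - b (r, y)) \<le> M r * norm (Yc r - y) powr \<beta>" by (rule b_holder)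
    also have "\<dots> \<le> M r * (norm (wc t - wc r) + mu N i) powr \<beta>"
      using dist[OF r] M_nonneg \<beta> wceq[OF r] wct by (intro mult_left_mono powr_mono2) auto
    also have "\<dots> \<le> M r * (norm (wc t - wc r) powr \<beta> + mu N i powr \<beta>)"
      using M_nonneg \<beta> mu_nonneg by (intro mult_left_mono powr_add_le) auto
    finally show "norm (b (r, Yc r) - b (r, y)) \<le> M r * norm (wc t - wc r) powr \<beta> + M r * mu N i powr \<beta>"
      by (simp add: algebra_simps)
  qed auto
  also have "\<dots> = (LINT r:cell N i|lborel. M r * norm (wc t - wc r) powr \<beta>) + mu N i * mu N i powr \<beta>"
    using intw intM by (simp add: mu_def)
  also have "(LINT r:cell N i|lborel. M r * norm (wc t - wc r) powr \<beta>) = path_error N w i"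
    unfolding path_error_def t_def[symmetric]
    by (intro set_lebesgue_integral_cong) (auto simp: wceq wct)
  also have "mu N i * mu N i powr \<beta> \<le> mu N i * ((\<integral>t. (M t)\<^sup>2 \<partial>lborel) powr (\<beta> / 2) * h powr (\<beta> / 2))"
  proof (intro mult_left_mono mu_nonneg)
    have m2: "0 \<le> (\<integral>t. (M t)\<^sup>2 \<partial>lborel)" by (intro integral_nonneg_AE AE_I2) simp
    have "mu N i powr \<beta> \<le> sqrt ((\<integral>t. (M t)\<^sup>2 \<partial>lborel) * h) powr \<beta>"
      using mu_le_sqrt[of N i] mu_nonneg \<beta> by (intro powr_mono2) (auto simp: h_def)
    also have "\<dots> = ((\<integral>t. (M t)\<^sup>2 \<partial>lborel) * h) powr (\<beta> / 2)"
      using m2 h by (simp add: powr_half_sqrt[symmetric] powr_powr)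
    also have "\<dots> = (\<integral>t. (M t)\<^sup>2 \<partial>lborel) powr (\<beta> / 2) * h powr (\<beta> / 2)"
      using m2 h by (simp add: powr_mult)
    finally show "mu N i powr \<beta> \<le> (\<integral>t. (M t)\<^sup>2 \<partial>lborel) powr (\<beta> / 2) * h powr (\<beta> / 2)" .
  qed
  finally have e1: "norm (J - cell_drift N i y) \<le> path_error N w i + mu N i * ((\<integral>t. (M t)\<^sup>2 \<partial>lborel) powr (\<beta> / 2) * h powr (\<beta> / 2))"
    by simp
  have e2: "norm (smooth_drift N i y - cell_drift N i y) \<le> mu N i * h powr (\<beta> / 2) * gauss_const TYPE('n)"
    unfolding smooth_drift_def h_def[symmetric]
    by (rule heat_close_holder[OF h bounded_borel_cell_drift mu_nonneg \<beta> cell_drift_holder])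
  have "norm (Y t - euler_step N i y) = norm ((J - cell_drift N i y) - (smooth_drift N i y - cell_drift N i y))"
    by (simp add: Yt euler_step_def)
  also have "\<dots> \<le> norm (J - cell_drift N i y) + norm (smooth_drift N i y - cell_drift N i y)" by (rule norm_triangle_ineq4)
  also have "\<dots> \<le> path_error N w i + error_const * h powr (\<beta> / 2) * mu N i"
    using e1 e2 unfolding error_const_def by (simp add: algebra_simps)
  finally show ?thesis by (simp add: y_def s_def t_def h_def)
qed

end

section \<open>Almost sure bounds along dyadic meshes\<close>

lemma (in prob_space) AE_eventually_not_in:
  assumes A: "\<And>m. A m \<in> sets M" and le: "\<And>m. emeasure M (A m) \<le> ennreal (g m)" and g: "summable g" "\<And>m. 0 \<le> g m"
  shows "AE \<omega> in M. \<forall>\<^sub>F m in sequentially. \<omega> \<notin> A m"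
proof -
  have "AE \<omega> in M. \<forall>\<^sub>F m in sequentially. \<omega> \<in> space M - A m"
  proof (rule borel_cantelli_AE1[OF A])
    show "emeasure M (A m) < \<infinity>" for m by (simp add: emeasure_eq_measure)
    have "measure M (A m) \<le> g m" for m
      using le[of m] g(2)[of m] by (simp add: emeasure_eq_measure ennreal_le_iff)
    then show "summable (\<lambda>m. measure M (A m))"
      by (intro summable_comparison_test[OF _ g(1)] exI[of _ 0] allI impI) auto
  qed
  then show ?thesis by eventually_elim (auto elim: eventually_mono)
qed

lemma (in prob_space) AE_eventually_le:
  assumes f[measurable]: "\<And>m. f m \<in> borel_measurable M" and a: "\<And>m. 0 < a m"
    and le: "\<And>m. (\<integral>\<^sup>+\<omega>. f m \<omega> \<partial>M) \<le> ennreal (a m * g m)" and g: "summable g" "\<And>m. 0 \<le> g m"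
  shows "AE \<omega> in M. \<forall>\<^sub>F m in sequentially. f m \<omega> \<le> ennreal (a m)"
proof -
  define A where "A m = {\<omega>\<in>space M. 1 \<le> ennreal (1 / a m) * f m \<omega>}" for m
  have "AE \<omega> in M. \<forall>\<^sub>F m in sequentially. \<omega> \<notin> A m"
  proof (rule AE_eventually_not_in[OF _ _ g])
    fix m
    show "A m \<in> sets M" unfolding A_def by measurable
    have "emeasure M (A m) \<le> ennreal (1 / a m) * (\<integral>\<^sup>+\<omega>. f m \<omega> * indicator (space M) \<omega> \<partial>M)"
      using nn_integral_Markov_inequality[of "f m" "space M" M "ennreal (1 / a m)"] by (simp add: A_def)
    also have "(\<integral>\<^sup>+\<omega>. f m \<omega> * indicator (space M) \<omega> \<partial>M) = (\<integral>\<^sup>+\<omega>. f m \<omega> \<partial>M)"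
      by (intro nn_integral_cong) simp
    also have "ennreal (1 / a m) * \<dots> \<le> ennreal (1 / a m) * ennreal (a m * g m)"
      by (intro mult_left_mono le) simp
    also have "\<dots> = ennreal (g m)"
      using a[of m] g(2)[of m] by (subst ennreal_mult[symmetric]) auto
    finally show "emeasure M (A m) \<le> ennreal (g m)" .
  qed
  moreover have "AE \<omega> in M. \<omega> \<in> space M" by (rule AE_space)
  ultimately show ?thesis
  proof eventually_elim
    case (elim \<omega>)
    have "f m \<omega> \<le> ennreal (a m)" if "\<omega> \<notin> A m" for m
    proof -
      have "ennreal (1 / a m) * f m \<omega> \<le> 1" using that elim(2) by (auto simp: A_def not_le intro: less_imp_le)
      then have "ennreal (a m) * (ennreal (1 / a m) * f m \<omega>) \<le> ennreal (a m) * 1" by (intro mult_left_mono) auto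
      moreover have "ennreal (a m) * (ennreal (1 / a m) * f m \<omega>) = f m \<omega>"
        using a[of m] by (simp add: mult.assoc[symmetric] ennreal_mult[symmetric])
      ultimately show ?thesis by simp
    qed
    then show ?case using elim(1) by (auto elim: eventually_mono)
  qed
qed

locale brownian_drift = rough_drift T \<beta> q b M
  for T \<beta> q :: real and b :: "real \<times> (real ^ 'n::finite) \<Rightarrow> real ^ 'n" and M :: "real \<Rightarrow> real" +
  fixes P :: "'w measure" and W :: "real \<Rightarrow> 'w \<Rightarrow> real ^ 'n"
  assumes bm: "standard_brownian_motion P T W"
begin

sublocale P: prob_space P
  using bm by (simp add: standard_brownian_motion_def)

lemma W_meas: "t \<in> {0..T} \<Longrightarrow> W t \<in> borel_measurable P"
  and W_zero: "\<omega> \<in> space P \<Longrightarrow> W 0 \<omega> = 0"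
  and W_cont: "\<omega> \<in> space P \<Longrightarrow> continuous_on {0..T} (\<lambda>t. W t \<omega>)"
  using bm unfolding standard_brownian_motion_def by auto

text \<open>
  By continuity of the paths, \<open>W\<close> is a pointwise limit of processes that are constant in time on the cells
  of a grid.
\<close>

lemma W_jointly_measurable: "(\<lambda>p. W (clamp_time (snd p)) (fst p)) \<in> borel_measurable (P \<Otimes>\<^sub>M borel)"
proof (rule borel_measurable_LIMSEQ_metric)
  fix n :: nat
  have "(\<lambda>p. W (clamp_time (real_of_int i / real (Suc n))) (fst p)) \<in> borel_measurable (P \<Otimes>\<^sub>M borel)" for i :: int
    by (rule measurable_compose[OF measurable_fst W_meas[OF clamp_time_in]])
  moreover have "(\<lambda>p. \<lfloor>real (Suc n) * snd p\<rfloor>) \<in> measurable (P \<Otimes>\<^sub>M borel) (count_space UNIV)"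
    by measurable
  ultimately show "(\<lambda>p. W (clamp_time (real_of_int \<lfloor>real (Suc n) * snd p\<rfloor> / real (Suc n))) (fst p)) \<in> borel_measurable (P \<Otimes>\<^sub>M borel)"
    by (rule measurable_compose_countable)
next
  fix p assume p: "p \<in> space (P \<Otimes>\<^sub>M (borel :: real measure))"
  then have w: "fst p \<in> space P" by (auto simp: space_pair_measure)
  have lim: "(\<lambda>n. real_of_int \<lfloor>real (Suc n) * snd p\<rfloor> / real (Suc n)) \<longlonglongrightarrow> snd p"
  proof (rule LIM_zero_cancel, rule Lim_null_comparison)
    show "\<forall>\<^sub>F n in sequentially. norm (real_of_int \<lfloor>real (Suc n) * snd p\<rfloor> / real (Suc n) - snd p) \<le> inverse (real (Suc n))"
    proof (intro always_eventually allI)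
      fix n
      have "\<bar>real_of_int \<lfloor>real (Suc n) * snd p\<rfloor> - real (Suc n) * snd p\<bar> \<le> 1" by linarith
      then have "\<bar>(real_of_int \<lfloor>real (Suc n) * snd p\<rfloor> - real (Suc n) * snd p) / real (Suc n)\<bar> \<le> 1 / real (Suc n)"
        by (simp add: abs_divide divide_right_mono del: of_nat_Suc)
      then show "norm (real_of_int \<lfloor>real (Suc n) * snd p\<rfloor> / real (Suc n) - snd p) \<le> inverse (real (Suc n))"
        by (simp add: diff_divide_distrib inverse_eq_divide del: of_nat_Suc)
    qed
  qed (rule LIMSEQ_inverse_real_of_nat)
  have c: "continuous_on UNIV (\<lambda>t. W (clamp_time t) (fst p))" by (rule continuous_clamped[OF W_cont[OF w]])
  show "(\<lambda>n. W (clamp_time (real_of_int \<lfloor>real (Suc n) * snd p\<rfloor> / real (Suc n))) (fst p)) \<longlonglongrightarrow> W (clamp_time (snd p)) (fst p)"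
    using continuous_on_tendsto_compose[OF c lim] by simp
qed

lemma increment_moment:
  assumes st: "0 \<le> s" "s \<le> t" "t \<le> T"
  shows "(\<integral>\<^sup>+\<omega>. ennreal (norm (W t \<omega> - W s \<omega>) powr \<beta>) \<partial>P) \<le> ennreal (gauss_const TYPE('n) * (t - s) powr (\<beta> / 2))"
proof (cases "s = t")
  case False
  define d where "d = t - s"
  have d: "0 < d" using st False by (simp add: d_def)
  have [measurable]: "W t \<in> borel_measurable P" "W s \<in> borel_measurable P" using st by (auto intro: W_meas)
  have law: "distr P borel (\<lambda>\<omega>. W t \<omega> - W s \<omega>) = gauss_measure d"
    unfolding d_def using st False by (intro brownian_increment_law[OF bm]) auto
  have g: "norm (norm w powr \<beta>) \<le> d powr (\<beta> / 2) * (1 + norm w / sqrt d)" for w :: "real ^ 'n"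
    using norm_powr_scaled[OF d \<beta>, of w] by simp
  have "(\<integral>\<^sup>+\<omega>. ennreal (norm (W t \<omega> - W s \<omega>) powr \<beta>) \<partial>P) = (\<integral>\<^sup>+w. ennreal (norm w powr \<beta>) \<partial>distr P borel (\<lambda>\<omega>. W t \<omega> - W s \<omega>))"
    by (subst nn_integral_distr) auto
  also have "\<dots> = ennreal (\<integral>w. norm w powr \<beta> \<partial>(gauss_measure d :: (real ^ 'n) measure))"
    unfolding law by (intro nn_integral_eq_integral integrable_gauss_mono(1)[OF d _ g]) auto
  also have "\<dots> \<le> ennreal (d powr (\<beta> / 2) * gauss_const TYPE('n))"
    using integrable_gauss_mono(2)[OF d _ g] by (intro ennreal_leI) auto
  finally show ?thesis by (simp add: d_def mult.commute)
qed simp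

text \<open>
  A measurable bound for the sum of the path errors, written with the integral of nonnegative functions so
  that Tonelli's theorem applies to its mean.
\<close>

definition path_error_nn :: "nat \<Rightarrow> 'w \<Rightarrow> ennreal" where
  "path_error_nn N \<omega> = (\<Sum>i<N. \<integral>\<^sup>+t. indicator (cell N i) t * (ennreal (M t) *
     ennreal (norm (W (grid N (Suc i)) \<omega> - W (clamp_time t) \<omega>) powr \<beta>)) \<partial>lborel)"

lemma path_error_integrand_meas:
  assumes "0 < N" "i < N"
  shows "(\<lambda>p. indicator (cell N i) (snd p) * (ennreal (M (snd p)) *
     ennreal (norm (W (grid N (Suc i)) (fst p) - W (clamp_time (snd p)) (fst p)) powr \<beta>))) \<in> borel_measurable (P \<Otimes>\<^sub>M lborel)"
proof -
  have [measurable]: "W (grid N (Suc i)) \<in> borel_measurable P" using assms by (intro W_meas grid_in) auto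
  have [measurable]: "(\<lambda>p. W (clamp_time (snd p)) (fst p)) \<in> borel_measurable (P \<Otimes>\<^sub>M lborel)"
    using W_jointly_measurable by (simp cong: measurable_cong_sets)
  show ?thesis by measurable
qed

lemma path_error_nn_meas: "0 < N \<Longrightarrow> path_error_nn N \<in> borel_measurable P"
  unfolding path_error_nn_def[abs_def]
  by (intro borel_measurable_sum lborel.borel_measurable_nn_integral) (use path_error_integrand_meas in \<open>simp add: case_prod_beta\<close>)

lemma path_error_nn_mean:
  assumes N: "0 < N"
  shows "(\<integral>\<^sup>+\<omega>. path_error_nn N \<omega> \<partial>P) \<le> ennreal (gauss_const TYPE('n) * (T / real N) powr (\<beta> / 2) * (\<integral>t. M t \<partial>lborel))"
proof -
  define h where "h = T / real N"
  have h: "0 < h" using N T by (simp add: h_def)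
  define c where "c = gauss_const TYPE('n) * h powr (\<beta> / 2)"
  have c: "0 \<le> c" unfolding c_def using less_imp_le[OF gauss_const_pos[where 'n='n]] by simp
  interpret PL: pair_sigma_finite P lborel ..
  define f where "f i p = indicator (cell N i) (snd p) * (ennreal (M (snd p)) *
     ennreal (norm (W (grid N (Suc i)) (fst p) - W (clamp_time (snd p)) (fst p)) powr \<beta>))" for i and p :: "'w \<times> real"
  have fm: "f i \<in> borel_measurable (P \<Otimes>\<^sub>M lborel)" if "i < N" for i
    unfolding f_def[abs_def] by (rule path_error_integrand_meas[OF N that])
  have fm': "(\<lambda>\<omega>. \<integral>\<^sup>+t. f i (\<omega>, t) \<partial>lborel) \<in> borel_measurable P" if "i < N" for i
    by (intro lborel.borel_measurable_nn_integral) (use fm[OF that] in simp)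
  have "(\<integral>\<^sup>+\<omega>. path_error_nn N \<omega> \<partial>P) = (\<integral>\<^sup>+\<omega>. (\<Sum>i<N. \<integral>\<^sup>+t. f i (\<omega>, t) \<partial>lborel) \<partial>P)"
    by (simp add: path_error_nn_def f_def)
  also have "\<dots> = (\<Sum>i<N. \<integral>\<^sup>+\<omega>. \<integral>\<^sup>+t. f i (\<omega>, t) \<partial>lborel \<partial>P)"
    by (intro nn_integral_sum) (use fm' in auto)
  also have "\<dots> = (\<Sum>i<N. \<integral>\<^sup>+t. \<integral>\<^sup>+\<omega>. f i (\<omega>, t) \<partial>P \<partial>lborel)"
    by (intro sum.cong refl PL.Fubini'[symmetric]) (use fm in \<open>auto simp: case_prod_beta\<close>)
  also have "\<dots> \<le> (\<Sum>i<N. \<integral>\<^sup>+t. ennreal (c * (indicator (cell N i) t *\<^sub>R M t)) \<partial>lborel)"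
  proof (intro sum_mono nn_integral_mono)
    fix i t assume "i \<in> {..<N}"
    then have i: "i < N" by simp
    show "(\<integral>\<^sup>+\<omega>. f i (\<omega>, t) \<partial>P) \<le> ennreal (c * (indicator (cell N i) t *\<^sub>R M t))"
    proof (cases "t \<in> cell N i")
      case False
      then show ?thesis by (simp add: f_def)
    next
      case True
      have g: "grid N i \<in> {0..T}" "grid N (Suc i) \<in> {0..T}" using i N by (auto intro!: grid_in simp del: atLeastAtMost_iff)
      have t: "0 \<le> t" "t \<le> grid N (Suc i)" "grid N (Suc i) \<le> T" using True g by (auto simp: cell_grid)
      have tT: "t \<in> {0..T}" using t by auto
      have [measurable]: "W (grid N (Suc i)) \<in> borel_measurable P" "W t \<in> borel_measurable P"
        using g tT by (auto intro!: W_meas simp del: atLeastAtMost_iff)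
      have "(\<integral>\<^sup>+\<omega>. f i (\<omega>, t) \<partial>P) = ennreal (M t) * (\<integral>\<^sup>+\<omega>. ennreal (norm (W (grid N (Suc i)) \<omega> - W t \<omega>) powr \<beta>) \<partial>P)"
        using True tT by (simp add: f_def clamp_time_eq nn_integral_cmult)
      also have "\<dots> \<le> ennreal (M t) * ennreal (gauss_const TYPE('n) * (grid N (Suc i) - t) powr (\<beta> / 2))"
        by (intro mult_left_mono increment_moment t) simp
      also have "\<dots> \<le> ennreal (M t) * ennreal c"
      proof (intro mult_left_mono ennreal_leI)
        have "grid N (Suc i) - t \<le> h" using True unfolding cell_grid by (simp add: grid_def h_def add_divide_distrib algebra_simps)
        then show "gauss_const TYPE('n) * (grid N (Suc i) - t) powr (\<beta> / 2) \<le> c"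
          unfolding c_def using t \<beta> less_imp_le[OF gauss_const_pos[where 'n='n]] by (intro mult_left_mono powr_mono2) auto
      qed simp
      also have "\<dots> = ennreal (c * (indicator (cell N i) t *\<^sub>R M t))"
        using True M_nonneg c by (simp add: ennreal_mult[symmetric] mult.commute)
      finally show ?thesis .
    qed
  qed
  also have "\<dots> = (\<Sum>i<N. ennreal (c * mu N i))"
  proof (intro sum.cong refl)
    fix i
    have "integrable lborel (\<lambda>t. indicator (cell N i) t *\<^sub>R M t)"
      using M_set_integrable[of "cell N i"] by (simp add: set_integrable_def)
    from integrable_mult_right[OF this, of c]
    have "(\<integral>\<^sup>+t. ennreal (c * (indicator (cell N i) t *\<^sub>R M t)) \<partial>lborel) = ennreal (\<integral>t. c * (indicator (cell N i) t *\<^sub>R M t) \<partial>lborel)"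
      using c M_nonneg by (intro nn_integral_eq_integral) auto
    then show "(\<integral>\<^sup>+t. ennreal (c * (indicator (cell N i) t *\<^sub>R M t)) \<partial>lborel) = ennreal (c * mu N i)"
      by (simp add: mu_def set_lebesgue_integral_def)
  qed
  also have "\<dots> = ennreal (c * (\<Sum>i<N. mu N i))"
    using c mu_nonneg by (simp add: sum_distrib_left)
  also have "\<dots> \<le> ennreal (c * (\<integral>t. M t \<partial>lborel))"
    unfolding mu_def using c by (intro ennreal_leI mult_left_mono sum_cells_le[OF N M_integrable] M_nonneg)
  finally show ?thesis by (simp add: c_def h_def)
qed

lemma path_error_le_nn:
  assumes N: "0 < N" and w: "\<omega> \<in> space P"
  shows "ennreal (\<Sum>i<N. path_error N (\<lambda>t. W t \<omega>) i) \<le> path_error_nn N \<omega>"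
proof -
  have pe0: "0 \<le> path_error N (\<lambda>t. W t \<omega>) i" for i
    unfolding path_error_def set_lebesgue_integral_def by (intro integral_nonneg_AE AE_I2) (simp add: M_nonneg)
  have "ennreal (path_error N (\<lambda>t. W t \<omega>) i) \<le> (\<integral>\<^sup>+t. indicator (cell N i) t * (ennreal (M t) *
     ennreal (norm (W (grid N (Suc i)) \<omega> - W (clamp_time t) \<omega>) powr \<beta>)) \<partial>lborel)" (is "_ \<le> ?R") if i: "i < N" for i
  proof -
    define g where "g t = indicator (cell N i) t *\<^sub>R (M t * norm (W (grid N (Suc i)) \<omega> - W (clamp_time t) \<omega>) powr \<beta>)" for t
    have cl: "clamp_time t = t" if "t \<in> cell N i" for t
      using that grid_in[OF N, of i] grid_in[OF N, of "Suc i"] i by (intro clamp_time_eq) (auto simp: cell_grid)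
    have [measurable]: "(\<lambda>t. W (clamp_time t) \<omega>) \<in> borel_measurable borel"
      by (rule borel_measurable_continuous_onI[OF continuous_clamped[OF W_cont[OF w]]])
    have "path_error N (\<lambda>t. W t \<omega>) i = (\<integral>t. g t \<partial>lborel)"
      unfolding path_error_def set_lebesgue_integral_def g_def
      by (intro Bochner_Integration.integral_cong) (auto simp: indicator_def cl)
    also have "\<dots> = enn2real (\<integral>\<^sup>+t. ennreal (g t) \<partial>lborel)"
      unfolding g_def by (intro integral_eq_nn_integral) (auto simp: M_nonneg)
    finally have "ennreal (path_error N (\<lambda>t. W t \<omega>) i) \<le> (\<integral>\<^sup>+t. ennreal (g t) \<partial>lborel)"
      by (simp add: ennreal_enn2real_if)
    also have "\<dots> = ?R"
      by (intro nn_integral_cong) (auto simp: g_def indicator_def M_nonneg ennreal_mult)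
    finally show ?thesis .
  qed
  then have "(\<Sum>i<N. ennreal (path_error N (\<lambda>t. W t \<omega>) i)) \<le> path_error_nn N \<omega>"
    unfolding path_error_nn_def by (intro sum_mono) simp
  then show ?thesis using pe0 by simp
qed

text \<open>
  The mean is of order \<open>N powr (- \<beta> / 2)\<close>; half of the exponent is given up to pass from the mean to almost
  every path along \<open>N = 2 ^ m\<close>.
\<close>

lemma path_error_AE:
  "AE \<omega> in P. \<forall>\<^sub>F m in sequentially. (\<Sum>i<2 ^ m. path_error (2 ^ m) (\<lambda>t. W t \<omega>) i) \<le> real (2 ^ m) powr (- (\<beta> / 4))"
proof -
  define c where "c = gauss_const TYPE('n) * T powr (\<beta> / 2) * (\<integral>t. M t \<partial>lborel)"
  define r where "r = (2::real) powr (- (\<beta> / 4))"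
  have r: "0 < r" "r < 1" using \<beta> powr_less_mono[of "- (\<beta> / 4)" 0 2] by (auto simp: r_def)
  have rp: "real (2 ^ m) powr (- (\<beta> / 4)) = r ^ m" for m
    by (simp add: r_def powr_realpow[symmetric] powr_powr mult.commute)
  have "0 \<le> (\<integral>t. M t \<partial>lborel)" by (intro integral_nonneg_AE AE_I2 M_nonneg)
  then have c: "0 \<le> c" unfolding c_def using less_imp_le[OF gauss_const_pos[where 'n='n]] by simp
  have "AE \<omega> in P. \<forall>\<^sub>F m in sequentially. path_error_nn (2 ^ m) \<omega> \<le> ennreal (r ^ m)"
  proof (rule P.AE_eventually_le[where g = "\<lambda>m. c * r ^ m"])
    show "path_error_nn (2 ^ m) \<in> borel_measurable P" for m by (rule path_error_nn_meas) simp
    show "summable (\<lambda>m. c * r ^ m)" using r by (intro summable_mult summable_geometric) auto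
    show "(\<integral>\<^sup>+\<omega>. path_error_nn (2 ^ m) \<omega> \<partial>P) \<le> ennreal (r ^ m * (c * r ^ m))" for m
    proof -
      have pos: "0 < (2::nat) ^ m" by simp
      have "(T / x) powr (\<beta> / 2) = T powr (\<beta> / 2) * (x powr (- (\<beta> / 4)) * x powr (- (\<beta> / 4)))" if "0 < x" for x
      proof -
        have "- (\<beta> / 4) + - (\<beta> / 4) = - (\<beta> / 2)" by simp
        then show ?thesis unfolding powr_add[symmetric] using T that by (simp add: powr_divide powr_minus_divide)
      qed
      from this[of "real (2 ^ m)"] have "(T / real (2 ^ m)) powr (\<beta> / 2) = T powr (\<beta> / 2) * (r ^ m * r ^ m)"
        unfolding rp by simp
      then have eq: "gauss_const TYPE('n) * (T / real (2 ^ m)) powr (\<beta> / 2) * (\<integral>t. M t \<partial>lborel) = r ^ m * (c * r ^ m)"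
        unfolding c_def by (simp only: mult_ac)
      show ?thesis using path_error_nn_mean[OF pos] unfolding eq .
    qed
  qed (use r c in auto)
  moreover have "AE \<omega> in P. \<omega> \<in> space P" by (rule AE_space)
  ultimately show ?thesis
  proof eventually_elim
    case (elim \<omega>)
    have "(\<Sum>i<2 ^ m. path_error (2 ^ m) (\<lambda>t. W t \<omega>) i) \<le> r ^ m" if "path_error_nn (2 ^ m) \<omega> \<le> ennreal (r ^ m)" for m
      using order_trans[OF path_error_le_nn[of "2 ^ m" \<omega>] that] elim(2) r by (simp add: ennreal_le_iff)
    then show ?case unfolding rp using elim(1) by (auto elim: eventually_mono)
  qed
qed

end

section \<open>Path-by-path uniqueness\<close>

lemma tendsto_pow2_powr: "0 < e \<Longrightarrow> (\<lambda>m. real (2 ^ m) powr (- e)) \<longlonglongrightarrow> 0"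
proof -
  assume e: "0 < e"
  have "2 powr (- e) < (2::real) powr 0" using e by (intro powr_less_mono) auto
  then have "(\<lambda>m. (2 powr (- e)) ^ m) \<longlonglongrightarrow> (0::real)" by (intro LIMSEQ_power_zero) auto
  then show ?thesis by (simp add: powr_realpow[symmetric] powr_powr mult.commute)
qed

context brownian_drift
begin

definition flow_map :: "nat \<Rightarrow> 'w \<Rightarrow> nat \<Rightarrow> nat \<Rightarrow> real ^ 'n \<Rightarrow> real ^ 'n" where
  "flow_map N \<omega> k j = flow (euler_step N) (\<lambda>i. W (grid N (Suc i)) \<omega> - W (grid N i) \<omega>) k j"

lemma flow_map_meas:
  assumes N: "0 < N" and kj: "k + j \<le> N"
  shows "(\<lambda>\<omega>. flow_map N \<omega> k j y) \<in> borel_measurable P"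
  unfolding flow_map_def
proof (rule measurable_flow_random)
  show "euler_step N i \<in> borel_measurable borel" for i
    by (rule borel_measurable_continuous_onI[OF continuous_euler_step[OF N]])
  show "(\<lambda>\<omega>. W (grid N (Suc i)) \<omega> - W (grid N i) \<omega>) \<in> borel_measurable P" if "i \<in> {k..<k + j}" for i
    using that kj N by (intro borel_measurable_diff W_meas grid_in) auto
qed

lemma continuous_flow_map: "0 < N \<Longrightarrow> continuous_on UNIV (flow_map N \<omega> k j)"
  unfolding flow_map_def by (intro continuous_flow continuous_euler_step)

text \<open>
  For \<open>N\<close> steps there are of the order of \<open>N\<^sup>2\<close> flow maps. If the moment exponent is so large that
  \<open>2 * n * \<eta> \<ge> 3\<close>, each map violates the condition with a probability of order \<open>N powr (- 3)\<close>, and the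
  resulting bound \<open>1 / N\<close> is summable along \<open>N = 2 ^ m\<close>.
\<close>

lemma flow_holder_AE:
  assumes \<alpha>: "\<alpha> < 1" and \<eta>: "0 < \<eta>" and R: "1 \<le> R"
  shows "AE \<omega> in P. \<forall>\<^sub>F m in sequentially. \<forall>k j. k + j \<le> 2 ^ m \<longrightarrow>
     lattice_holder (flow_map (2 ^ m) \<omega> k j) R (real (2 ^ m) powr \<eta>) ((1 / 2) powr \<alpha>)"
proof -
  define d where "d = CARD('n)"
  obtain n :: nat where n: "(2 * real d + 1) / (2 * (1 - \<alpha>)) \<le> real n" "3 / (2 * \<eta>) \<le> real n" "1 \<le> n"
  proof -
    obtain n :: nat where "max (max ((2 * real d + 1) / (2 * (1 - \<alpha>))) (3 / (2 * \<eta>))) 1 \<le> real n"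
      using real_arch_simple by blast
    then show ?thesis by (intro that[of n]) auto
  qed
  have n1: "2 * real CARD('n) + 1 \<le> 2 * real n * (1 - \<alpha>)"
    using n(1) \<alpha> by (simp add: divide_le_eq d_def mult_ac)
  have n2: "3 \<le> \<eta> * (2 * real n)" using n(2) \<eta> by (simp add: divide_le_eq mult_ac)
  obtain C N0 where C: "0 \<le> C" and mom: "\<And>N k j x z. N0 \<le> N \<Longrightarrow> k + j \<le> N \<Longrightarrow>
      (\<integral>\<^sup>+\<omega>. ennreal (norm (flow_map N \<omega> k j x - flow_map N \<omega> k j z) ^ (2 * n)) \<partial>P)
      \<le> ennreal (C * norm (x - z) ^ (2 * n))"
    using euler_flow_moment[OF bm n(3)] unfolding flow_map_def grid_def by blast
  define c where "c = 2 * (real (3 * R) ^ (2 * CARD('n)) * (4 * real CARD('n)) ^ (2 * n) * C)"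
  have c: "0 \<le> c" using C by (simp add: c_def)
  define bad where "bad N k j = {\<omega>\<in>space P. \<not> lattice_holder (flow_map N \<omega> k j) R (real N powr \<eta>) ((1 / 2) powr \<alpha>)}" for N k j
  have bad: "bad N k j \<in> sets P" "emeasure P (bad N k j) \<le> ennreal (c / real N ^ 3)"
    if N: "N0 \<le> N" "0 < N" "k + j \<le> N" for N k j
  proof -
    have K: "0 < real N powr \<eta>" using N by simp
    show "bad N k j \<in> sets P"
      unfolding bad_def by (rule P.lattice_holder_prob(1)[OF flow_map_meas[OF N(2,3)] C K R mom[OF N(1,3)] n1])
    have "emeasure P (bad N k j) \<le> ennreal (c / (real N powr \<eta>) ^ (2 * n))"
      unfolding bad_def c_def by (rule P.lattice_holder_prob(2)[OF flow_map_meas[OF N(2,3)] C K R mom[OF N(1,3)] n1])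
    also have "\<dots> \<le> ennreal (c / real N ^ 3)"
    proof (intro ennreal_leI divide_left_mono c)
      have "real N ^ 3 = real N powr 3" using N by (simp add: powr_numeral)
      also have "\<dots> \<le> real N powr (\<eta> * (2 * real n))" using N n2 by (intro powr_mono) auto
      also have "\<dots> = (real N powr \<eta>) ^ (2 * n)" unfolding powr_realpow[OF K, symmetric] powr_powr by simp
      finally show "real N ^ 3 \<le> (real N powr \<eta>) ^ (2 * n)" .
    qed (use N in auto)
    finally show "emeasure P (bad N k j) \<le> ennreal (c / real N ^ 3)" .
  qed
  define idx where "idx N = {p \<in> {..N} \<times> {..N}. fst p + snd p \<le> N}" for N :: nat
  have fin: "finite (idx N)" for N by (rule finite_subset[of _ "{..N} \<times> {..N}"]) (auto simp: idx_def)
  have card: "card (idx N) \<le> (N + 1)\<^sup>2" for N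
  proof -
    have "card (idx N) \<le> card ({..N} \<times> {..N})" by (intro card_mono) (auto simp: idx_def)
    then show ?thesis by (simp add: card_cartesian_product power2_eq_square)
  qed
  define A where "A m = (if N0 \<le> 2 ^ m then (\<Union>p\<in>idx (2 ^ m). bad (2 ^ m) (fst p) (snd p)) else {})" for m
  have large: "\<forall>\<^sub>F m in sequentially. N0 \<le> 2 ^ m"
    by (rule eventually_sequentiallyI[of N0]) (use less_exp in \<open>meson le_trans less_imp_le\<close>)
  have "AE \<omega> in P. \<forall>\<^sub>F m in sequentially. \<omega> \<notin> A m"
  proof (rule P.AE_eventually_not_in)
    show "A m \<in> sets P" for m
      unfolding A_def using fin by (auto intro!: sets.finite_UN bad(1) simp: idx_def)
    show "summable (\<lambda>m. 4 * c * (1 / 2) ^ m)" by (intro summable_mult summable_geometric) auto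
    show "0 \<le> 4 * c * (1 / 2) ^ m" for m using c by simp
    show "emeasure P (A m) \<le> ennreal (4 * c * (1 / 2) ^ m)" for m
    proof (cases "N0 \<le> 2 ^ m")
      case True
      define N :: nat where "N = 2 ^ m"
      have N: "N0 \<le> N" "0 < N" "1 \<le> real N" using True by (auto simp: N_def)
      have "emeasure P (A m) \<le> (\<Sum>p\<in>idx N. emeasure P (bad N (fst p) (snd p)))"
        unfolding A_def N_def[symmetric] using N fin
        by (simp, intro emeasure_subadditive_finite) (auto simp: idx_def intro!: bad(1))
      also have "\<dots> \<le> (\<Sum>p\<in>idx N. ennreal (c / real N ^ 3))"
        using N by (intro sum_mono bad(2)) (auto simp: idx_def)
      also have "\<dots> = ennreal (real (card (idx N)) * (c / real N ^ 3))"
        unfolding sum_constant ennreal_of_nat_eq_real_of_nat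
        by (rule ennreal_mult[symmetric]) (use c in auto)
      also have "\<dots> \<le> ennreal (4 * c * (1 / 2) ^ m)"
      proof (rule ennreal_leI)
        have "real (card (idx N)) \<le> real ((N + 1)\<^sup>2)" by (rule of_nat_mono[OF card])
        also have "\<dots> = (real N + 1)\<^sup>2" by simp
        also have "\<dots> \<le> (2 * real N)\<^sup>2" using N by (intro power_mono) auto
        finally have "real (card (idx N)) * (c / real N ^ 3) \<le> (2 * real N)\<^sup>2 * (c / real N ^ 3)"
          using c by (intro mult_right_mono) auto
        also have "\<dots> = 4 * c * (1 / real N)" using N by (simp add: power2_eq_square power3_eq_cube)
        also have "1 / real N = (1 / 2) ^ m" by (simp add: N_def power_one_over)
        finally show "real (card (idx N)) * (c / real N ^ 3) \<le> 4 * c * (1 / 2) ^ m" .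
      qed
      finally show ?thesis .
    qed (simp add: A_def)
  qed
  moreover have "AE \<omega> in P. \<omega> \<in> space P" by (rule AE_space)
  ultimately show ?thesis
  proof eventually_elim
    case (elim \<omega>)
    note w = elim(2)
    from elim(1) large show ?case
    proof eventually_elim
      case (elim m)
      show ?case
      proof (intro allI impI)
        fix k j :: nat assume "k + j \<le> 2 ^ m"
        then have "(k, j) \<in> idx (2 ^ m)" by (auto simp: idx_def)
        with elim have "\<omega> \<notin> bad (2 ^ m) k j" by (auto simp: A_def)
        with w show "lattice_holder (flow_map (2 ^ m) \<omega> k j) R (real (2 ^ m) powr \<eta>) ((1 / 2) powr \<alpha>)"
          by (simp add: bad_def)
      qed
    qed
  qed
qed

definition rate_const :: real where
  "rate_const = 1 + error_const * T powr (\<beta> / 2) * (\<integral>t. M t \<partial>lborel)"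

lemma M_integral_nonneg: "0 \<le> (\<integral>t. M t \<partial>lborel)"
  by (intro integral_nonneg_AE AE_I2 M_nonneg)

lemma error_const_nonneg: "0 \<le> error_const"
  unfolding error_const_def using less_imp_le[OF gauss_const_pos[where 'n='n]] by simp

lemma rate_const_ge_1: "1 \<le> rate_const"
  unfolding rate_const_def using M_integral_nonneg error_const_nonneg by simp

text \<open>
  The exponents are chosen such that the growth \<open>N powr (\<beta> / 16)\<close> of the Hoelder constants and the loss
  \<open>N powr (2 * (1 - \<alpha>)) = N powr (\<beta> / 16)\<close> in \<open>powr_split_le\<close> leave half of the decay \<open>N powr (- \<beta> / 4)\<close> of
  the sum of the local errors.
\<close>

lemma grid_error:
  assumes w: "\<omega> \<in> space P" and sol: "solution x (\<lambda>t. W t \<omega>) Y" and N: "0 < N"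
    and pe: "(\<Sum>i<N. path_error N (\<lambda>t. W t \<omega>) i) \<le> real N powr (- (\<beta> / 4))"
    and lh: "\<And>k j. k + j \<le> N \<Longrightarrow> lattice_holder (flow_map N \<omega> k j) R (real N powr (\<beta> / 16)) ((1 / 2) powr (1 - \<beta> / 32))"
    and R: "\<And>t. t \<in> {0..T} \<Longrightarrow> norm (Y t) \<le> real R - 2"
    and big: "rate_const * real N powr (- (\<beta> / 4)) \<le> 1" and l: "l \<le> N"
  shows "norm (Y (grid N l) - flow_map N \<omega> 0 l x) \<le> 14 * (rate_const + 1) * real N powr (- (\<beta> / 8))"
proof -
  define \<alpha> where "\<alpha> = 1 - \<beta> / 32"
  have \<alpha>: "1 / 2 \<le> \<alpha>" "\<alpha> \<le> 1" "0 < \<alpha>" using \<beta> by (auto simp: \<alpha>_def)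
  define K where "K = real N powr (\<beta> / 16)"
  have K: "0 \<le> K" by (simp add: K_def)
  have N1: "1 \<le> real N" using N by simp
  define y where "y k = Y (grid N k)" for k
  define \<Delta> where "\<Delta> i = W (grid N (Suc i)) \<omega> - W (grid N i) \<omega>" for i
  define e where "e k = norm (y (Suc k) - euler_step N k (y k + \<Delta> k))" for k
  have le: "e k \<le> path_error N (\<lambda>t. W t \<omega>) k + error_const * (T / real N) powr (\<beta> / 2) * mu N k" if "k < N" for k
    unfolding e_def y_def \<Delta>_def by (rule local_error[OF sol W_cont[OF w] N that])
  have sum_e: "(\<Sum>k<N. e k) \<le> rate_const * real N powr (- (\<beta> / 4))"
  proof -
    have "(\<Sum>k<N. e k) \<le> (\<Sum>k<N. path_error N (\<lambda>t. W t \<omega>) k) + error_const * (T / real N) powr (\<beta> / 2) * (\<Sum>k<N. mu N k)"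
      using sum_mono[of "{..<N}" e, OF le] by (simp add: sum.distrib sum_distrib_left)
    also have "\<dots> \<le> real N powr (- (\<beta> / 4)) + error_const * (T powr (\<beta> / 2) * real N powr (- (\<beta> / 4))) * (\<integral>t. M t \<partial>lborel)"
    proof (intro add_mono pe mult_mono mult_left_mono)
      have "(T / real N) powr (\<beta> / 2) = T powr (\<beta> / 2) * real N powr (- (\<beta> / 2))"
        using T N by (simp add: powr_divide powr_minus_divide)
      also have "\<dots> \<le> T powr (\<beta> / 2) * real N powr (- (\<beta> / 4))"
        using N1 \<beta> by (intro mult_left_mono powr_mono) auto
      finally show "(T / real N) powr (\<beta> / 2) \<le> T powr (\<beta> / 2) * real N powr (- (\<beta> / 4))" .
      show "(\<Sum>k<N. mu N k) \<le> (\<integral>t. M t \<partial>lborel)"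
        unfolding mu_def by (rule sum_cells_le[OF N M_integrable M_nonneg])
    qed (use error_const_nonneg mu_nonneg in \<open>auto intro!: sum_nonneg mult_nonneg_nonneg\<close>)
    also have "\<dots> = rate_const * real N powr (- (\<beta> / 4))" by (simp add: rate_const_def algebra_simps)
    finally show ?thesis .
  qed
  have e0: "0 \<le> e k" for k by (simp add: e_def)
  have e1: "e k \<le> 1" if "k < N" for k
  proof -
    have "e k \<le> (\<Sum>k<N. e k)" using that by (intro member_le_sum e0) auto
    then show ?thesis using sum_e big by simp
  qed
  have term_le: "norm (flow_map N \<omega> (Suc k) (l - Suc k) (y (Suc k)) - flow_map N \<omega> (Suc k) (l - Suc k) (euler_step N k (y k + \<Delta> k)))
      \<le> 14 * K * (e k powr \<alpha>)" if k: "k < l" for k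
    unfolding e_def
  proof (rule chaining[OF continuous_flow_map[OF N] _ \<alpha>(1,2) K])
    have kN: "k < N" using k l by simp
    show "lattice_holder (flow_map N \<omega> (Suc k) (l - Suc k)) R K ((1 / 2) powr \<alpha>)"
      unfolding K_def \<alpha>_def using k l by (intro lh) auto
    have yR: "norm (y (Suc k)) \<le> real R - 2" unfolding y_def using kN N by (intro R grid_in) auto
    then show "norm (y (Suc k)) \<le> real R - 1" by simp
    show d: "norm (y (Suc k) - euler_step N k (y k + \<Delta> k)) \<le> 1" using e1[OF kN] by (simp add: e_def)
    have "norm (euler_step N k (y k + \<Delta> k)) \<le> norm (y (Suc k)) + norm (y (Suc k) - euler_step N k (y k + \<Delta> k))"
      by (metis norm_minus_commute norm_triangle_sub)
    then show "norm (euler_step N k (y k + \<Delta> k)) \<le> real R - 1" using yR d by linarith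
  qed
  have y0: "y 0 = x"
  proof -
    have "Y 0 = x + W 0 \<omega> + (LINT s:{0..0}|lborel. b (s, Y s))"
      using sol T unfolding solution_def by auto
    moreover have "(LINT s:{0..0}|lborel. b (s, Y s)) = 0"
      unfolding set_lebesgue_integral_def
      by (intro integral_eq_zero_AE) (use AE_lborel_singleton[of "0::real"] in \<open>auto elim: eventually_mono\<close>)
    ultimately show ?thesis using W_zero[OF w] by (simp add: y_def grid_def)
  qed
  have "norm (Y (grid N l) - flow_map N \<omega> 0 l x)
      \<le> (\<Sum>k<l. norm (flow_map N \<omega> (Suc k) (l - Suc k) (y (Suc k)) - flow_map N \<omega> (Suc k) (l - Suc k) (euler_step N k (y k + \<Delta> k))))"
    using flow_telescope[of y l "euler_step N" \<Delta>] unfolding flow_map_def y0 \<Delta>_def y_def[symmetric] .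
  also have "\<dots> \<le> (\<Sum>k<l. 14 * K * (e k powr \<alpha>))" by (intro sum_mono term_le) simp
  also have "\<dots> \<le> (\<Sum>k<N. 14 * K * (e k powr \<alpha>))" using l K by (intro sum_mono2) auto
  also have "\<dots> \<le> (\<Sum>k<N. 14 * K * (real N powr (2 * (1 - \<alpha>)) * e k + real N powr (- (2 * \<alpha>))))"
    using K N \<alpha> e0 by (intro sum_mono mult_left_mono powr_split_le) auto
  also have "\<dots> = 14 * K * (real N powr (2 * (1 - \<alpha>)) * (\<Sum>k<N. e k) + real N * real N powr (- (2 * \<alpha>)))"
    by (simp add: sum.distrib sum_distrib_left[symmetric])
  also have "\<dots> \<le> 14 * K * (real N powr (2 * (1 - \<alpha>)) * (rate_const * real N powr (- (\<beta> / 4))) + real N * real N powr (- (2 * \<alpha>)))"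
    using K by (intro mult_left_mono add_mono sum_e) auto
  also have "\<dots> = 14 * (rate_const * (real N powr (\<beta> / 16) * (real N powr (2 * (1 - \<alpha>)) * real N powr (- (\<beta> / 4))))
      + real N powr (\<beta> / 16) * (real N powr 1 * real N powr (- (2 * \<alpha>))))"
    using N by (simp add: K_def algebra_simps)
  also have "real N powr (\<beta> / 16) * (real N powr (2 * (1 - \<alpha>)) * real N powr (- (\<beta> / 4))) = real N powr (- (\<beta> / 8))"
    unfolding powr_add[symmetric] by (simp add: \<alpha>_def)
  also have "real N powr (\<beta> / 16) * (real N powr 1 * real N powr (- (2 * \<alpha>))) = real N powr (\<beta> / 8 - 1)"
    unfolding powr_add[symmetric] by (simp add: \<alpha>_def)
  also have "14 * (rate_const * real N powr (- (\<beta> / 8)) + real N powr (\<beta> / 8 - 1))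
      \<le> 14 * (rate_const * real N powr (- (\<beta> / 8)) + real N powr (- (\<beta> / 8)))"
    using N1 \<beta> rate_const_ge_1 by (intro mult_left_mono add_mono powr_mono) auto
  also have "\<dots> = 14 * (rate_const + 1) * real N powr (- (\<beta> / 8))" by (simp add: algebra_simps)
  finally show ?thesis .
qed

lemma grid_floor_tendsto:
  assumes t: "t \<in> {0..T}"
  obtains l where "\<And>m. l m \<le> 2 ^ m" "(\<lambda>m. grid (2 ^ m) (l m)) \<longlonglongrightarrow> t"
proof -
  define l where "l m = nat \<lfloor>t * 2 ^ m / T\<rfloor>" for m :: nat
  have l0: "real (l m) = real_of_int \<lfloor>t * 2 ^ m / T\<rfloor>" for m
    using t T by (simp add: l_def)
  have le: "l m \<le> 2 ^ m" for m
  proof -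
    have "t * 2 ^ m / T \<le> 2 ^ m" using t T by (simp add: divide_le_eq)
    then have "real (l m) \<le> real (2 ^ m)" unfolding l0 by (metis of_int_floor_le of_nat_numeral of_nat_power order_trans)
    then show ?thesis by (simp only: of_nat_le_iff)
  qed
  have "(\<lambda>m. grid (2 ^ m) (l m)) \<longlonglongrightarrow> t"
  proof (rule LIM_zero_cancel, rule Lim_null_comparison)
    show "\<forall>\<^sub>F m in sequentially. norm (grid (2 ^ m) (l m) - t) \<le> T * (1 / 2) ^ m"
    proof (intro always_eventually allI)
      fix m :: nat
      have "\<bar>real (l m) - t * 2 ^ m / T\<bar> \<le> 1" unfolding l0 by linarith
      then have "\<bar>real (l m) - t * 2 ^ m / T\<bar> * (T / 2 ^ m) \<le> 1 * (T / 2 ^ m)"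
        using T by (intro mult_right_mono) auto
      moreover have "grid (2 ^ m) (l m) - t = (real (l m) - t * 2 ^ m / T) * (T / 2 ^ m)"
        using T by (simp add: grid_def field_simps)
      ultimately show "norm (grid (2 ^ m) (l m) - t) \<le> T * (1 / 2) ^ m"
        using T by (simp add: abs_mult power_one_over)
    qed
    show "(\<lambda>m. T * (1 / 2) ^ m) \<longlonglongrightarrow> 0"
      using tendsto_mult[OF tendsto_const[of T] LIMSEQ_power_zero[of "1 / 2 :: real"]] by simp
  qed
  with le show ?thesis by (rule that)
qed

text \<open>
  At the grid times both solutions are close to the same Euler scheme. The exceptional null set depends on
  neither the solutions nor their starting point; countably many radii \<open>R\<close> cover all bounded paths.
\<close>

lemma solutions_unique_AE:
  "AE \<omega> in P. \<forall>x Y Y'. solution x (\<lambda>t. W t \<omega>) Y \<longrightarrow> solution x (\<lambda>t. W t \<omega>) Y' \<longrightarrow> (\<forall>t\<in>{0..T}. Y t = Y' t)"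
proof -
  have "AE \<omega> in P. \<forall>R::nat. \<forall>\<^sub>F m in sequentially. \<forall>k j. k + j \<le> 2 ^ m \<longrightarrow>
     lattice_holder (flow_map (2 ^ m) \<omega> k j) (Suc R) (real (2 ^ m) powr (\<beta> / 16)) ((1 / 2) powr (1 - \<beta> / 32))"
    unfolding AE_all_countable using \<beta> by (intro allI flow_holder_AE) auto
  moreover note path_error_AE
  moreover have "AE \<omega> in P. \<omega> \<in> space P" by (rule AE_space)
  ultimately show ?thesis
  proof eventually_elim
    case (elim \<omega>)
    show ?case
    proof (intro allI impI ballI)
      fix x Y Y' t
      assume sol: "solution x (\<lambda>t. W t \<omega>) Y" "solution x (\<lambda>t. W t \<omega>) Y'" and t: "t \<in> {0..T}"
      have cont: "continuous_on {0..T} Y" "continuous_on {0..T} Y'" using sol by (auto simp: solution_def)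
      have "bounded (Y ` {0..T})" "bounded (Y' ` {0..T})"
        using cont by (auto intro!: compact_imp_bounded compact_continuous_image)
      then obtain B B' where B: "\<And>s. s \<in> {0..T} \<Longrightarrow> norm (Y s) \<le> B" "\<And>s. s \<in> {0..T} \<Longrightarrow> norm (Y' s) \<le> B'"
        unfolding bounded_iff by (metis image_eqI)
      obtain R :: nat where R: "max B B' + 2 \<le> real R" using real_arch_simple by blast
      have YR: "norm (Y s) \<le> real (Suc R) - 2" "norm (Y' s) \<le> real (Suc R) - 2" if "s \<in> {0..T}" for s
        using B(1)[OF that] B(2)[OF that] R by auto
      obtain l where l: "\<And>m. l m \<le> 2 ^ m" "(\<lambda>m. grid (2 ^ m) (l m)) \<longlonglongrightarrow> t"
        using grid_floor_tendsto[OF t] by blast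
      have gin: "grid (2 ^ m) (l m) \<in> {0..T}" for m by (rule grid_in) (use l in auto)
      have "(\<lambda>m. rate_const * real (2 ^ m) powr (- (\<beta> / 4))) \<longlonglongrightarrow> rate_const * 0"
        using \<beta> by (intro tendsto_mult tendsto_const tendsto_pow2_powr) auto
      then have big: "\<forall>\<^sub>F m in sequentially. rate_const * real (2 ^ m) powr (- (\<beta> / 4)) < 1"
        by (rule order_tendstoD) simp
      have "\<forall>\<^sub>F m in sequentially. norm (Y (grid (2 ^ m) (l m)) - Y' (grid (2 ^ m) (l m)))
          \<le> 28 * (rate_const + 1) * real (2 ^ m) powr (- (\<beta> / 8))"
        using elim(1)[rule_format, of R] elim(2) big
      proof eventually_elim
        case (elim m)
        have N: "0 < (2::nat) ^ m" by simp
        define f where "f = flow_map (2 ^ m) \<omega> 0 (l m) x"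
        have "norm (Y (grid (2 ^ m) (l m)) - f) \<le> 14 * (rate_const + 1) * real (2 ^ m) powr (- (\<beta> / 8))"
          unfolding f_def using elim
          by (intro grid_error[OF \<open>\<omega> \<in> space P\<close> sol(1) N _ _ YR(1) _ l(1)]) auto
        moreover have "norm (Y' (grid (2 ^ m) (l m)) - f) \<le> 14 * (rate_const + 1) * real (2 ^ m) powr (- (\<beta> / 8))"
          unfolding f_def using elim
          by (intro grid_error[OF \<open>\<omega> \<in> space P\<close> sol(2) N _ _ YR(2) _ l(1)]) auto
        moreover have "norm (Y (grid (2 ^ m) (l m)) - Y' (grid (2 ^ m) (l m)))
            \<le> norm (Y (grid (2 ^ m) (l m)) - f) + norm (Y' (grid (2 ^ m) (l m)) - f)"
          using norm_triangle_ineq4[of "Y (grid (2 ^ m) (l m)) - f" "Y' (grid (2 ^ m) (l m)) - f"] by simp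
        ultimately show ?case by linarith
      qed
      moreover have "(\<lambda>m. 28 * (rate_const + 1) * real (2 ^ m) powr (- (\<beta> / 8))) \<longlonglongrightarrow> 28 * (rate_const + 1) * 0"
        using \<beta> by (intro tendsto_mult tendsto_const tendsto_pow2_powr) auto
      then have "(\<lambda>m. 28 * (rate_const + 1) * real (2 ^ m) powr (- (\<beta> / 8))) \<longlonglongrightarrow> 0"
        by (simp only: mult_zero_right)
      ultimately have lim0: "(\<lambda>m. Y (grid (2 ^ m) (l m)) - Y' (grid (2 ^ m) (l m))) \<longlonglongrightarrow> 0"
        by (rule Lim_null_comparison)
      have ev: "\<forall>\<^sub>F m in sequentially. grid (2 ^ m) (l m) \<in> {0..T}"
        by (intro always_eventually allI gin)
      have "(\<lambda>m. Y (grid (2 ^ m) (l m)) - Y' (grid (2 ^ m) (l m))) \<longlonglongrightarrow> Y t - Y' t"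
        by (rule tendsto_diff[OF continuous_on_tendsto_compose[OF cont(1) l(2) t ev] continuous_on_tendsto_compose[OF cont(2) l(2) t ev]])
      from this lim0 have "Y t - Y' t = 0" by (rule LIMSEQ_unique)
      then show "Y t = Y' t" by simp
    qed
  qed
qed

end

section \<open>Existence along a fixed path\<close>

context rough_drift
begin

text \<open>
  The Euler scheme along a given path in which the drift of a cell is evaluated at the left end point.
\<close>

primrec frozen :: "nat \<Rightarrow> (real \<Rightarrow> real ^ 'n) \<Rightarrow> real ^ 'n \<Rightarrow> nat \<Rightarrow> real ^ 'n" where
  "frozen N w x 0 = x + w 0"
| "frozen N w x (Suc i) = frozen N w x i + (w (grid N (Suc i)) - w (grid N i)) + cell_drift N i (frozen N w x i)"

text \<open>
  The index of the cell that contains \<open>t\<close>; at \<open>t = 0\<close>, which belongs to no cell, truncation gives \<open>0\<close>.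
\<close>

definition cell_index :: "nat \<Rightarrow> real \<Rightarrow> nat" where
  "cell_index N t = nat (\<lceil>t * real N / T\<rceil> - 1)"

text \<open>
  The drift part of the scheme as a continuous function of time, see \<open>frozen_eq\<close>.
\<close>

definition frozen_drift :: "nat \<Rightarrow> (real \<Rightarrow> real ^ 'n) \<Rightarrow> real ^ 'n \<Rightarrow> real \<Rightarrow> real ^ 'n" where
  "frozen_drift N w x t = (LINT s:{0..t}|lborel. b (s, frozen N w x (cell_index N s)))"

lemma cell_index_meas [measurable]: "cell_index N \<in> measurable borel (count_space UNIV)"
  unfolding cell_index_def[abs_def] by measurable

lemma frozen_meas: "(\<lambda>s. frozen N w x (cell_index N s)) \<in> borel_measurable borel"
  by (rule measurable_compose[OF cell_index_meas]) simp

lemma cell_index_eq: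
  assumes N: "0 < N" and t: "t \<in> cell N i"
  shows "cell_index N t = i"
proof -
  have "real i < t * real N / T" "t * real N / T \<le> real (Suc i)"
    using t N T unfolding cell_def by (auto simp: field_simps)
  then have "\<lceil>t * real N / T\<rceil> = int i + 1" by (intro ceiling_unique) auto
  then show ?thesis by (simp add: cell_index_def)
qed

lemma in_cell_index:
  assumes N: "0 < N" and t: "0 < t"
  shows "t \<in> cell N (cell_index N t)"
proof -
  define c where "c = \<lceil>t * real N / T\<rceil>"
  have pos: "0 < t * real N / T" using N t T by simp
  then have "0 < c" by (simp add: c_def)
  then have i: "real (cell_index N t) = real_of_int c - 1" "real (Suc (cell_index N t)) = real_of_int c"
    by (simp_all add: cell_index_def c_def[symmetric])
  have "real_of_int c - 1 < t * real N / T" "t * real N / T \<le> real_of_int c"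
    unfolding c_def by linarith+
  then have "(real_of_int c - 1) * (T / real N) < t" "t \<le> real_of_int c * (T / real N)"
    using N T by (auto simp: field_simps)
  then show ?thesis unfolding cell_def i by simp
qed

lemma frozen_eq:
  assumes N: "0 < N"
  shows "frozen N w x i = x + w (grid N i) + frozen_drift N w x (grid N i)"
proof (induction i)
  case 0
  have "(LINT s:{0..0}|lborel. b (s, frozen N w x (cell_index N s))) = 0"
    unfolding set_lebesgue_integral_def
    by (intro integral_eq_zero_AE) (use AE_lborel_singleton[of "0::real"] in \<open>auto elim: eventually_mono\<close>)
  then show ?case by (simp add: grid_def frozen_drift_def)
next
  case (Suc i)
  have g: "0 \<le> grid N i" "grid N i \<le> grid N (Suc i)" using T by (auto simp: grid_def intro: grid_mono) (auto intro!: divide_right_mono)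
  have "frozen_drift N w x (grid N (Suc i)) = frozen_drift N w x (grid N i) + (LINT s:cell N i|lborel. b (s, frozen N w x (cell_index N s)))"
    unfolding frozen_drift_def cell_grid by (rule set_integral_split[OF frozen_meas g])
  also have "(LINT s:cell N i|lborel. b (s, frozen N w x (cell_index N s))) = cell_drift N i (frozen N w x i)"
    unfolding cell_drift_def by (intro set_lebesgue_integral_cong) (auto simp: cell_index_eq[OF N])
  finally show ?case using Suc by (simp add: algebra_simps)
qed

lemma frozen_drift_diff:
  assumes st: "0 \<le> s" "s \<le> t"
  shows "norm (frozen_drift N w x t - frozen_drift N w x s) \<le> sqrt ((\<integral>t. (M t)\<^sup>2 \<partial>lborel) * (t - s))"
proof -
  have "frozen_drift N w x t - frozen_drift N w x s = (LINT r:{s<..t}|lborel. b (r, frozen N w x (cell_index N r)))"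
    unfolding frozen_drift_def set_integral_split[OF frozen_meas st] by simp
  also have "norm \<dots> \<le> (LINT r:{s<..t}|lborel. M r)" by (rule norm_set_integral_b_le[OF frozen_meas]) simp
  also have "\<dots> \<le> sqrt ((\<integral>t. (M t)\<^sup>2 \<partial>lborel) * (t - s))" by (rule M_interval_le_sqrt[OF st(2)])
  finally show ?thesis .
qed

text \<open>
  By the Cauchy-Schwarz bound \<open>M_interval_le_sqrt\<close> the drift parts are bounded and equicontinuous, so that
  a subsequence converges uniformly. The drift is continuous in space, and dominated convergence
  identifies the limit.
\<close>

lemma solution_exists:
  assumes w: "continuous_on {0..T} w"
  shows "\<exists>Y. solution x w Y"
proof -
  define m2 where "m2 = (\<integral>t. (M t)\<^sup>2 \<partial>lborel)"
  have m2: "0 \<le> m2" unfolding m2_def by (intro integral_nonneg_AE AE_I2) simp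
  define G where "G n = frozen_drift (Suc n) w x" for n
  have diff: "norm (G n t - G n s) \<le> sqrt (m2 * \<bar>t - s\<bar>)" if "0 \<le> s" "0 \<le> t" for n s t
  proof (cases "s \<le> t")
    case True
    then show ?thesis using frozen_drift_diff[of s t "Suc n" w x] that by (simp add: G_def m2_def)
  next
    case False
    then show ?thesis using frozen_drift_diff[of t s "Suc n" w x] that by (simp add: G_def m2_def norm_minus_commute)
  qed
  have G0: "G n 0 = 0" for n
    unfolding G_def frozen_drift_def set_lebesgue_integral_def
    by (intro integral_eq_zero_AE) (use AE_lborel_singleton[of "0::real"] in \<open>auto elim: eventually_mono\<close>)
  have bound: "norm (G n t) \<le> sqrt (m2 * T)" if "t \<in> {0..T}" for n t
  proof -
    have "norm (G n t) \<le> sqrt (m2 * \<bar>t - 0\<bar>)" using diff[of 0 t n] that by (simp add: G0)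
    also have "\<dots> \<le> sqrt (m2 * T)" using that m2 by (auto intro!: mult_left_mono)
    finally show ?thesis .
  qed
  have equi: "\<exists>d. 0 < d \<and> (\<forall>n s. s \<in> {0..T} \<and> norm (t - s) < d \<longrightarrow> norm (G n t - G n s) < e)"
    if "t \<in> {0..T}" "0 < e" for t e
  proof (intro exI conjI allI impI)
    show "0 < e\<^sup>2 / (m2 + 1)" using that m2 by simp
    fix n s assume s: "s \<in> {0..T} \<and> norm (t - s) < e\<^sup>2 / (m2 + 1)"
    have "norm (G n t - G n s) \<le> sqrt (m2 * \<bar>t - s\<bar>)" using s that by (intro diff) auto
    also have "\<dots> < e"
    proof (rule real_less_lsqrt)
      have "m2 * \<bar>t - s\<bar> \<le> (m2 + 1) * \<bar>t - s\<bar>" by (intro mult_right_mono) auto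
      also have "\<dots> < e\<^sup>2" using s m2 by (simp add: field_simps)
      finally show "m2 * \<bar>t - s\<bar> < e\<^sup>2" .
    qed (use that m2 in auto)
    finally show "norm (G n t - G n s) < e" .
  qed
  obtain g k where g: "continuous_on {0..T} g" and k: "strict_mono (k :: nat \<Rightarrow> nat)"
    and unif: "\<And>e. 0 < e \<Longrightarrow> \<exists>n0. \<forall>n t. n \<ge> n0 \<and> t \<in> {0..T} \<longrightarrow> norm (G (k n) t - g t) < e"
    by (rule Arzela_Ascoli[of "{0..T}" G "sqrt (m2 * T)"]) (use bound equi in auto)
  define X where "X t = x + w t + g t" for t
  have X: "continuous_on {0..T} X" unfolding X_def by (intro continuous_intros w g)
  define Z where "Z n s = frozen (Suc (k n)) w x (cell_index (Suc (k n)) s)" for n s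
  have Zlim: "(\<lambda>n. Z n s) \<longlonglongrightarrow> X s" if s: "s \<in> {0..T}" "s \<noteq> 0" for s
  proof -
    have s0: "0 < s" using s by auto
    define a where "a n = grid (Suc (k n)) (cell_index (Suc (k n)) s)" for n
    have cells: "a n < s" "s \<le> a n + T / real (Suc (k n))" "0 \<le> a n" for n
      using in_cell_index[of "Suc (k n)" s] s0 T unfolding cell_eq grid_def a_def by (auto simp del: of_nat_Suc)
    have aT: "a n \<in> {0..T}" for n using cells[of n] s by auto
    have alim: "a \<longlonglongrightarrow> s"
    proof (rule LIM_zero_cancel, rule Lim_null_comparison)
      show "\<forall>\<^sub>F n in sequentially. norm (a n - s) \<le> T * inverse (real (Suc (k n)))"
        using cells by (intro always_eventually allI) (smt (verit) divide_inverse real_norm_def)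
      have "(\<lambda>n. T * inverse (real (Suc n))) \<longlonglongrightarrow> T * 0"
        by (intro tendsto_mult tendsto_const LIMSEQ_inverse_real_of_nat)
      from LIMSEQ_subseq_LIMSEQ[OF this k] show "(\<lambda>n. T * inverse (real (Suc (k n)))) \<longlonglongrightarrow> 0" by (simp add: o_def)
    qed
    have ev: "\<forall>\<^sub>F n in sequentially. a n \<in> {0..T}" by (intro always_eventually allI aT)
    have "(\<lambda>n. G (k n) (a n) - g (a n)) \<longlonglongrightarrow> 0"
    proof (rule LIMSEQ_I)
      fix e :: real assume "0 < e"
      then obtain n0 where "\<forall>n t. n \<ge> n0 \<and> t \<in> {0..T} \<longrightarrow> norm (G (k n) t - g t) < e" using unif by blast
      then show "\<exists>n0. \<forall>n\<ge>n0. norm (G (k n) (a n) - g (a n) - 0) < e" using aT by (intro exI[of _ n0]) auto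
    qed
    then have "(\<lambda>n. X (a n) + (G (k n) (a n) - g (a n))) \<longlonglongrightarrow> X s + 0"
      by (intro tendsto_add continuous_on_tendsto_compose[OF X alim s(1) ev])
    moreover have "Z n s = X (a n) + (G (k n) (a n) - g (a n))" for n
      unfolding Z_def frozen_eq[OF zero_less_Suc] by (simp add: X_def a_def G_def)
    ultimately show ?thesis by simp
  qed
  define Xc where "Xc = (\<lambda>t. X (clamp_time t))"
  have Xc: "Xc \<in> borel_measurable borel" unfolding Xc_def by (intro borel_measurable_continuous_onI continuous_clamped X)
  have Zm: "Z n \<in> borel_measurable borel" for n unfolding Z_def by (rule frozen_meas)
  have "g t = (LINT s:{0..t}|lborel. b (s, X s))" if t: "t \<in> {0..T}" for t
  proof -
    have "(\<lambda>n. \<integral>s. indicator {0..t} s *\<^sub>R b (s, Z n s) \<partial>lborel) \<longlonglongrightarrow> (\<integral>s. indicator {0..t} s *\<^sub>R b (s, Xc s) \<partial>lborel)"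
    proof (rule integral_dominated_convergence[OF _ _ M_integrable])
      show "(\<lambda>s. indicator {0..t} s *\<^sub>R b (s, Xc s)) \<in> borel_measurable lborel"
        using b_set_integrable[OF Xc, of "{0..t}"] unfolding set_integrable_def by auto
      show "(\<lambda>s. indicator {0..t} s *\<^sub>R b (s, Z n s)) \<in> borel_measurable lborel" for n
        using b_set_integrable[OF Zm, of "{0..t}"] unfolding set_integrable_def by auto
      show "AE s in lborel. norm (indicator {0..t} s *\<^sub>R b (s, Z n s)) \<le> M s" for n
        by (intro AE_I2) (auto simp: indicator_def b_bound M_nonneg)
      show "AE s in lborel. (\<lambda>n. indicator {0..t} s *\<^sub>R b (s, Z n s)) \<longlonglongrightarrow> indicator {0..t} s *\<^sub>R b (s, Xc s)"
        using AE_lborel_singleton[of "0::real"]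
      proof eventually_elim
        case (elim s)
        show ?case
        proof (cases "s \<in> {0..t}")
          case True
          then have sT: "s \<in> {0..T}" using t by auto
          have "(\<lambda>n. b (s, Z n s) - b (s, X s)) \<longlonglongrightarrow> 0"
          proof (rule Lim_null_comparison)
            show "\<forall>\<^sub>F n in sequentially. norm (b (s, Z n s) - b (s, X s)) \<le> M s * norm (Z n s - X s) powr \<beta>"
              by (intro always_eventually allI b_holder)
            have "(\<lambda>n. norm (Z n s - X s)) \<longlonglongrightarrow> 0"
              using Zlim[OF sT elim] by (simp add: tendsto_norm_zero LIM_zero)
            then have "(\<lambda>n. M s * norm (Z n s - X s) powr \<beta>) \<longlonglongrightarrow> M s * 0 powr \<beta>"
              using \<beta> by (intro tendsto_mult tendsto_const tendsto_powr') auto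
            then show "(\<lambda>n. M s * norm (Z n s - X s) powr \<beta>) \<longlonglongrightarrow> 0" by simp
          qed
          then have "(\<lambda>n. b (s, Z n s)) \<longlonglongrightarrow> b (s, X s)" by (rule LIM_zero_cancel)
          then show ?thesis using True sT by (simp add: Xc_def clamp_time_eq)
        qed simp
      qed
    qed
    then have "(\<lambda>n. G (k n) t) \<longlonglongrightarrow> (LINT s:{0..t}|lborel. b (s, X s))"
      by (simp add: G_def frozen_drift_def Z_def set_lebesgue_integral_def Xc_def b_clamped)
    moreover have "(\<lambda>n. G (k n) t) \<longlonglongrightarrow> g t"
    proof (rule LIMSEQ_I)
      fix e :: real assume "0 < e"
      then obtain n0 where "\<forall>n t. n \<ge> n0 \<and> t \<in> {0..T} \<longrightarrow> norm (G (k n) t - g t) < e" using unif by blast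
      then show "\<exists>n0. \<forall>n\<ge>n0. norm (G (k n) t - g t) < e" using t by (intro exI[of _ n0]) auto
    qed
    ultimately show ?thesis by (rule LIMSEQ_unique[symmetric])
  qed
  then have "solution x w X" unfolding solution_def using X by (auto simp: X_def)
  then show ?thesis by blast
qed

end

section \<open>Integrability and Borel versions of the bounds\<close>

lemma integrable_powr_of_Lq:
  assumes f: "f \<in> Lq_space N r" and fin: "finite_measure N" and q: "0 < q" "ereal q \<le> r"
  shows "integrable N (\<lambda>t. \<bar>f t\<bar> powr q)"
proof -
  interpret finite_measure N by fact
  have [measurable]: "f \<in> borel_measurable N" using f by (simp add: Lq_space_def)
  show ?thesis
  proof (cases "r = \<infinity>")
    case True
    then have ess: "esssup N (\<lambda>x. ereal \<bar>f x\<bar>) < \<infinity>" using f by (simp add: Lq_space_def)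
    obtain C where C: "esssup N (\<lambda>x. ereal \<bar>f x\<bar>) \<le> ereal C"
      using ess by (cases "esssup N (\<lambda>x. ereal \<bar>f x\<bar>)") auto
    have "AE x in N. ereal \<bar>f x\<bar> \<le> esssup N (\<lambda>x. ereal \<bar>f x\<bar>)" by (rule esssup_AE)
    then have "AE x in N. norm (\<bar>f x\<bar> powr q) \<le> \<bar>C\<bar> powr q"
    proof eventually_elim
      case (elim x)
      then have "ereal \<bar>f x\<bar> \<le> ereal C" using C by (rule order_trans)
      then show ?case using q by (simp add: powr_mono2)
    qed
    then show ?thesis by (rule integrable_const_bound) measurable
  next
    case False
    then obtain r' where r: "r = ereal r'" "q \<le> r'" using q by (cases r) auto
    then have int: "integrable N (\<lambda>x. \<bar>f x\<bar> powr r')" using f by (simp add: Lq_space_def)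
    show ?thesis
    proof (rule Bochner_Integration.integrable_bound[OF Bochner_Integration.integrable_add[OF integrable_const[of "1::real"] int]])
      have "\<bar>f x\<bar> powr q \<le> 1 + \<bar>f x\<bar> powr r'" for x
      proof (cases "\<bar>f x\<bar> \<le> 1")
        case True
        then have "\<bar>f x\<bar> powr q \<le> 1" using q by (intro powr_le1) auto
        then show ?thesis by (simp add: add_increasing2)
      next
        case False
        then have "\<bar>f x\<bar> powr q \<le> \<bar>f x\<bar> powr r'" using r by (intro powr_mono) auto
        then show ?thesis by simp
      qed
      then show "AE x in N. norm (\<bar>f x\<bar> powr q) \<le> norm (1 + \<bar>f x\<bar> powr r')" by (intro AE_I2) simp
    qed measurable
  qed
qed

lemma borel_version:
  fixes f :: "real \<Rightarrow> real"
  assumes f: "f \<in> borel_measurable (lebesgue_on {0..T})"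
  obtains g E where "g \<in> borel_measurable borel" "E \<in> null_sets lborel" "\<And>t. t \<in> {0..T} \<Longrightarrow> t \<notin> E \<Longrightarrow> f t = g t"
proof -
  have "(\<lambda>t. if t \<in> {0..T} then f t else 0) \<in> borel_measurable (completion lborel)"
    using f by (intro borel_measurable_if_I) auto
  from completion_ex_borel_measurable_real[OF this]
  obtain g where g: "g \<in> borel_measurable lborel" "AE t in lborel. (if t \<in> {0..T} then f t else 0) = g t" by blast
  from g(2) obtain E where E: "E \<in> null_sets lborel" "{t \<in> space lborel. (if t \<in> {0..T} then f t else 0) \<noteq> g t} \<subseteq> E"
    by (auto simp: eventually_ae_filter)
  show ?thesis
  proof (rule that[of g E])
    show "f t = g t" if "t \<in> {0..T}" "t \<notin> E" for t
    proof -
      have "(if t \<in> {0..T} then f t else 0) = g t"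
        by (rule ccontr) (use subsetD[OF E(2), of t] that(2) in simp)
      then show ?thesis unfolding if_P[OF that(1)] .
    qed
  qed (use g E in auto)
qed

theorem theorem3p1:
  fixes T \<beta> p1 p2 :: real
    and q1 q2 :: ereal
    and x :: "real ^ 'n"
    and P :: "'w measure"
    and W :: "real \<Rightarrow> 'w \<Rightarrow> real ^ 'n"
    and b :: "real \<times> (real ^ 'n) \<Rightarrow> real ^ 'n"
    and M1 M2 :: "real \<Rightarrow> real"
  assumes "T > 0"
    and "standard_brownian_motion P T W"
    and "b \<in> borel_measurable (restrict_space borel ({0..T} \<times> UNIV))"
    and "M1 \<in> Lq_space (lebesgue_on {0..T}) q1"
    and "\<forall>t\<in>{0..T}. \<forall>y. norm (b (t, y)) \<le> M1 t"
    and "M2 \<in> Lq_space (lebesgue_on {0..T}) q2"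
    and "\<forall>t\<in>{0..T}. \<forall>y z. norm (b (t, y) - b (t, z)) \<le> M2 t * norm (y - z) powr \<beta>"
    and "q1 \<ge> q2" and "q2 > 2" and "\<beta> > 0"
    and "1 / ereal p1 + 1 / q1 = 1" and "1 / ereal p2 + 1 / q2 = 1"
    and "\<beta> / p1 + 1 / p2 > 1"
  shows "\<exists>\<Omega>'\<in>sets P. measure P \<Omega>' = 1 \<and>
    (\<forall>\<omega>\<in>\<Omega>'. \<exists>!X. solves_integral_eq T x (\<lambda>t. W t \<omega>) b X)"
proof -
  note T = assms(1) and bm = assms(2) and b_meas = assms(3) and M1 = assms(4,5) and M2 = assms(6,7)
  define q where "q = (if q2 = \<infinity> then 3 else real_of_ereal q2)"
  have q: "2 < q" "ereal q \<le> q2"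
    using \<open>q2 > 2\<close> by (cases q2; auto simp: q_def)+
  \<comment> \<open>For points at distance at most 1 the Hoelder bound persists with a smaller exponent; for all others the bound by \<open>M1\<close> suffices.\<close>
  define \<gamma> where "\<gamma> = min \<beta> 1"
  have \<gamma>: "0 < \<gamma>" "\<gamma> \<le> 1" "\<gamma> \<le> \<beta>" using \<open>\<beta> > 0\<close> by (auto simp: \<gamma>_def)
  have fin: "finite_measure (lebesgue_on {0..T})"
    by (rule finite_measure_lebesgue_on) simp
  \<comment> \<open>The factor 3 leaves room for a difference of two values of \<open>b\<close>.\<close>
  define M0 where "M0 t = 3 * max \<bar>M1 t\<bar> \<bar>M2 t\<bar>" for t
  have [measurable]: "M1 \<in> borel_measurable (lebesgue_on {0..T})" "M2 \<in> borel_measurable (lebesgue_on {0..T})"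
    using M1(1) M2(1) by (auto simp: Lq_space_def)
  have M0_meas[measurable]: "M0 \<in> borel_measurable (lebesgue_on {0..T})" unfolding M0_def by measurable
  have M0_nonneg: "0 \<le> M0 t" for t by (simp add: M0_def)
  have M0_int: "integrable (lebesgue_on {0..T}) (\<lambda>t. M0 t powr q)"
  proof (rule Bochner_Integration.integrable_bound)
    show "integrable (lebesgue_on {0..T}) (\<lambda>t. 3 powr q * (\<bar>M1 t\<bar> powr q + \<bar>M2 t\<bar> powr q))"
      using q \<open>q1 \<ge> q2\<close>
      by (intro integrable_mult_right Bochner_Integration.integrable_add integrable_powr_of_Lq[OF M1(1) fin] integrable_powr_of_Lq[OF M2(1) fin]) auto
    have "M0 t powr q \<le> 3 powr q * (\<bar>M1 t\<bar> powr q + \<bar>M2 t\<bar> powr q)" for t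
      by (cases "\<bar>M1 t\<bar> \<le> \<bar>M2 t\<bar>") (auto simp: M0_def powr_mult max_def)
    then show "AE t in lebesgue_on {0..T}. norm (M0 t powr q) \<le> norm (3 powr q * (\<bar>M1 t\<bar> powr q + \<bar>M2 t\<bar> powr q))"
      by (intro AE_I2) (simp add: abs_mult)
  qed measurable
  have M0_bound: "norm (b (t, y)) \<le> M0 t" if "t \<in> {0..T}" for t y
  proof -
    have "norm (b (t, y)) \<le> M1 t" using M1(2) that by blast
    then show ?thesis unfolding M0_def by linarith
  qed
  have M0_holder: "norm (b (t, y) - b (t, z)) \<le> M0 t * norm (y - z) powr \<gamma>" if t: "t \<in> {0..T}" for t y z
  proof (cases "norm (y - z) \<le> 1")
    case True
    have "norm (b (t, y) - b (t, z)) \<le> M2 t * norm (y - z) powr \<beta>" using M2(2) t by blast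
    also have "\<dots> \<le> M0 t * norm (y - z) powr \<gamma>"
    proof (rule mult_mono)
      show "norm (y - z) powr \<beta> \<le> norm (y - z) powr \<gamma>" using True \<gamma> by (intro powr_mono') auto
      show "M2 t \<le> M0 t" unfolding M0_def by linarith
    qed (use M0_nonneg in auto)
    finally show ?thesis .
  next
    case False
    have "norm (b (t, y)) \<le> M1 t" "norm (b (t, z)) \<le> M1 t" using M1(2) t by blast+
    then have "norm (b (t, y) - b (t, z)) \<le> M0 t * 1"
      using norm_triangle_ineq4[of "b (t, y)" "b (t, z)"] unfolding M0_def by linarith
    also have "\<dots> \<le> M0 t * norm (y - z) powr \<gamma>"
      using False \<gamma> M0_nonneg by (intro mult_left_mono ge_one_powr_ge_zero) auto
    finally show ?thesis .
  qed
  obtain g E where g[measurable]: "g \<in> borel_measurable borel" and E: "E \<in> null_sets lborel"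
    and gE: "\<And>t. t \<in> {0..T} \<Longrightarrow> t \<notin> E \<Longrightarrow> M0 t = g t"
    using borel_version[OF M0_meas] by metis
  have Es[measurable]: "E \<in> sets borel" using E by auto
  \<comment> \<open>Outside \<open>A\<close> the drift is set to 0, which affects neither the integrability nor the integrals along a path.\<close>
  define A where "A = {0..T} - E"
  have A[measurable]: "A \<in> sets borel" by (simp add: A_def)
  define M where "M t = indicator A t * \<bar>g t\<bar>" for t
  have MA: "M t = M0 t" if "t \<in> A" for t using that gE[of t] M0_nonneg[of t] by (auto simp: M_def A_def)
  have MnA: "M t = 0" if "t \<notin> A" for t using that by (simp add: M_def)
  have AE_not_E: "AE t in lborel. t \<notin> E" by (rule AE_not_in[OF E])
  define b0 where "b0 p = indicator ({0..T} \<times> UNIV) p *\<^sub>R b p" for p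
  have b0_meas[measurable]: "b0 \<in> borel_measurable borel"
  proof -
    have "({0..T} \<times> (UNIV :: (real ^ 'n) set)) \<inter> space borel \<in> sets borel"
      by (simp add: borel_closed closed_Times)
    then show ?thesis using b_meas unfolding b0_def[abs_def] by (subst (asm) borel_measurable_restrict_space_iff) auto
  qed
  define b' where "b' p = indicator (A \<times> UNIV) p *\<^sub>R b0 p" for p
  have b'_eq: "b' (t, y) = (if t \<in> A then b (t, y) else 0)" for t y
    by (auto simp: b'_def b0_def A_def indicator_def)
  have b'_meas: "b' \<in> borel_measurable borel"
  proof -
    have "A \<times> (UNIV :: (real ^ 'n) set) \<in> sets (borel \<Otimes>\<^sub>M borel)" by (intro pair_measureI A) simp
    then have [measurable]: "A \<times> (UNIV :: (real ^ 'n) set) \<in> sets borel" by (simp only: borel_prod)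
    show ?thesis unfolding b'_def[abs_def] by measurable
  qed
  have AT: "t \<in> A \<Longrightarrow> t \<in> {0..T}" for t by (simp add: A_def)
  interpret brownian_drift T \<gamma> q b' M P W
  proof
    show "M \<in> borel_measurable borel" unfolding M_def by measurable
    show "M t = 0" if "t \<notin> {0..T}" for t using that AT by (intro MnA) blast
    show "integrable lborel (\<lambda>t. M t powr q)"
    proof -
      have "integrable lebesgue (\<lambda>t. indicator {0..T} t *\<^sub>R (M0 t powr q))"
        using M0_int by (subst (asm) integrable_restrict_space) auto
      moreover have "AE t in lebesgue. indicator {0..T} t *\<^sub>R (M0 t powr q) = M t powr q"
      proof (rule AE_completion)
        show "AE t in lborel. indicator {0..T} t *\<^sub>R (M0 t powr q) = M t powr q"
          using AE_not_E
        proof eventually_elim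
          case (elim t)
          then show ?case using MA[of t] MnA[of t] q by (cases "t \<in> {0..T}") (auto simp: A_def)
        qed
      qed
      moreover have m: "(\<lambda>t. M t powr q) \<in> borel_measurable lborel" unfolding M_def by measurable
      ultimately have "integrable lebesgue (\<lambda>t. M t powr q)"
        using integrable_cong_AE_imp measurable_completion by blast
      then show ?thesis using integrable_completion[OF m] by simp
    qed
    show "norm (b' (t, y)) \<le> M t" for t y
      using M0_bound AT MA MnA by (auto simp: b'_eq)
    show "norm (b' (t, y) - b' (t, z)) \<le> M t * norm (y - z) powr \<gamma>" for t y z
      using M0_holder AT MA MnA by (auto simp: b'_eq)
  qed (use T \<gamma> q bm b'_meas in \<open>auto simp: M_def\<close>)
  have eqint: "set_integrable lborel {0..t} (\<lambda>s. b (s, X s))"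
    "(LINT s:{0..t}|lborel. b (s, X s)) = (LINT s:{0..t}|lborel. b' (s, X s))"
    if X: "continuous_on {0..T} X" and t: "t \<in> {0..T}" for X t
  proof -
    define Xc where "Xc = (\<lambda>t. X (clamp_time t))"
    have Xc[measurable]: "Xc \<in> borel_measurable borel"
      unfolding Xc_def by (intro borel_measurable_continuous_onI continuous_clamped X)
    have pm: "(\<lambda>s. (s, Xc s)) \<in> borel_measurable borel"
      using measurable_Pair[of "\<lambda>s. s" borel borel Xc borel] by (simp add: borel_prod)
    have e1: "indicator {0..t} s *\<^sub>R b (s, X s) = indicator {0..t} s *\<^sub>R b0 (s, Xc s)" for s
      using t by (auto simp: indicator_def b0_def Xc_def clamp_time_eq)
    have m1: "(\<lambda>s. indicator {0..t} s *\<^sub>R b (s, X s)) \<in> borel_measurable lborel"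
      unfolding e1 using measurable_compose[OF pm b0_meas] by measurable
    have i2: "integrable lborel (\<lambda>s. indicator {0..t} s *\<^sub>R b' (s, Xc s))"
      using b_set_integrable[OF Xc, of "{0..t}"] by (simp add: set_integrable_def)
    have e2: "b' (s, Xc s) = b' (s, X s)" for s unfolding Xc_def by (rule b_clamped)
    have ae: "AE s in lborel. indicator {0..t} s *\<^sub>R b' (s, X s) = indicator {0..t} s *\<^sub>R b (s, X s)"
      using AE_not_E by eventually_elim (use t in \<open>auto simp: indicator_def b'_eq A_def\<close>)
    show "set_integrable lborel {0..t} (\<lambda>s. b (s, X s))"
      unfolding set_integrable_def using i2 unfolding e2 by (rule integrable_cong_AE_imp[OF _ m1]) (use ae in auto)
    have "(\<lambda>s. indicator {0..t} s *\<^sub>R b' (s, X s)) \<in> borel_measurable lborel" using i2 unfolding e2 by auto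
    then show "(LINT s:{0..t}|lborel. b (s, X s)) = (LINT s:{0..t}|lborel. b' (s, X s))"
      unfolding set_lebesgue_integral_def using ae by (intro integral_cong_AE m1) (auto elim: eventually_mono)
  qed
  have solves_iff: "solves_integral_eq T x w b X \<longleftrightarrow> X \<in> extensional {0..T} \<and> solution x w X" for w X
  proof (cases "continuous_on {0..T} X")
    case True
    then show ?thesis using eqint[OF True] T unfolding solves_integral_eq_def solution_def by auto
  qed (auto simp: solves_integral_eq_def solution_def)
  have restrict: "solution x w (restrict Y {0..T})" if Y: "solution x w Y" for w Y
  proof -
    have "(LINT s:{0..t}|lborel. b' (s, restrict Y {0..T} s)) = (LINT s:{0..t}|lborel. b' (s, Y s))" if "t \<in> {0..T}" for t
      using that by (intro set_lebesgue_integral_cong) auto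
    moreover have "continuous_on {0..T} (restrict Y {0..T})"
      by (rule continuous_on_eq[of _ Y]) (use Y in \<open>auto simp: solution_def\<close>)
    ultimately show ?thesis using Y unfolding solution_def by auto
  qed
  have unique: "\<exists>!X. solves_integral_eq T x (\<lambda>t. W t \<omega>) b X"
    if w: "\<omega> \<in> space P" and u: "\<forall>x Y Y'. solution x (\<lambda>t. W t \<omega>) Y \<longrightarrow> solution x (\<lambda>t. W t \<omega>) Y' \<longrightarrow> (\<forall>t\<in>{0..T}. Y t = Y' t)" for \<omega>
  proof -
    obtain Y where "solution x (\<lambda>t. W t \<omega>) Y" using solution_exists[OF W_cont[OF w]] by blast
    then have Y: "solves_integral_eq T x (\<lambda>t. W t \<omega>) b (restrict Y {0..T})"
      unfolding solves_iff using restrict by auto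
    show ?thesis
    proof (rule ex1I[of _ "restrict Y {0..T}"])
      show "solves_integral_eq T x (\<lambda>t. W t \<omega>) b (restrict Y {0..T})" by (rule Y)
      fix X assume "solves_integral_eq T x (\<lambda>t. W t \<omega>) b X"
      with Y u show "X = restrict Y {0..T}"
        unfolding solves_iff by (intro extensionalityI[of X "{0..T}"]) blast+
    qed
  qed
  obtain Nl where Nl: "{\<omega> \<in> space P. \<not> (\<forall>x Y Y'. solution x (\<lambda>t. W t \<omega>) Y \<longrightarrow> solution x (\<lambda>t. W t \<omega>) Y' \<longrightarrow> (\<forall>t\<in>{0..T}. Y t = Y' t))} \<subseteq> Nl"
    "emeasure P Nl = 0" "Nl \<in> sets P"
    by (rule AE_E[OF solutions_unique_AE])
  show ?thesis
  proof (intro bexI[of _ "space P - Nl"] conjI ballI)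
    show "measure P (space P - Nl) = 1" using P.prob_compl[OF Nl(3)] Nl(2) by (simp add: measure_def)
    show "\<exists>!X. solves_integral_eq T x (\<lambda>t. W t \<omega>) b X" if "\<omega> \<in> space P - Nl" for \<omega>
    proof (rule unique)
      show "\<omega> \<in> space P" using that by simp
      show "\<forall>x Y Y'. solution x (\<lambda>t. W t \<omega>) Y \<longrightarrow> solution x (\<lambda>t. W t \<omega>) Y' \<longrightarrow> (\<forall>t\<in>{0..T}. Y t = Y' t)"
        using that Nl(1) by blast
    qed
    show "space P - Nl \<in> sets P" using Nl(3) by auto
  qed
qed

end
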